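(* Let $u$ be a weak supersolution of $A_{\mu,p}u=0$ in $\Omega$ with $u\geq0$ in $B_R(x_0)\subset\Omega$. Suppose that $\zeta\geq0$ and that there exists $\sigma\in(0,1]$ such that $$|\{u\geq\zeta\}\cap B_r(x_0)|\geq\sigma|B_r(x_0)|,$$ for some $r\in(0,1]$ with $0<16r<R$. Then there exists a constant $\delta\in\left(0,\frac14\right)$ such that $$\operatorname*{ess\,inf}_{B_{4r}(x_0)}u\geq\delta\zeta-\left(\frac rR\right)^{\frac p{p-1}}\operatorname{Tail}(u_-;x_0,R).$$
   Context: Let $p\in(1,\infty)$ and let $\Omega\subset\mathbb{R}^N$ be a bounded domain. $\mu$ is a nonnegative finite Borel measure on $[0,1]$, nontrivial on $(0,1)$, with $\mu(\{0\})=0$ and $\alpha:=\mu(\{1\})>0$. $B_r(x_0)$ is the open ball of radius $r$ centered at $x_0$, $|\cdot|$ of a set is Lebesgue measure, and $u_-:=\max\{-u,0\}$. The operator is $A_{\mu,p}u=\int_{(0,1)}(-\Delta)_p^su\,d\mu(s)-\alpha\Delta_pu$ (fractional $p$-Laplacians and the $p$-Laplacian $\Delta_pu=\operatorname{div}(|\nabla u|^{p-2}\nabla u)$); (super)solutions are understood in the weak sense defined below. For $s\in(0,1)$ the normalization constant is $$C_{N,p,s}=\frac{\frac{sp}{2}(1-s)2^{2s-1}}{\pi^{\frac{N-1}{2}}}\,\frac{\Gamma\left(\frac{N+ps}{2}\right)}{\Gamma\left(\frac{p+1}{2}\right)\Gamma(2-s)}.$$ Tail: for $u\in L^{p-1}_{loc}(\mathbb{R}^N)$,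 $$\operatorname{Tail}(u;x_0,r)=\left[\int_{(0,1)}C_{N,p,s}\,r^{p}\left(\int_{\mathbb{R}^N\setminus B_r(x_0)}\frac{|u(y)|^{p-1}}{|y-x_0|^{N+sp}}\,dy\right)d\mu(s)\right]^{\frac1{p-1}}.$$ Tail space: $L^{p-1}_{sp,\mu}(\mathbb{R}^N)=\{u\in L^{p-1}_{loc}(\mathbb{R}^N):\operatorname{Tail}(u;x,r)<\infty\ \forall x\in\mathbb{R}^N,\ \forall r\in(0,\infty)\}$. For a bounded domain $\Omega'$, $W_0^{1,p}(\Omega')=\{v\in W^{1,p}(\Omega'):v=0\text{ in }\mathbb{R}^N\setminus\Omega'\}$. A function $u\in W^{1,p}_{loc}(\Omega)\cap L^{p-1}_{sp,\mu}(\mathbb{R}^N)$ is a weak supersolution of $A_{\mu,p}u=0$ in $\Omega$ if for every $\Omega'\Subset\Omega$ and every nonnegative $v\in W_0^{1,p}(\Omega')$ $$\int_{(0,1)}C_{N,p,s}\iint_{\mathbb{R}^{2N}}\frac{|u(x)-u(y)|^{p-2}(u(x)-u(y))(v(x)-v(y))}{|x-y|^{N+sp}}\,dx\,dy\,d\mu(s)+\alpha\int_\Omega|\nabla u|^{p-2}\nabla u\cdot\nabla v\,dx\geq0.$$ *)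

theory Defs
  imports "HOL-Probability.Essential_Supremum"
begin

text \<open>Throughout, \<open>\<real>\<^sup>N\<close> is a type \<open>'a::euclidean_space\<close> with \<open>N = DIM('a)\<close>, and functions on (subsets
  of) \<open>\<real>\<^sup>N\<close> are total functions that are Lebesgue (not necessarily Borel) measurable.\<close>

definition domain :: "'a::euclidean_space set \<Rightarrow> bool" where
  "domain \<Omega> \<longleftrightarrow> open \<Omega> \<and> connected \<Omega> \<and> \<Omega> \<noteq> {}"

definition compactly_inside :: "'a::euclidean_space set \<Rightarrow> 'a set \<Rightarrow> bool" where
  "compactly_inside \<Omega>' \<Omega> \<longleftrightarrow> compact (closure \<Omega>') \<and> closure \<Omega>' \<subseteq> \<Omega>"

text \<open>A function is of class \<open>C\<^sup>k\<^sup>+\<^sup>1\<close> iff it is differentiable everywhere and all its partial derivatives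
  are of class \<open>C\<^sup>k\<close>.\<close>

primrec C_k :: "nat \<Rightarrow> ('a::euclidean_space \<Rightarrow> real) \<Rightarrow> bool" where
  "C_k 0 f \<longleftrightarrow> continuous_on UNIV f"
| "C_k (Suc k) f \<longleftrightarrow> (\<forall>x. f differentiable at x) \<and>
     (\<forall>b\<in>Basis. C_k k (\<lambda>x. frechet_derivative f (at x) b))"

definition test_function :: "'a::euclidean_space set \<Rightarrow> ('a \<Rightarrow> real) \<Rightarrow> bool" where
  "test_function S \<phi> \<longleftrightarrow> (\<forall>k. C_k k \<phi>) \<and> (\<exists>K. compact K \<and> K \<subseteq> S \<and> (\<forall>x. x \<notin> K \<longrightarrow> \<phi> x = 0))"

definition Lp_on :: "real \<Rightarrow> 'a::euclidean_space set \<Rightarrow> ('a \<Rightarrow> 'b::euclidean_space) \<Rightarrow> bool" where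
  "Lp_on q S f \<longleftrightarrow> f \<in> borel_measurable (lebesgue_on S) \<and>
     integrable (lebesgue_on S) (\<lambda>x. norm (f x) powr q)"

definition Lp_loc :: "real \<Rightarrow> 'a::euclidean_space set \<Rightarrow> ('a \<Rightarrow> 'b::euclidean_space) \<Rightarrow> bool" where
  "Lp_loc q S f \<longleftrightarrow> (\<forall>K. compact K \<and> K \<subseteq> S \<longrightarrow> Lp_on q K f)"

definition is_weak_grad ::
    "'a::euclidean_space set \<Rightarrow> ('a \<Rightarrow> real) \<Rightarrow> ('a \<Rightarrow> 'a) \<Rightarrow> bool" where
  "is_weak_grad S u g \<longleftrightarrow> Lp_loc 1 S u \<and> Lp_loc 1 S g \<and>
     (\<forall>\<phi>. test_function S \<phi> \<longrightarrow> (\<forall>b\<in>Basis.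
        (LINT x:S|lebesgue. u x * frechet_derivative \<phi> (at x) b)
          = - (LINT x:S|lebesgue. (g x \<bullet> b) * \<phi> x)))"

text \<open>The weak gradient is unique up to null sets, and is only used inside integrals.\<close>

definition weak_grad :: "'a::euclidean_space set \<Rightarrow> ('a \<Rightarrow> real) \<Rightarrow> 'a \<Rightarrow> 'a" where
  "weak_grad S u = (SOME g. is_weak_grad S u g)"

definition W1p :: "real \<Rightarrow> 'a::euclidean_space set \<Rightarrow> ('a \<Rightarrow> real) \<Rightarrow> bool" where
  "W1p p S u \<longleftrightarrow> Lp_on p S u \<and> (\<exists>g. is_weak_grad S u g \<and> Lp_on p S g)"

definition W1p_loc :: "real \<Rightarrow> 'a::euclidean_space set \<Rightarrow> ('a \<Rightarrow> real) \<Rightarrow> bool" where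
  "W1p_loc p S u \<longleftrightarrow> Lp_loc p S u \<and> (\<exists>g. is_weak_grad S u g \<and> Lp_loc p S g)"

text \<open>Elements of \<open>W\<^sub>0\<^sup>1\<^sup>,\<^sup>p(\<Omega>')\<close> are functions on all of \<open>\<real>\<^sup>N\<close> vanishing outside \<open>\<Omega>'\<close>. Being Sobolev
  functions on \<open>\<real>\<^sup>N\<close>, rather than only on \<open>\<Omega>'\<close>, is what makes them vanish at the boundary: the
  indicator function of \<open>\<Omega>'\<close> is not admitted.\<close>

definition W1p_zero :: "real \<Rightarrow> 'a::euclidean_space set \<Rightarrow> ('a \<Rightarrow> real) \<Rightarrow> bool" where
  "W1p_zero p S v \<longleftrightarrow> W1p p UNIV v \<and> (AE x in lebesgue. x \<notin> S \<longrightarrow> v x = 0)"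

definition C_norm :: "real \<Rightarrow> real \<Rightarrow> real \<Rightarrow> real" where
  "C_norm N p s =
     (s * p / 2 * (1 - s) * 2 powr (2 * s - 1)) / (pi powr ((N - 1) / 2))
     * (Gamma ((N + p * s) / 2) / (Gamma ((p + 1) / 2) * Gamma (2 - s)))"

text \<open>\<open>Tail\<close> takes values in \<open>[0,\<infinity>]\<close>; the case distinction extends \<open>t \<mapsto> t\<^sup>1\<^sup>/\<^sup>(\<^sup>p\<^sup>-\<^sup>1\<^sup>)\<close> to \<open>t = \<infinity>\<close>.\<close>

definition Tail ::
    "real measure \<Rightarrow> real \<Rightarrow> ('a::euclidean_space \<Rightarrow> real) \<Rightarrow> 'a \<Rightarrow> real \<Rightarrow> ennreal" where
  "Tail \<mu> p u x\<^sub>0 r =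
     (let I = (\<integral>\<^sup>+s\<in>{0<..<1}. ennreal (C_norm (real DIM('a)) p s * r powr p) *
                (\<integral>\<^sup>+y\<in>- ball x\<^sub>0 r.
                   ennreal (\<bar>u y\<bar> powr (p - 1) / norm (y - x\<^sub>0) powr (real DIM('a) + s * p))
                 \<partial>lebesgue) \<partial>\<mu>)
      in if I = \<infinity> then \<infinity> else ennreal (enn2real I powr (1 / (p - 1))))"

definition tail_space :: "real measure \<Rightarrow> real \<Rightarrow> ('a::euclidean_space \<Rightarrow> real) \<Rightarrow> bool" where
  "tail_space \<mu> p u \<longleftrightarrow> Lp_loc (p - 1) UNIV u \<and> (\<forall>x. \<forall>r>0. Tail \<mu> p u x r < \<infinity>)"

definition nonlocal_form ::
    "real \<Rightarrow> real \<Rightarrow> ('a::euclidean_space \<Rightarrow> real) \<Rightarrow> ('a \<Rightarrow> real) \<Rightarrow> real" where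
  "nonlocal_form p s u v =
     (LINT z|(lebesgue :: ('a \<times> 'a) measure). (case z of (x, y) \<Rightarrow>
        \<bar>u x - u y\<bar> powr (p - 2) * (u x - u y) * (v x - v y)
          / norm (x - y) powr (real DIM('a) + s * p)))"

definition local_form ::
    "real \<Rightarrow> 'a::euclidean_space set \<Rightarrow> ('a \<Rightarrow> real) \<Rightarrow> ('a \<Rightarrow> real) \<Rightarrow> real" where
  "local_form p \<Omega> u v =
     (LINT x:\<Omega>|lebesgue. norm (weak_grad \<Omega> u x) powr (p - 2)
        * (weak_grad \<Omega> u x \<bullet> weak_grad UNIV v x))"

text \<open>\<open>\<alpha> = \<mu>({1})\<close> is the coefficient of the \<open>p\<close>-Laplacian.\<close>

definition weak_supersolution ::
    "real measure \<Rightarrow> real \<Rightarrow> 'a::euclidean_space set \<Rightarrow> ('a \<Rightarrow> real) \<Rightarrow> bool" where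
  "weak_supersolution \<mu> p \<Omega> u \<longleftrightarrow>
     W1p_loc p \<Omega> u \<and> tail_space \<mu> p u \<and>
     (\<forall>\<Omega>' v. domain \<Omega>' \<and> compactly_inside \<Omega>' \<Omega> \<and> W1p_zero p \<Omega>' v \<and> (AE x in lebesgue. 0 \<le> v x) \<longrightarrow>
        (LINT s:{0<..<1}|\<mu>. C_norm (real DIM('a)) p s * nonlocal_form p s u v)
          + measure \<mu> {1} * local_form p \<Omega> u v \<ge> 0)"

definition admissible_measure :: "real measure \<Rightarrow> bool" where
  "admissible_measure \<mu> \<longleftrightarrow>
     finite_measure \<mu> \<and> sets \<mu> = sets (restrict_space borel {0..1}) \<and>
     measure \<mu> {0<..<1} > 0 \<and> measure \<mu> {0} = 0 \<and> measure \<mu> {1} > 0"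

text \<open>The essential infimum over \<open>S\<close> with respect to Lebesgue measure.\<close>

definition ess_inf :: "'a::euclidean_space set \<Rightarrow> ('a \<Rightarrow> real) \<Rightarrow> ereal" where
  "ess_inf S u = - esssup (lebesgue_on S) (\<lambda>x. - ereal (u x))"

end

theory Submission
  imports Defs "HOL-Computational_Algebra.Polynomial"
begin

text \<open>Since \<open>\<alpha> > 0\<close>, it suffices to control the energy of the \<open>p\<close>-Laplacian; the nonlocal energy is only
  estimated from one side. Test the equation with \<open>\<phi>\<^sup>n (l - u)\<^sub>+\<close>, where \<open>\<phi>\<close> is a cutoff between \<open>B\<^sub>a\<close> and
  \<open>B\<^sub>b\<close> and \<open>n \<ge> p\<close>. For points of \<open>B\<^sub>R\<close>, where \<open>u \<ge> 0\<close>, Young's inequality bounds the interaction by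
  \<open>l\<^sup>p \<bar>\<phi> x - \<phi> y\<bar>\<^sup>p\<close>, whose integral against the kernel is of order \<open>1 / (s (1 - s))\<close> and is
  compensated by the normalization constant; the remaining interaction is bounded by the tail of \<open>u\<^sub>-\<close>. If
  \<open>\<delta>\<zeta>\<close> is at most the tail term, the claim is trivial; otherwise the tail costs no more than \<open>l\<^sup>p r\<^sup>-\<^sup>p\<close>
  for every level \<open>l \<ge> \<delta>\<zeta>\<close>, which gives the Caccioppoli inequality
  \<open>\<integral> \<bar>\<nabla>u\<bar>\<^sup>p \<le> C (l / (b - a))\<^sup>p \<bar>B\<^sub>b \<inter> {u < l}\<bar>\<close> over \<open>B\<^sub>a \<inter> {u < l}\<close>. De Giorgi's method then applies: among the
  levels \<open>2\<^sup>-\<^sup>j \<zeta>\<close> one finds by pigeonhole a small sublevel set in \<open>B\<^sub>6\<^sub>r\<close>, and an iteration over levels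
  decreasing from \<open>2\<delta>\<zeta>\<close> to \<open>\<delta>\<zeta>\<close> and radii from \<open>6r\<close> to \<open>4r\<close> removes it.

  All functional inequalities needed follow from the estimate of \<open>W(\<cdot> + h) - W\<close> in \<open>L\<^sup>1\<close> by
  \<open>\<bar>h\<bar>\<close> times the \<open>L\<^sup>1\<close>-norm of \<open>\<nabla>W\<close>, averaged over \<open>h\<close> in a ball.\<close>

section \<open>Smooth functions\<close>

text \<open>\<delta> is fixed before \<Omega>, u, r and \<zeta>, so every constant may depend only
  on p, \<mu>, \<sigma> and N. The two conditions on the radii make this possible. With r <= 1 the
  slope L of each cutoff is at least 1, and then all the powers L^(sp) with s in (0,1) are dominated
  by the single power L^p that belongs to the p-Laplacian. With 16r < R, a point x of B_8r and a
  point y outside B_R satisfy |y - \<open>x\<^sub>0\<close>| <= 2|x - y|, so interactions with the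
  exterior turn into a tail centred at \<open>x\<^sub>0\<close>. Since 0 <= u in B_R gives (l - u)_+
  <= l, the right-hand side of the Caccioppoli inequality is a power of l times the measure of a
  sublevel set. Young's inequality with a free weight then passes from the p-th power of the
  gradient to the gradient itself: weight 1 serves the iteration, a small weight makes the first
  sublevel set small. The superlinear exponent 1 + 1/N of the iteration stems from the radius of a
  ball with twice the measure of the sublevel set.\<close>

lemma C_k_Suc_imp: "C_k (Suc k) f \<Longrightarrow> C_k k f"
proof (induction k arbitrary: f)
  case 0
  then show ?case
    by (auto simp: continuous_on_eq_continuous_at intro: differentiable_imp_continuous_within)
next
  case (Suc k)
  then have "C_k k (\<lambda>x. frechet_derivative f (at x) b)" if "b \<in> Basis" for b
    using Suc.prems that by (intro Suc.IH) (simp only: C_k.simps(2)[of "Suc k"])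
  with Suc.prems show ?case by (simp only: C_k.simps(2)) blast
qed

lemma frechet_derivative_eqI:
  "(f has_derivative f') (at x) \<Longrightarrow> frechet_derivative f (at x) = f'"
  by (metis frechet_derivative_at)

lemma C_k_SucI:
  assumes "\<And>x. (f has_derivative f' x) (at x)" "\<And>b. b \<in> Basis \<Longrightarrow> C_k k (\<lambda>x. f' x b)"
  shows "C_k (Suc k) f"
proof -
  have "frechet_derivative f (at x) = f' x" for x
    using assms(1) by (rule frechet_derivative_eqI)
  then show ?thesis using assms by (auto simp: differentiable_def)
qed

lemma C_k_const [simp]: "C_k k (\<lambda>x. c)"
proof (induction k arbitrary: c)
  case (Suc k)
  show ?case by (rule C_k_SucI[where f'="\<lambda>x h. 0"]) (auto simp: Suc)
qed simp

lemma has_derivative_frechet: "C_k (Suc k) f \<Longrightarrow> (f has_derivative frechet_derivative f (at x)) (at x)"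
  by (simp add: frechet_derivative_works[symmetric])

lemma C_k_add: "C_k k f \<Longrightarrow> C_k k g \<Longrightarrow> C_k k (\<lambda>x. f x + g x)"
proof (induction k arbitrary: f g)
  case (Suc k)
  show ?case
    by (rule C_k_SucI, rule has_derivative_add, rule has_derivative_frechet[OF Suc(2)],
        rule has_derivative_frechet[OF Suc(3)])
      (use Suc in auto)
qed (auto intro: continuous_intros)

text \<open>The product rule keeps one factor undifferentiated; \<open>C_k_Suc_imp\<close> lowers
  its class to the one of the induction hypothesis.\<close>

lemma C_k_mult: "C_k k f \<Longrightarrow> C_k k g \<Longrightarrow> C_k k (\<lambda>x. f x * g x)"
proof (induction k arbitrary: f g)
  case (Suc k)
  show ?case
    by (rule C_k_SucI, rule has_derivative_mult, rule has_derivative_frechet[OF Suc(2)],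
        rule has_derivative_frechet[OF Suc(3)], rule C_k_add; rule Suc.IH)
      (use Suc.prems Suc.prems[THEN C_k_Suc_imp] in auto)
qed (auto intro: continuous_intros)

lemma C_k_power: "C_k k f \<Longrightarrow> C_k k (\<lambda>x. f x ^ n)"
  by (induction n) (auto intro: C_k_mult)

lemma C_k_comp:
  fixes \<theta> :: "real \<Rightarrow> real"
  shows "C_k k \<theta> \<Longrightarrow> C_k k q \<Longrightarrow> C_k k (\<lambda>x. \<theta> (q x))"
proof (induction k arbitrary: \<theta> q)
  case 0
  then show ?case
    by (auto intro: continuous_on_compose2)
next
  case (Suc k)
  \<comment> \<open>In one real variable the derivative is multiplication by its value at 1. This
    turns the chain rule into a product of two functions, to which \<open>C_k_mult\<close> and the
    induction hypothesis apply.\<close>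
  have lin: "frechet_derivative \<theta> (at t) z = frechet_derivative \<theta> (at t) 1 * z" for t z
    using has_derivative_frechet[OF Suc(2), THEN has_derivative_bounded_linear, THEN bounded_linear.linear]
    by (metis linear_cmul mult.commute mult.right_neutral real_scaleR_def)
  have "((\<lambda>x. \<theta> (q x)) has_derivative
      (\<lambda>h. frechet_derivative \<theta> (at (q x)) 1 * frechet_derivative q (at x) h)) (at x)" for x
    using has_derivative_compose[OF has_derivative_frechet[OF Suc(3)] has_derivative_frechet[OF Suc(2)], of x]
    by (subst (asm) lin)
  then show ?case
  proof (rule C_k_SucI)
    fix b :: 'a assume "b \<in> Basis"
    then show "C_k k (\<lambda>x. frechet_derivative \<theta> (at (q x)) 1 * frechet_derivative q (at x) b)"
      using Suc.prems Suc.prems(2)[THEN C_k_Suc_imp]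
      by (intro C_k_mult Suc.IH[of "\<lambda>y. frechet_derivative \<theta> (at y) 1" q]) auto
  qed
qed

text \<open>Covers the translates of test functions, with c = 1, and the reflection 1 - t in the
  construction of the step function, with c = -1.\<close>

lemma C_k_affine:
  fixes f :: "'a::euclidean_space \<Rightarrow> real"
  shows "C_k k f \<Longrightarrow> C_k k (\<lambda>x. f (c *\<^sub>R x + a))"
proof (induction k arbitrary: f)
  case 0
  then show ?case
    by (auto intro!: continuous_on_compose2[of UNIV f] continuous_intros)
next
  case (Suc k)
  have lin: "frechet_derivative f (at y) (c *\<^sub>R h) = c * frechet_derivative f (at y) h" for y h
    using has_derivative_frechet[OF Suc(2), THEN has_derivative_bounded_linear, THEN bounded_linear.linear]
    by (simp add: linear_cmul)
  have "((\<lambda>x. f (c *\<^sub>R x + a)) has_derivative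
      (\<lambda>h. c * frechet_derivative f (at (c *\<^sub>R x + a)) h)) (at x)" for x
    unfolding lin[symmetric]
    by (rule has_derivative_compose[of "\<lambda>x. c *\<^sub>R x + a", OF _ has_derivative_frechet[OF Suc(2)]])
      (auto intro!: derivative_eq_intros)
  then show ?case
  proof (rule C_k_SucI)
    fix b :: 'a assume "b \<in> Basis"
    then show "C_k k (\<lambda>x. c * frechet_derivative f (at (c *\<^sub>R x + a)) b)"
      using Suc.prems by (intro C_k_mult Suc.IH[of "\<lambda>y. frechet_derivative f (at y) b"]) auto
  qed
qed

lemma C_k_inner: "C_k k (\<lambda>x. x \<bullet> b)"
  by (cases k) (auto intro!: C_k_SucI[where f'="\<lambda>x h. h \<bullet> b"] continuous_intros derivative_eq_intros
      simp del: C_k.simps(2))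

lemma C_k_inner_self: "C_k k (\<lambda>x::'a::euclidean_space. x \<bullet> x)"
proof -
  have "C_k k (\<lambda>x::'a. \<Sum>b\<in>B. (x \<bullet> b) * (x \<bullet> b))" if "finite B" for B
    using that by (induction B) (auto intro!: C_k_add C_k_mult C_k_inner)
  then show ?thesis by (subst euclidean_inner) auto
qed

section \<open>Gradients of smooth functions\<close>

definition smooth :: "('a::euclidean_space \<Rightarrow> real) \<Rightarrow> bool" where
  "smooth f \<longleftrightarrow> (\<forall>k. C_k k f)"

definition grad :: "('a::euclidean_space \<Rightarrow> real) \<Rightarrow> 'a \<Rightarrow> 'a" where
  "grad f x = (\<Sum>b\<in>Basis. frechet_derivative f (at x) b *\<^sub>R b)"

lemma grad_inner_Basis: "b \<in> Basis \<Longrightarrow> grad f x \<bullet> b = frechet_derivative f (at x) b"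
  unfolding grad_def by (rule inner_sum_left_Basis)

lemma grad_eqI: "(f has_derivative (\<lambda>h. v \<bullet> h)) (at x) \<Longrightarrow> grad f x = v"
  by (simp add: grad_def frechet_derivative_eqI euclidean_representation)

lemma has_derivative_grad:
  assumes "f differentiable at x"
  shows "(f has_derivative (\<lambda>h. grad f x \<bullet> h)) (at x)"
proof -
  have d: "(f has_derivative frechet_derivative f (at x)) (at x)"
    using assms by (simp add: frechet_derivative_works)
  then have "linear (frechet_derivative f (at x))"
    by (intro bounded_linear.linear has_derivative_bounded_linear)
  then have "frechet_derivative f (at x) h = grad f x \<bullet> h" for h
    by (subst euclidean_representation[symmetric, of h])
      (simp add: linear_sum linear_cmul grad_def inner_sum_left inner_sum_right inner_commute mult.commute
        del: euclidean_representation)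
  then have "frechet_derivative f (at x) = (\<lambda>h. grad f x \<bullet> h)" by auto
  with d show ?thesis by simp
qed

lemma smooth_has_derivative: "smooth f \<Longrightarrow> (f has_derivative (\<lambda>h. grad f x \<bullet> h)) (at x)"
  unfolding smooth_def by (rule has_derivative_grad) (drule spec[of _ "Suc 0"], simp)

lemma smooth_mult: "smooth f \<Longrightarrow> smooth g \<Longrightarrow> smooth (\<lambda>x. f x * g x)"
  by (simp add: smooth_def C_k_mult)
lemma smooth_power: "smooth f \<Longrightarrow> smooth (\<lambda>x. f x ^ n)"
  by (simp add: smooth_def C_k_power)
lemma smooth_affine: "smooth f \<Longrightarrow> smooth (\<lambda>x. f (c *\<^sub>R x + a))"
  by (simp add: smooth_def C_k_affine)

lemma smooth_continuous: "smooth f \<Longrightarrow> continuous_on S f"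
  unfolding smooth_def by (drule spec[of _ 0]) (auto intro: continuous_on_subset)

lemma smooth_grad_continuous: "smooth f \<Longrightarrow> continuous_on S (grad f)"
  unfolding smooth_def grad_def
  by (drule spec[of _ "Suc 0"], rule continuous_on_subset[OF _ subset_UNIV])
    (auto intro!: continuous_on_sum continuous_on_scaleR)

lemma grad_mult:
  assumes "smooth f" "smooth g"
  shows "grad (\<lambda>x. f x * g x) x = f x *\<^sub>R grad g x + g x *\<^sub>R grad f x"
  by (rule grad_eqI, rule has_derivative_eq_rhs,
      rule has_derivative_mult[OF smooth_has_derivative[OF assms(1)] smooth_has_derivative[OF assms(2)]])
    (auto simp: algebra_simps)

lemma grad_power:
  assumes "smooth f"
  shows "grad (\<lambda>x. f x ^ n) x = (real n * f x ^ (n - 1)) *\<^sub>R grad f x"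
  by (rule grad_eqI, rule has_derivative_eq_rhs,
      rule has_derivative_power[OF smooth_has_derivative[OF assms(1)]])
    (auto simp: algebra_simps)

lemma grad_affine:
  assumes "smooth f"
  shows "grad (\<lambda>x. f (c *\<^sub>R x + a)) x = c *\<^sub>R grad f (c *\<^sub>R x + a)"
proof (rule grad_eqI)
  have "((\<lambda>x. f (c *\<^sub>R x + a)) has_derivative (\<lambda>h. grad f (c *\<^sub>R x + a) \<bullet> (c *\<^sub>R h))) (at x)"
    by (rule has_derivative_compose[of "\<lambda>x. c *\<^sub>R x + a", OF _ smooth_has_derivative[OF assms]])
      (auto intro!: derivative_eq_intros)
  then show "((\<lambda>x. f (c *\<^sub>R x + a)) has_derivative (\<bullet>) (c *\<^sub>R grad f (c *\<^sub>R x + a))) (at x)"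
    by (rule has_derivative_eq_rhs) (simp add: fun_eq_iff)
qed

lemma grad_zero_outside:
  assumes "closed K" "\<And>x. x \<notin> K \<Longrightarrow> f x = 0" "x \<notin> K"
  shows "grad f x = 0"
proof (rule grad_eqI)
  have "((\<lambda>_. 0::real) has_derivative (\<bullet>) 0) (at x)" by (rule has_derivative_eq_rhs[OF has_derivative_const]) auto
  then show "(f has_derivative (\<bullet>) 0) (at x)"
    by (rule has_derivative_transform_within_open[OF _ open_Compl[OF \<open>closed K\<close>]]) (use assms in auto)
qed

lemma grad_const_open:
  assumes "open S" "\<And>x. x \<in> S \<Longrightarrow> f x = c" "x \<in> S"
  shows "grad f x = 0"
proof (rule grad_eqI)
  have "((\<lambda>_. c) has_derivative (\<bullet>) 0) (at x)" by (rule has_derivative_eq_rhs[OF has_derivative_const]) auto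
  then show "(f has_derivative (\<bullet>) 0) (at x)"
    by (rule has_derivative_transform_within_open[OF _ \<open>open S\<close>]) (use assms in auto)
qed

section \<open>A smooth step function and radial cutoffs\<close>

lemma poly_exp_tendsto_0: "((\<lambda>t::real. poly P (1/t) * exp (-1/t)) \<longlongrightarrow> 0) (at_right 0)"
proof -
  have "((\<lambda>y::real. \<Sum>i\<le>degree P. coeff P i * (y ^ i / exp y)) \<longlongrightarrow> (\<Sum>i\<le>degree P. coeff P i * 0)) at_top"
    by (intro tendsto_intros tendsto_power_div_exp_0)
  then have "((\<lambda>y::real. poly P y * exp (- y)) \<longlongrightarrow> 0) at_top"
    by (simp add: poly_altdef sum_distrib_right exp_minus divide_inverse mult.assoc)
  then have "((\<lambda>t::real. poly P (inverse t) * exp (- inverse t)) \<longlongrightarrow> 0) (at_right 0)"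
    by (rule filterlim_compose[OF _ filterlim_inverse_at_top_right])
  then show ?thesis by (simp add: field_simps)
qed

text \<open>These functions are closed under differentiation, which is why they carry a polynomial factor.\<close>

definition flat :: "real poly \<Rightarrow> real \<Rightarrow> real" where
  "flat P t = (if t \<le> 0 then 0 else poly P (1/t) * exp (-1/t))"

text \<open>With y = 1/t and dy/dt = - y^2, the derivative of P(y) exp(-y) is y^2 (P - P')(y)
  exp(-y); \<open>[:0,0,1:]\<close> is the polynomial y^2.\<close>

lemma flat_deriv: "(flat P has_real_derivative flat ((P - pderiv P) * [:0,0,1:]) t) (at t)"
proof -
  consider "t < 0" | "t > 0" | "t = 0" by linarith
  then show ?thesis
  proof cases
    case 1
    have "((\<lambda>t. 0) has_real_derivative 0) (at t)" by simp
    then have "(flat P has_real_derivative 0) (at t)"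
      by (rule has_field_derivative_transform_within_open[where S="{..<0}"]) (use 1 in \<open>auto simp: flat_def\<close>)
    with 1 show ?thesis by (simp add: flat_def)
  next
    case 2
    have "((\<lambda>t. poly P (1/t) * exp (-1/t)) has_real_derivative
        poly ((P - pderiv P) * [:0,0,1:]) (1/t) * exp (-1/t)) (at t)"
      using 2 by (auto intro!: derivative_eq_intros simp: field_simps power2_eq_square)
    then have "(flat P has_real_derivative poly ((P - pderiv P) * [:0,0,1:]) (1/t) * exp (-1/t)) (at t)"
      by (rule has_field_derivative_transform_within_open[where S="{0<..}"]) (use 2 in \<open>auto simp: flat_def\<close>)
    with 2 show ?thesis by (simp add: flat_def del: poly_mult)
  next
    case 3
    \<comment> \<open>Dividing by h multiplies by y = 1/h, so the quotient is again a polynomial in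
      y times exp(-y).\<close>
    have "((\<lambda>h. flat P h / h) \<longlongrightarrow> 0) (at_right 0)"
      by (rule Lim_transform_eventually[OF poly_exp_tendsto_0[of "P * [:0,1:]"]])
        (auto simp: flat_def eventually_at_right_field intro!: exI[of _ 1])
    moreover have "((\<lambda>h. flat P h / h) \<longlongrightarrow> 0) (at_left 0)"
      by (rule Lim_transform_eventually[OF tendsto_const])
        (auto simp: flat_def eventually_at_left_field intro!: exI[of _ "-1"])
    ultimately have "((\<lambda>h. flat P h / h) \<longlongrightarrow> 0) (at 0)"
      by (rule filterlim_split_at_real[rotated])
    then show ?thesis using 3 by (simp add: DERIV_def flat_def)
  qed
qed

lemma C_k_real_SucI:
  fixes f :: "real \<Rightarrow> real"
  assumes "\<And>x. (f has_real_derivative f' x) (at x)" "C_k k f'"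
  shows "C_k (Suc k) f"
  by (rule C_k_SucI[OF assms(1)[unfolded has_field_derivative_def]]) (use assms in auto)

lemma smooth_flat: "smooth (flat P)"
proof -
  have "C_k k (flat P)" for k
  proof (induction k arbitrary: P)
    case 0
    show ?case using flat_deriv[of P]
      by (auto simp: continuous_on_eq_continuous_at intro!: DERIV_isCont)
  next
    case (Suc k)
    then show ?case by (intro C_k_real_SucI[OF flat_deriv])
  qed
  then show ?thesis by (simp add: smooth_def)
qed

text \<open>The step is the normalized primitive of the bump \<open>g\<close>, which is positive on
  (0,1) and 0 elsewhere. The bound on its derivative is recorded because it determines the slope of
  every cutoff.\<close>

lemma smooth_step_exists:
  "\<exists>\<theta> \<theta>' :: real \<Rightarrow> real. \<exists>L. smooth \<theta> \<and> (\<forall>t. (\<theta> has_real_derivative \<theta>' t) (at t)) \<and>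
     (\<forall>t\<le>0. \<theta> t = 0 \<and> \<theta>' t = 0) \<and> (\<forall>t\<ge>1. \<theta> t = 1) \<and> (\<forall>t. 0 \<le> \<theta> t \<and> \<theta> t \<le> 1) \<and> (\<forall>t. \<bar>\<theta>' t\<bar> \<le> L)"
proof -
  define g where "g t = flat 1 t * flat 1 (1 - t)" for t
  have sg: "smooth g"
    unfolding g_def using smooth_affine[OF smooth_flat, of 1 "-1" 1] by (auto intro!: smooth_mult smooth_flat)
  have g0: "g t = 0" if "t \<le> 0 \<or> t \<ge> 1" for t using that by (auto simp: g_def flat_def)
  have gnn: "g t \<ge> 0" for t by (auto simp: g_def flat_def)
  have gpos: "g t > 0" if "0 < t" "t < 1" for t using that by (auto simp: g_def flat_def)
  have "\<exists>F. \<forall>x::real. - \<infinity> < ereal x \<longrightarrow> ereal x < \<infinity> \<longrightarrow> (F has_vector_derivative g x) (at x)"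
    using smooth_continuous[OF sg, of UNIV]
    by (intro einterval_antiderivative) (auto simp: continuous_on_eq_continuous_at)
  then obtain F where F: "(F has_real_derivative g x) (at x)" for x
    by (auto simp: has_real_derivative_iff_has_vector_derivative)
  have mono: "F x \<le> F y" if "x \<le> y" for x y
    by (rule DERIV_nonneg_imp_nondecreasing[OF that]) (use F gnn in blast)
  have cF: "continuous_on A F" for A
    using F by (auto intro!: continuous_at_imp_continuous_on DERIV_isCont)
  have strict: "F 0 < F 1"
  proof (rule DERIV_pos_imp_increasing_open[of 0 1 F])
    show "\<exists>y. (F has_real_derivative y) (at x) \<and> 0 < y" if "0 < x" "x < 1" for x
      using F[of x] gpos[OF that] by blast
  qed (use cF in auto)
  have F_const: "F t = F s" if "s < t" "t \<le> 0 \<or> 1 \<le> s" for s t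
  proof (rule DERIV_isconst_end[OF \<open>s < t\<close> cF])
    fix x assume "s < x" "x < t"
    then have "g x = 0" using that g0[of x] by auto
    then show "(F has_real_derivative 0) (at x)" using F[of x] by simp
  qed
  have F0: "F t = F 0" if "t \<le> 0" for t using F_const[of t 0] that by (cases "t = 0") auto
  have F1: "F t = F 1" if "t \<ge> 1" for t using F_const[of 1 t] that by (cases "t = 1") auto
  obtain M where M: "\<And>t. t \<in> {0..1} \<Longrightarrow> g t \<le> M"
    using continuous_attains_sup[of "{0..1::real}" g] smooth_continuous[OF sg, of "{0..1}"] by fastforce
  have M0: "M \<ge> 0" using M[of 0] gnn[of 0] by auto
  have gM: "g t \<le> M" for t
    using M[of t] g0[of t] M0 by (cases "t \<in> {0..1}") auto
  define \<theta> where "\<theta> t = (F t - F 0) / (F 1 - F 0)" for t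
  define \<theta>' where "\<theta>' t = 1 / (F 1 - F 0) * g t" for t
  have d: "(\<theta> has_real_derivative \<theta>' t) (at t)" for t
    unfolding \<theta>_def \<theta>'_def using F[of t] strict by (auto intro!: derivative_eq_intros)
  have "C_k k \<theta>'" for k unfolding \<theta>'_def using sg by (intro C_k_mult C_k_const) (auto simp: smooth_def)
  then have "C_k k \<theta>" for k by (rule C_k_Suc_imp[OF C_k_real_SucI[OF d]])
  then have "smooth \<theta>" by (simp add: smooth_def)
  moreover have "\<theta> t = 0 \<and> \<theta>' t = 0" if "t \<le> 0" for t using F0[OF that] g0 that by (auto simp: \<theta>_def \<theta>'_def)
  moreover have one: "\<theta> t = 1" if "t \<ge> 1" for t using F1[OF that] strict by (auto simp: \<theta>_def)
  moreover have "0 \<le> \<theta> t \<and> \<theta> t \<le> 1" for t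
  proof -
    have "F 0 \<le> F t" using mono[of 0 t] F0[of t] by (cases "t \<le> 0") auto
    moreover have "F t \<le> F 1" using mono[of t 1] F1[of t] by (cases "t \<ge> 1") auto
    ultimately show ?thesis using strict by (auto simp: \<theta>_def)
  qed
  moreover have "\<bar>\<theta>' t\<bar> \<le> 1 / (F 1 - F 0) * M" for t
    using gM[of t] gnn[of t] strict by (auto simp: \<theta>'_def abs_mult divide_right_mono)
  ultimately show ?thesis using d by blast
qed

definition cutoff :: "'a::euclidean_space \<Rightarrow> real \<Rightarrow> real \<Rightarrow> real \<Rightarrow> ('a \<Rightarrow> real) \<Rightarrow> bool" where
  "cutoff x\<^sub>0 a b L \<phi> \<longleftrightarrow> smooth \<phi> \<and> (\<forall>x. 0 \<le> \<phi> x \<and> \<phi> x \<le> 1) \<and> (\<forall>x\<in>cball x\<^sub>0 a. \<phi> x = 1) \<and>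
     (\<forall>x. x \<notin> ball x\<^sub>0 b \<longrightarrow> \<phi> x = 0) \<and> (\<forall>x. norm (grad \<phi> x) \<le> L)"

text \<open>The step is composed with a quadratic function of x instead of |x -
  \<open>x\<^sub>0\<close>|, which keeps it smooth at the centre. The gradient is at most 2 L |x -
  \<open>x\<^sub>0\<close>| / (b^2 - a^2), and this is still of order 1 / (b - a) because b <= b +
  a. Hence \<Lambda> is the same for all centres and radii.\<close>

lemma cutoff_exists:
  "\<exists>\<Lambda>\<ge>1. \<forall>(x\<^sub>0::'a::euclidean_space) a b. 0 < a \<longrightarrow> a < b \<longrightarrow> (\<exists>\<phi>. cutoff x\<^sub>0 a b (\<Lambda> / (b - a)) \<phi>)"
proof -
  obtain \<theta> \<theta>' :: "real \<Rightarrow> real" and L where \<theta>: "smooth \<theta>" "\<And>t. (\<theta> has_real_derivative \<theta>' t) (at t)"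
     "\<And>t. t\<le>0 \<Longrightarrow> \<theta> t = 0 \<and> \<theta>' t = 0" "\<And>t. t \<ge> 1 \<Longrightarrow> \<theta> t = 1" "\<And>t. 0 \<le> \<theta> t \<and> \<theta> t \<le> 1" "\<And>t. \<bar>\<theta>' t\<bar> \<le> L"
    using smooth_step_exists by metis
  define \<Lambda> where "\<Lambda> = max 1 (2 * L)"
  have L0: "0 \<le> L" using \<theta>(6)[of 0] by simp
  have "\<exists>\<phi>. cutoff x\<^sub>0 a b (\<Lambda> / (b - a)) \<phi>" if ab: "0 < a" "a < b" for x\<^sub>0 :: 'a and a b
  proof -
    define c where "c = 1 / (b^2 - a^2)"
    have ab2: "b^2 - a^2 > 0" using ab by (simp add: power2_eq_square mult_strict_mono)
    \<comment> \<open>Written in the shape of \<open>C_k_affine\<close>; the next fact shows the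
      formula that is meant.\<close>
    define q where "q x = b^2 * c + (- c) * ((1 *\<^sub>R x + - x\<^sub>0) \<bullet> (1 *\<^sub>R x + - x\<^sub>0))" for x
    have q: "q x = (b^2 - (norm (x - x\<^sub>0))^2) / (b^2 - a^2)" for x
      unfolding q_def c_def by (simp add: power2_norm_eq_inner diff_divide_distrib)
    define \<phi> where "\<phi> x = \<theta> (q x)" for x
    have "C_k k q" for k
      unfolding q_def by (rule C_k_add[OF C_k_const C_k_mult[OF C_k_const C_k_affine[OF C_k_inner_self]]])
    then have 1: "smooth \<phi>" unfolding smooth_def \<phi>_def using \<theta>(1) C_k_comp unfolding smooth_def by blast
    have dq: "(q has_derivative (\<lambda>h. (-2 * c) * ((x - x\<^sub>0) \<bullet> h))) (at x)" for x
      unfolding q_def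
      by (auto intro!: derivative_eq_intros simp: inner_commute algebra_simps)
    have gr: "grad \<phi> x = (\<theta>' (q x) * (-2 * c)) *\<^sub>R (x - x\<^sub>0)" for x
    proof (rule grad_eqI)
      have "(\<phi> has_derivative (\<lambda>h. \<theta>' (q x) * ((-2 * c) * ((x - x\<^sub>0) \<bullet> h)))) (at x)"
        unfolding \<phi>_def using has_derivative_compose[OF dq \<theta>(2)[unfolded has_field_derivative_def]] .
      then show "(\<phi> has_derivative (\<bullet>) ((\<theta>' (q x) * (-2 * c)) *\<^sub>R (x - x\<^sub>0))) (at x)"
        by (rule has_derivative_eq_rhs) (simp add: fun_eq_iff mult.assoc)
    qed
    have 2: "\<phi> x = 1" if "x \<in> cball x\<^sub>0 a" for x
    proof -
      have "(norm (x - x\<^sub>0))^2 \<le> a^2" using that ab by (intro power_mono) (auto simp: dist_norm norm_minus_commute)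
      then show ?thesis using ab2 by (auto simp: \<phi>_def q intro!: \<theta>)
    qed
    have q0: "q x \<le> 0" if "x \<notin> ball x\<^sub>0 b" for x
    proof -
      have "b^2 \<le> (norm (x - x\<^sub>0))^2" using that ab by (intro power_mono) (auto simp: dist_norm norm_minus_commute)
      then show ?thesis using ab2 by (auto simp: q divide_le_0_iff)
    qed
    have 3: "\<phi> x = 0" if "x \<notin> ball x\<^sub>0 b" for x using q0[OF that] \<theta> by (auto simp: \<phi>_def)
    have 4: "norm (grad \<phi> x) \<le> \<Lambda> / (b - a)" for x
    proof (cases "x \<in> ball x\<^sub>0 b")
      case False
      then show ?thesis using q0[OF False] \<theta>(3) ab by (simp add: gr \<Lambda>_def)
    next
      case True
      have "norm (grad \<phi> x) = \<bar>\<theta>' (q x)\<bar> * (2 / (b^2 - a^2)) * norm (x - x\<^sub>0)"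
        using ab2 by (simp add: gr abs_mult c_def)
      also have "\<dots> \<le> L * (2 / (b^2 - a^2)) * b"
        using True \<theta>(6)[of "q x"] ab2 L0 by (intro mult_mono) (auto simp: dist_norm norm_minus_commute)
      also have "\<dots> = (2 * L / (b - a)) * (b / (b + a))"
        using ab ab2 by (simp add: power2_eq_square square_diff_square_factored mult_ac)
      also have "\<dots> \<le> (2 * L / (b - a)) * 1" using ab L0 by (intro mult_left_mono) auto
      also have "\<dots> \<le> \<Lambda> / (b - a)" using ab by (simp add: \<Lambda>_def divide_right_mono)
      finally show ?thesis .
    qed
    have 5: "0 \<le> \<phi> x \<and> \<phi> x \<le> 1" for x unfolding \<phi>_def by (rule \<theta>(5))
    show ?thesis unfolding cutoff_def using 1 2 3 4 5 by blast
  qed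
  moreover have "1 \<le> \<Lambda>" by (simp add: \<Lambda>_def)
  ultimately show ?thesis by blast
qed

section \<open>Continuity of translations in the mean\<close>

lemma integrable_shift:
  fixes f :: "'a::euclidean_space \<Rightarrow> 'b::{banach, second_countable_topology}"
  assumes "integrable lborel f"
  shows "integrable lborel (\<lambda>x. f (x + h))"
proof -
  have "integrable (distr lborel borel ((+) h)) f" using assms by (simp add: lborel_distr_plus)
  then have "integrable lborel (\<lambda>x. f (h + x))"
    using borel_measurable_integrable[OF assms] by (subst (asm) integrable_distr_eq) auto
  then show ?thesis by (simp add: add.commute)
qed

lemma nn_integral_shift:
  fixes f :: "'a::euclidean_space \<Rightarrow> ennreal"
  assumes "f \<in> borel_measurable borel"
  shows "(\<integral>\<^sup>+x. f (x + h) \<partial>lborel) = (\<integral>\<^sup>+x. f x \<partial>lborel)"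
proof -
  have "(\<integral>\<^sup>+x. f x \<partial>distr lborel borel ((+) h)) = (\<integral>\<^sup>+x. f (h + x) \<partial>lborel)"
    using assms by (subst nn_integral_distr) auto
  then show ?thesis by (simp add: lborel_distr_plus add.commute)
qed

lemma integral_shift:
  fixes f :: "'a::euclidean_space \<Rightarrow> 'b::{banach, second_countable_topology}"
  assumes "f \<in> borel_measurable borel"
  shows "(\<integral>x. f (x + h) \<partial>lborel) = (\<integral>x. f x \<partial>lborel)"
proof -
  have "(\<integral>x. f x \<partial>distr lborel borel ((+) h)) = (\<integral>x. f (h + x) \<partial>lborel)"
    using assms by (subst integral_distr) auto
  then show ?thesis by (simp add: lborel_distr_plus add.commute)
qed

lemma integrable_mult_bounded:
  fixes f g :: "'a \<Rightarrow> real"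
  assumes "integrable M f" "g \<in> borel_measurable M" "\<And>x. \<bar>g x\<bar> \<le> B"
  shows "integrable M (\<lambda>x. f x * g x)"
proof (rule Bochner_Integration.integrable_bound)
  show "integrable M (\<lambda>x. B * f x)" using assms by simp
  show "AE x in M. norm (f x * g x) \<le> norm (B * f x)"
  proof (rule AE_I2)
    fix x
    have "\<bar>g x\<bar> \<le> \<bar>B\<bar>" using assms(3)[of x] by linarith
    then show "norm (f x * g x) \<le> norm (B * f x)"
      by (simp add: abs_mult) (metis abs_ge_zero mult.commute mult_right_mono)
  qed
qed (use assms in auto)

text \<open>The modulus of continuity of f in the mean.\<close>

definition modL1 :: "('a::euclidean_space \<Rightarrow> real) \<Rightarrow> 'a \<Rightarrow> real" where
  "modL1 f h = (\<integral>x. \<bar>f (x + h) - f x\<bar> \<partial>lborel)"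

lemma modL1_integrable:
  fixes f :: "'a::euclidean_space \<Rightarrow> real"
  shows "integrable lborel f \<Longrightarrow> integrable lborel (\<lambda>x. \<bar>f (x + h) - f x\<bar>)"
  using integrable_shift[of f h] by auto

lemma modL1_nonneg: "0 \<le> modL1 f h"
  by (simp add: modL1_def)

lemma modL1_add:
  assumes "integrable lborel f" "integrable lborel g"
  shows "modL1 (\<lambda>x. f x + g x) h \<le> modL1 f h + modL1 g h"
proof -
  have "modL1 (\<lambda>x. f x + g x) h \<le> (\<integral>x. \<bar>f (x + h) - f x\<bar> + \<bar>g (x + h) - g x\<bar> \<partial>lborel)"
    unfolding modL1_def using assms
    by (intro integral_mono Bochner_Integration.integrable_add modL1_integrable) auto
  also have "\<dots> = modL1 f h + modL1 g h"
    unfolding modL1_def using assms by (intro Bochner_Integration.integral_add modL1_integrable) auto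
  finally show ?thesis .
qed

lemma modL1_le:
  assumes "integrable lborel f"
  shows "modL1 f h \<le> 2 * (\<integral>x. \<bar>f x\<bar> \<partial>lborel)"
proof -
  have [measurable]: "f \<in> borel_measurable borel" using assms by auto
  have "modL1 f h \<le> (\<integral>x. \<bar>f (x + h)\<bar> + \<bar>f x\<bar> \<partial>lborel)"
    unfolding modL1_def using assms integrable_shift[of "\<lambda>x. \<bar>f x\<bar>" h]
    by (intro integral_mono modL1_integrable) auto
  also have "\<dots> = (\<integral>x. \<bar>f (x + h)\<bar> \<partial>lborel) + (\<integral>x. \<bar>f x\<bar> \<partial>lborel)"
    using assms integrable_shift[of "\<lambda>x. \<bar>f x\<bar>" h] by (intro Bochner_Integration.integral_add) auto
  also have "\<dots> = 2 * (\<integral>x. \<bar>f x\<bar> \<partial>lborel)"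
    using integral_shift[of "\<lambda>x. \<bar>f x\<bar>" h] by simp
  finally show ?thesis .
qed

lemma modL1_perturb:
  assumes f: "integrable lborel f" and g: "integrable lborel g"
  shows "modL1 f h \<le> modL1 g h + 2 * (\<integral>x. \<bar>f x - g x\<bar> \<partial>lborel)"
  using modL1_add[OF g Bochner_Integration.integrable_diff[OF f g], of h]
    modL1_le[OF Bochner_Integration.integrable_diff[OF f g], of h] by simp

lemma LIMSEQ_0_if_le_plus_eps:
  fixes a :: "nat \<Rightarrow> real"
  assumes "\<And>n. 0 \<le> a n" "\<And>e. e > 0 \<Longrightarrow> \<exists>b. b \<longlonglongrightarrow> 0 \<and> (\<forall>n. a n \<le> b n + e)"
  shows "a \<longlonglongrightarrow> 0"
proof (rule LIMSEQ_I)
  fix r :: real assume "0 < r"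
  then obtain b where b: "b \<longlonglongrightarrow> 0" "\<And>n. a n \<le> b n + r/2" using assms(2)[of "r/2"] by auto
  from LIMSEQ_D[OF b(1), of "r/2"] \<open>0 < r\<close> obtain N where "\<forall>n\<ge>N. \<bar>b n\<bar> < r/2" by auto
  then have "\<forall>n\<ge>N. norm (a n - 0) < r"
    using b(2) assms(1) by (smt (verit) field_sum_of_halves real_norm_def)
  then show "\<exists>no. \<forall>n\<ge>no. norm (a n - 0) < r" by blast
qed

text \<open>If x lies in the open set U, so does x + h n eventually; hence the part of the
  difference where the indicator drops tends to 0 by dominated convergence. Translations preserve
  the measure, so the part where it rises has the same integral.\<close>

lemma modL1_open:
  fixes U :: "'a::euclidean_space set"
  assumes "open U" "emeasure lborel U < \<infinity>" "h \<longlonglongrightarrow> 0"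
  shows "(\<lambda>n. modL1 (indicator U) (h n)) \<longlonglongrightarrow> 0"
proof -
  have [measurable]: "U \<in> sets borel" using assms by simp
  have iU: "integrable lborel (indicator U :: 'a \<Rightarrow> real)" using assms by (simp add: less_top)
  let ?m = "\<lambda>n x. max 0 (indicator U x - indicator U (x + h n) :: real)"
  have lim: "(\<lambda>n. \<integral>x. ?m n x \<partial>lborel) \<longlonglongrightarrow> (\<integral>x. 0 \<partial>(lborel :: 'a measure))"
  proof (rule integral_dominated_convergence[where w="indicator U"])
    show "AE x in lborel. (\<lambda>n. ?m n x) \<longlonglongrightarrow> 0"
    proof (rule AE_I2)
      fix x
      show "(\<lambda>n. ?m n x) \<longlonglongrightarrow> 0"
      proof (cases "x \<in> U")
        case True
        have "(\<lambda>n. x + h n) \<longlonglongrightarrow> x + 0" by (intro tendsto_intros assms)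
        then have "\<forall>\<^sub>F n in sequentially. x + h n \<in> U"
          using \<open>open U\<close> True by (auto dest: topological_tendstoD)
        then have "\<forall>\<^sub>F n in sequentially. 0 = ?m n x"
          by eventually_elim (use True in auto)
        then show ?thesis by (rule Lim_transform_eventually[OF tendsto_const])
      qed simp
    qed
  qed (use iU in \<open>auto simp: indicator_def\<close>)
  have "modL1 (indicator U) k = 2 * (\<integral>x. max 0 (indicator U x - indicator U (x + k)) \<partial>lborel)" for k
  proof -
    have s: "integrable lborel (\<lambda>x. indicator U (x + k) :: real)" by (rule integrable_shift[OF iU])
    have i: "integrable lborel (\<lambda>x. max 0 (indicator U x - indicator U (x + k)) :: real)"
      by (rule Bochner_Integration.integrable_bound[OF iU]) (auto simp: indicator_def)
    have "\<bar>indicator U (x + k) - indicator U x :: real\<bar> =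
        2 * max 0 (indicator U x - indicator U (x + k)) + (indicator U (x + k) - indicator U x)" for x
      by (auto simp: indicator_def)
    then have "modL1 (indicator U) k = (\<integral>x. 2 * max 0 (indicator U x - indicator U (x + k))
        + (indicator U (x + k) - indicator U x :: real) \<partial>lborel)"
      unfolding modL1_def by simp
    also have "\<dots> = 2 * (\<integral>x. max 0 (indicator U x - indicator U (x + k)) \<partial>lborel)
       + ((\<integral>x. indicator U (x + k) \<partial>lborel) - (\<integral>x. indicator U x \<partial>lborel))"
      using s i iU by simp
    also have "(\<integral>x. indicator U (x + k) \<partial>lborel) = (\<integral>x. (indicator U x :: real) \<partial>lborel)"
      by (rule integral_shift) simp
    finally show ?thesis by simp
  qed
  with tendsto_mult_left[OF lim, of 2] show ?thesis by simp
qed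

text \<open>Indicators of open sets are the core. Outer regularity leads to indicators of measurable
  sets, and sums and dominated limits to all integrable functions; \<open>modL1_perturb\<close>
  controls the approximation errors uniformly in h.\<close>

lemma modL1_tendsto:
  fixes f :: "'a::euclidean_space \<Rightarrow> real"
  assumes "integrable lborel f" "h \<longlonglongrightarrow> 0"
  shows "(\<lambda>n. modL1 f (h n)) \<longlonglongrightarrow> 0"
  using assms(1)
proof (induction rule: integrable_induct)
  case (base A c)
  then have [measurable]: "A \<in> sets borel" by simp
  have iA: "integrable lborel (indicator A :: 'a \<Rightarrow> real)" using base by simp
  have A: "(\<lambda>n. modL1 (indicator A) (h n)) \<longlonglongrightarrow> 0"
  proof (rule LIMSEQ_0_if_le_plus_eps)
    fix e :: real assume "e > 0"
    then obtain U where U: "open U" "A \<subseteq> U" "emeasure lborel (U - A) < ennreal (e/2)"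
      using outer_regular_lborel[of A "e/2"] base by auto
    have [measurable]: "U \<in> sets borel" using U by simp
    have "emeasure lborel U = emeasure lborel A + emeasure lborel (U - A)"
      using U(2) by (subst plus_emeasure) (auto simp: Un_absorb1)
    then have fU: "emeasure lborel U < \<infinity>" using base U(3)
      by (metis ennreal_add_eq_top infinity_ennreal_def less_top ennreal_less_top order.strict_trans)
    then have iU: "integrable lborel (indicator U :: 'a \<Rightarrow> real)" by (simp add: less_top)
    have "(\<integral>x. \<bar>indicator A x - indicator U x :: real\<bar> \<partial>lborel) = (\<integral>x. indicator (U - A) x \<partial>lborel)"
      using U(2) by (intro Bochner_Integration.integral_cong) (auto simp: indicator_def)
    also have "\<dots> = measure lborel (U - A)" by simp
    also have "\<dots> \<le> e/2" using U(3) \<open>e > 0\<close> unfolding measure_def by (intro enn2real_leI) auto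
    finally have "modL1 (indicator A) (h n) \<le> modL1 (indicator U) (h n) + e" for n
      using modL1_perturb[OF iA iU, of "h n"] by simp
    then show "\<exists>b. b \<longlonglongrightarrow> 0 \<and> (\<forall>n. modL1 (indicator A) (h n) \<le> b n + e)"
      using modL1_open[OF U(1) fU assms(2)] by blast
  qed (rule modL1_nonneg)
  have "modL1 (\<lambda>x. indicator A x *\<^sub>R c) k = \<bar>c\<bar> * modL1 (indicator A) k" for k
  proof -
    have "\<bar>indicator A (x + k) *\<^sub>R c - indicator A x *\<^sub>R c\<bar> = \<bar>c\<bar> * \<bar>indicator A (x + k) - indicator A x\<bar>" for x
      by (simp add: left_diff_distrib[symmetric] abs_mult)
    then show ?thesis unfolding modL1_def by simp
  qed
  with tendsto_mult_left[OF A, of "\<bar>c\<bar>"] show ?case by simp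
next
  case (add f g)
  have "(\<lambda>n. modL1 f (h n) + modL1 g (h n)) \<longlonglongrightarrow> 0 + 0" using add by (intro tendsto_add)
  then have lim: "(\<lambda>n. modL1 f (h n) + modL1 g (h n)) \<longlonglongrightarrow> 0" by simp
  show ?case
    by (rule tendsto_sandwich[OF _ _ tendsto_const lim])
      (use add modL1_add modL1_nonneg in \<open>auto intro!: always_eventually\<close>)
next
  case (lim f s)
  have s_int: "integrable lborel (s i)" and f_int: "integrable lborel f"
    and s_lim: "(\<lambda>i. s i x) \<longlonglongrightarrow> f x" and s_bound: "norm (s i x) \<le> 2 * norm (f x)"
    and IH: "(\<lambda>n. modL1 (s i) (h n)) \<longlonglongrightarrow> 0" for i x
    using lim by auto
  show ?case
  proof (rule LIMSEQ_0_if_le_plus_eps)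
    fix e :: real assume e: "e > 0"
    have [measurable]: "f \<in> borel_measurable borel" "\<And>i. s i \<in> borel_measurable borel"
      using s_int f_int by auto
    have "(\<lambda>i. \<integral>x. \<bar>f x - s i x\<bar> \<partial>lborel) \<longlonglongrightarrow> (\<integral>x. 0 \<partial>(lborel :: 'a measure))"
    proof (rule integral_dominated_convergence[where w="\<lambda>x. 3 * \<bar>f x\<bar>"])
      show "AE x in lborel. (\<lambda>i. \<bar>f x - s i x\<bar>) \<longlonglongrightarrow> 0"
      proof (rule AE_I2)
        fix x
        have "(\<lambda>i. \<bar>f x - s i x\<bar>) \<longlonglongrightarrow> \<bar>f x - f x\<bar>" using s_lim[of x] by (intro tendsto_intros)
        then show "(\<lambda>i. \<bar>f x - s i x\<bar>) \<longlonglongrightarrow> 0" by simp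
      qed
      show "AE x in lborel. norm \<bar>f x - s i x\<bar> \<le> 3 * \<bar>f x\<bar>" for i
      proof (rule AE_I2)
        fix x show "norm \<bar>f x - s i x\<bar> \<le> 3 * \<bar>f x\<bar>" using s_bound[of i x] by simp
      qed
    qed (use f_int in auto)
    then have "(\<lambda>i. \<integral>x. \<bar>f x - s i x\<bar> \<partial>lborel) \<longlonglongrightarrow> 0" by simp
    from LIMSEQ_D[OF this, of "e/2"] e obtain i where "(\<integral>x. \<bar>f x - s i x\<bar> \<partial>lborel) < e/2"
      by fastforce
    then have "modL1 f (h n) \<le> modL1 (s i) (h n) + e" for n
      using modL1_perturb[OF f_int s_int[of i], of "h n"] by simp
    then show "\<exists>b. b \<longlonglongrightarrow> 0 \<and> (\<forall>n. modL1 f (h n) \<le> b n + e)" using IH[of i] by blast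
  qed (rule modL1_nonneg)
qed

lemma modL1_small:
  fixes f :: "'a::euclidean_space \<Rightarrow> real"
  assumes "integrable lborel f" "e > 0"
  shows "\<exists>d>0. \<forall>h. norm h < d \<longrightarrow> modL1 f h < e"
proof (rule ccontr)
  assume "\<not> ?thesis"
  then have "\<forall>n::nat. \<exists>h. norm h < 1 / real (Suc n) \<and> modL1 f h \<ge> e"
    by (metis not_le of_nat_0_less_iff zero_less_Suc zero_less_divide_1_iff)
  then obtain h where h: "\<And>n. norm (h n) < 1 / real (Suc n)" "\<And>n. modL1 f (h n) \<ge> e" by metis
  have "h \<longlonglongrightarrow> 0"
    by (rule tendsto_norm_zero_cancel, rule tendsto_sandwich[OF _ _ tendsto_const LIMSEQ_inverse_real_of_nat])
      (use h(1) in \<open>auto simp: inverse_eq_divide intro!: less_imp_le eventuallyI\<close>)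
  from LIMSEQ_D[OF modL1_tendsto[OF assms(1) this] assms(2)] show False
    using h(2) modL1_nonneg[of f] by (metis abs_of_nonneg diff_zero le_refl not_le real_norm_def)
qed

section \<open>Test functions and the fundamental lemma of the calculus of variations\<close>

lemma test_function_UNIV_iff:
  "test_function UNIV \<phi> \<longleftrightarrow> smooth \<phi> \<and> (\<exists>K. compact K \<and> (\<forall>x. x \<notin> K \<longrightarrow> \<phi> x = 0))"
  by (auto simp: test_function_def smooth_def)

lemma test_function_smooth: "test_function S \<phi> \<Longrightarrow> smooth \<phi>"
  by (simp add: test_function_def smooth_def)

lemma test_function_mult:
  "test_function S \<phi> \<Longrightarrow> smooth \<psi> \<Longrightarrow> test_function S (\<lambda>x. \<phi> x * \<psi> x)"
  using smooth_mult[of \<phi> \<psi>] by (auto simp: test_function_def smooth_def)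

lemma test_function_power:
  assumes "test_function S \<phi>" "0 < n"
  shows "test_function S (\<lambda>x. \<phi> x ^ n)"
  using assms smooth_power[of \<phi> n] by (auto simp: test_function_def smooth_def)

lemma cutoff_test_function: 
  assumes "cutoff x\<^sub>0 a b L \<phi>" "cball x\<^sub>0 b \<subseteq> S"
  shows "test_function S \<phi>"
  unfolding test_function_def
proof (intro conjI exI[of _ "cball x\<^sub>0 b"])
  show "\<forall>x. x \<notin> cball x\<^sub>0 b \<longrightarrow> \<phi> x = 0"
    using assms unfolding cutoff_def by (metis ball_subset_cball in_mono)
qed (use assms in \<open>auto simp: cutoff_def smooth_def\<close>)

lemma test_function_affine:
  assumes "test_function UNIV \<phi>" "c \<noteq> 0"
  shows "test_function UNIV (\<lambda>x. \<phi> (c *\<^sub>R x + a))"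
proof -
  obtain K where K: "compact K" "\<And>x. x \<notin> K \<Longrightarrow> \<phi> x = 0" and s: "smooth \<phi>"
    using assms unfolding test_function_UNIV_iff by blast
  have "compact ((\<lambda>y. (1/c) *\<^sub>R y + (- (1/c)) *\<^sub>R a) ` K)"
    by (intro compact_continuous_image K continuous_intros)
  moreover have "\<phi> (c *\<^sub>R x + a) = 0" if "x \<notin> (\<lambda>y. (1/c) *\<^sub>R y + (- (1/c)) *\<^sub>R a) ` K" for x
  proof (rule K)
    show "c *\<^sub>R x + a \<notin> K"
    proof
      assume "c *\<^sub>R x + a \<in> K"
      moreover have "x = (1/c) *\<^sub>R (c *\<^sub>R x + a) + (- (1/c)) *\<^sub>R a"
        using assms(2) by (simp add: algebra_simps)
      ultimately show False using that by blast
    qed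
  qed
  ultimately show ?thesis
    unfolding test_function_UNIV_iff using smooth_affine[OF s] by blast
qed

lemma test_function_bounds:
  assumes "test_function S \<phi>"
  obtains K B where "compact K" "K \<subseteq> S" "\<And>x. x \<notin> K \<Longrightarrow> \<phi> x = 0" "\<And>x. x \<notin> K \<Longrightarrow> grad \<phi> x = 0"
    "\<And>x. \<bar>\<phi> x\<bar> \<le> B" "\<And>x. norm (grad \<phi> x) \<le> B" "0 \<le> B"
proof -
  obtain K where K: "compact K" "K \<subseteq> S" "\<And>x. x \<notin> K \<Longrightarrow> \<phi> x = 0" and s: "smooth \<phi>"
    using assms unfolding test_function_def smooth_def by blast
  have g0: "grad \<phi> x = 0" if "x \<notin> K" for x
    using grad_zero_outside[OF compact_imp_closed[OF K(1)] K(3) that] .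
  have "bounded (\<phi> ` K)" "bounded (grad \<phi> ` K)"
    using K s by (auto intro!: compact_imp_bounded compact_continuous_image smooth_continuous smooth_grad_continuous)
  then obtain B1 B2 where B: "\<And>x. x \<in> K \<Longrightarrow> \<bar>\<phi> x\<bar> \<le> B1" "\<And>x. x \<in> K \<Longrightarrow> norm (grad \<phi> x) \<le> B2"
    unfolding bounded_iff by auto
  define B where "B = max 0 (max B1 B2)"
  have "\<bar>\<phi> x\<bar> \<le> B" "norm (grad \<phi> x) \<le> B" for x
    using B[of x] K(3)[of x] g0[of x] by (cases "x \<in> K"; force simp: B_def)+
  moreover have "0 \<le> B" by (simp add: B_def)
  ultimately show thesis using that[OF K g0] by blast
qed

lemma smooth_measurable: "smooth \<phi> \<Longrightarrow> \<phi> \<in> borel_measurable borel"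
  by (intro borel_measurable_continuous_onI smooth_continuous)

lemma smooth_grad_measurable: "smooth \<phi> \<Longrightarrow> grad \<phi> \<in> borel_measurable borel"
  by (intro borel_measurable_continuous_onI smooth_grad_continuous)

text \<open>Let \<rho> be a bump of small support. Its translates are test functions, so the average
  of f (x + h) against \<rho> h vanishes, and f x is up to the mass of \<rho> the average of f x - f
  (x + h). Integrating over x bounds the L1 norm of f by its modulus of continuity near 0, which is
  arbitrarily small.\<close>

lemma fundamental_lemma_lborel:
  fixes f :: "'a::euclidean_space \<Rightarrow> real"
  assumes f: "integrable lborel f"
    and 0: "\<And>\<phi>. test_function UNIV \<phi> \<Longrightarrow> (\<integral>x. f x * \<phi> x \<partial>lborel) = 0"
  shows "AE x in lborel. f x = 0"
proof -
  have [measurable]: "f \<in> borel_measurable borel" using f by auto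
  have small: "(\<integral>\<^sup>+x. ennreal \<bar>f x\<bar> \<partial>lborel) \<le> ennreal e" if e: "e > 0" for e
  proof -
    obtain d where d: "d > 0" "\<And>h. norm h < d \<Longrightarrow> modL1 f h < e"
      using modL1_small[OF f e] by auto
    obtain \<rho> L where \<rho>: "cutoff (0::'a) (d/2) d L \<rho>" using cutoff_exists[where 'a='a] d(1)
      by (metis field_sum_of_halves half_gt_zero less_add_same_cancel1)
    then have t: "test_function UNIV \<rho>" by (rule cutoff_test_function) simp
    have \<rho>0: "0 \<le> \<rho> h" "\<rho> h \<le> 1" "h \<in> cball 0 (d/2) \<Longrightarrow> \<rho> h = 1" "h \<notin> ball 0 d \<Longrightarrow> \<rho> h = 0" and s: "smooth \<rho>" for h
      using \<rho> by (auto simp: cutoff_def)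
    have [measurable]: "\<rho> \<in> borel_measurable borel" using s by (rule smooth_measurable)
    define c where "c = (\<integral>\<^sup>+h. ennreal (\<rho> h) \<partial>lborel)"
    have ib: "integrable lborel (indicator (cball (0::'a) d) :: 'a \<Rightarrow> real)"
      using emeasure_lborel_cball_finite[of "0::'a" d] by simp
    have \<rho>i: "integrable lborel \<rho>"
    proof (rule Bochner_Integration.integrable_bound[OF ib])
      show "AE x in lborel. norm (\<rho> x) \<le> norm (indicator (cball 0 d) x :: real)"
      proof (rule AE_I2)
        fix x show "norm (\<rho> x) \<le> norm (indicator (cball 0 d) x :: real)"
          using \<rho>0(1,2)[of x] \<rho>0(4)[of x] by (cases "x \<in> ball 0 d") (auto simp: indicator_def)
      qed
    qed simp
    have c_fin: "c < \<infinity>" unfolding c_def using \<rho>i \<rho>0 by (simp add: nn_integral_eq_integral)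
    \<comment> \<open>The mass c of the bump has to be positive and finite in order to cancel at the
      end.\<close>
    have "0 < emeasure lborel (cball (0::'a) (d/2))" using d(1) by (simp add: emeasure_cball)
    also have "\<dots> = (\<integral>\<^sup>+h. indicator (cball (0::'a) (d/2)) h \<partial>lborel)" by simp
    also have "\<dots> \<le> c" unfolding c_def
      by (intro nn_integral_mono) (use \<rho>0 in \<open>auto simp: indicator_def\<close>)
    finally have c_pos: "0 < c" .
    have pw: "ennreal \<bar>f x\<bar> * c \<le> (\<integral>\<^sup>+h. ennreal \<bar>f (x + h) - f x\<bar> * ennreal (\<rho> h) \<partial>lborel)" for x
    proof -
      have sh: "integrable lborel (\<lambda>h. f (h + x) * \<rho> h)"
        by (rule integrable_mult_bounded[OF integrable_shift[OF f], of _ 1]) (use \<rho>0 in auto)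
      have "(\<integral>h. f (h + x) * \<rho> h \<partial>lborel) = (\<integral>h. (\<lambda>y. f y * \<rho> (1 *\<^sub>R y + - x)) (h + x) \<partial>lborel)" by simp
      also have "\<dots> = (\<integral>y. f y * \<rho> (1 *\<^sub>R y + - x) \<partial>lborel)"
        by (rule integral_shift) simp
      also have "\<dots> = 0" by (rule 0, rule test_function_affine[OF t]) simp
      finally have z: "(\<integral>h. f (h + x) * \<rho> h \<partial>lborel) = 0" .
      have "(\<integral>h. (f (h + x) - f x) * \<rho> h \<partial>lborel) = - (f x * (\<integral>h. \<rho> h \<partial>lborel))"
        using z sh \<rho>i by (simp add: left_diff_distrib)
      then have "\<bar>f x\<bar> * (\<integral>h. \<rho> h \<partial>lborel) = norm (\<integral>h. (f (h + x) - f x) * \<rho> h \<partial>lborel)"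
        using \<rho>0 by (simp add: abs_mult)
      then have "ennreal \<bar>f x\<bar> * c = ennreal (norm (\<integral>h. (f (h + x) - f x) * \<rho> h \<partial>lborel))"
        unfolding c_def using \<rho>i \<rho>0 by (simp add: nn_integral_eq_integral ennreal_mult'[symmetric])
      also have "\<dots> \<le> (\<integral>\<^sup>+h. norm ((f (h + x) - f x) * \<rho> h) \<partial>lborel)"
        by (rule integral_norm_bound_ennreal) (use sh \<rho>i in \<open>simp add: left_diff_distrib\<close>)
      also have "\<dots> = (\<integral>\<^sup>+h. ennreal \<bar>f (x + h) - f x\<bar> * ennreal (\<rho> h) \<partial>lborel)"
        using \<rho>0 by (intro nn_integral_cong) (simp add: abs_mult ennreal_mult add.commute)
      finally show ?thesis .
    qed
    have "(\<integral>\<^sup>+x. ennreal \<bar>f x\<bar> \<partial>lborel) * c = (\<integral>\<^sup>+x. ennreal \<bar>f x\<bar> * c \<partial>lborel)"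
      by (simp add: nn_integral_multc)
    also have "\<dots> \<le> (\<integral>\<^sup>+x. \<integral>\<^sup>+h. ennreal \<bar>f (x + h) - f x\<bar> * ennreal (\<rho> h) \<partial>lborel \<partial>lborel)"
      by (intro nn_integral_mono pw)
    also have "\<dots> = (\<integral>\<^sup>+h. \<integral>\<^sup>+x. ennreal \<bar>f (x + h) - f x\<bar> * ennreal (\<rho> h) \<partial>lborel \<partial>lborel)"
      by (rule lborel_pair.Fubini') simp
    also have "\<dots> = (\<integral>\<^sup>+h. ennreal (modL1 f h) * ennreal (\<rho> h) \<partial>lborel)"
      unfolding modL1_def
      by (intro nn_integral_cong) (simp add: nn_integral_multc nn_integral_eq_integral modL1_integrable f)
    also have "\<dots> \<le> (\<integral>\<^sup>+h. ennreal e * ennreal (\<rho> h) \<partial>lborel)"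
    proof (intro nn_integral_mono)
      fix h :: 'a
      show "ennreal (modL1 f h) * ennreal (\<rho> h) \<le> ennreal e * ennreal (\<rho> h)"
        using d(2)[of h] \<rho>0(4)[of h] by (cases "h \<in> ball 0 d") (auto intro!: mult_right_mono ennreal_leI)
    qed
    also have "\<dots> = ennreal e * c" unfolding c_def by (simp add: nn_integral_cmult)
    finally show ?thesis
      using c_fin c_pos by (simp add: ennreal_mult_le_mult_iff mult.commute)
  qed
  have "(\<integral>\<^sup>+x. ennreal \<bar>f x\<bar> \<partial>lborel) \<le> 0"
    by (rule ennreal_le_epsilon) (use small in simp)
  then have "(\<integral>\<^sup>+x. ennreal \<bar>f x\<bar> \<partial>lborel) = 0" by simp
  then have "AE x in lborel. ennreal \<bar>f x\<bar> = 0" by (subst (asm) nn_integral_0_iff_AE) simp_all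
  then show ?thesis by eventually_elim (simp add: ennreal_eq_0_iff)
qed

section \<open>Weak gradients of integrable functions\<close>

text \<open>The global Borel counterpart of \<^const>\<open>is_weak_grad\<close>: multiplying by a cutoff turns a function with
  a local weak gradient into such a pair.\<close>

definition weak_pair :: "('a::euclidean_space \<Rightarrow> real) \<Rightarrow> ('a \<Rightarrow> 'a) \<Rightarrow> bool" where
  "weak_pair f G \<longleftrightarrow> integrable lborel f \<and> integrable lborel G \<and>
     (\<forall>\<phi> h. test_function UNIV \<phi> \<longrightarrow>
        (\<integral>x. f x * (grad \<phi> x \<bullet> h) \<partial>lborel) = - (\<integral>x. (G x \<bullet> h) * \<phi> x \<partial>lborel))"

lemma weak_pairD:
  assumes "weak_pair f G"
  shows "integrable lborel f" "integrable lborel G" "f \<in> borel_measurable borel" "G \<in> borel_measurable borel"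
    "test_function UNIV \<phi> \<Longrightarrow> (\<integral>x. f x * (grad \<phi> x \<bullet> h) \<partial>lborel) = - (\<integral>x. (G x \<bullet> h) * \<phi> x \<partial>lborel)"
  using assms unfolding weak_pair_def by auto

lemma integrable_mult_test:
  fixes f :: "'a::euclidean_space \<Rightarrow> real"
  assumes "integrable lborel f" "test_function S \<phi>"
  shows "integrable lborel (\<lambda>x. f x * \<phi> x)" "integrable lborel (\<lambda>x. f x * (grad \<phi> x \<bullet> h))"
proof -
  obtain B where B: "\<And>x. \<bar>\<phi> x\<bar> \<le> B" "\<And>x. norm (grad \<phi> x) \<le> B" "0 \<le> B"
    using test_function_bounds[OF assms(2)] by metis
  have [measurable]: "\<phi> \<in> borel_measurable borel" "grad \<phi> \<in> borel_measurable borel"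
    using test_function_smooth[OF assms(2)] by (auto intro: smooth_measurable smooth_grad_measurable)
  show "integrable lborel (\<lambda>x. f x * \<phi> x)"
    by (rule integrable_mult_bounded[OF assms(1) _ B(1)]) simp
  have "\<bar>grad \<phi> x \<bullet> h\<bar> \<le> B * norm h" for x
    using Cauchy_Schwarz_ineq2[of "grad \<phi> x" h] B(2)[of x] by (meson mult_right_mono norm_ge_zero order_trans)
  then show "integrable lborel (\<lambda>x. f x * (grad \<phi> x \<bullet> h))"
    by (intro integrable_mult_bounded[OF assms(1)]) auto
qed

lemma weak_pair_diff:
  assumes "weak_pair f F" "weak_pair g G"
  shows "weak_pair (\<lambda>x. f x - g x) (\<lambda>x. F x - G x)"
  unfolding weak_pair_def
proof (intro conjI allI impI)
  fix \<phi> h assume \<phi>: "test_function UNIV (\<phi> :: 'a \<Rightarrow> real)"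
  note [simp] = integrable_mult_test[OF _ \<phi>]
  show "(\<integral>x. (f x - g x) * (grad \<phi> x \<bullet> h) \<partial>lborel) = - (\<integral>x. ((F x - G x) \<bullet> h) * \<phi> x \<partial>lborel)"
    using weak_pairD(5)[OF assms(1) \<phi>, of h] weak_pairD(5)[OF assms(2) \<phi>, of h] weak_pairD(1,2)[OF assms(1)] weak_pairD(1,2)[OF assms(2)]
    by (simp add: left_diff_distrib inner_diff_left)
qed (use weak_pairD(1,2)[OF assms(1)] weak_pairD(1,2)[OF assms(2)] in auto)

text \<open>The difference of the pairs has a function that vanishes almost everywhere, so each
  component of its gradient is orthogonal to all test functions.\<close>

lemma weak_pair_unique:
  assumes F: "weak_pair f F" and G: "weak_pair g G" and "AE x in lborel. f x = g x"
  shows "AE x in lborel. F x = G x"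
proof -
  have "AE x in lborel. (F x - G x) \<bullet> b = 0" for b
  proof (rule fundamental_lemma_lborel)
    have d: "weak_pair (\<lambda>x. f x - g x) (\<lambda>x. F x - G x)" using F G by (rule weak_pair_diff)
    show "integrable lborel (\<lambda>x. (F x - G x) \<bullet> b)" using weak_pairD(2)[OF d] by auto
    fix \<phi> :: "'a \<Rightarrow> real" assume \<phi>: "test_function UNIV \<phi>"
    have [measurable]: "f \<in> borel_measurable borel" "g \<in> borel_measurable borel" "grad \<phi> \<in> borel_measurable borel"
      using weak_pairD(3)[OF F] weak_pairD(3)[OF G] test_function_smooth[OF \<phi>] by (auto intro: smooth_grad_measurable)
    have "(\<integral>x. (f x - g x) * (grad \<phi> x \<bullet> b) \<partial>lborel) = (\<integral>x. 0 \<partial>(lborel::'a measure))"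
      by (rule integral_cong_AE) (use assms(3) in auto)
    then show "(\<integral>x. ((F x - G x) \<bullet> b) * \<phi> x \<partial>lborel) = 0"
      using weak_pairD(5)[OF d \<phi>, of b] by simp
  qed
  then have "AE x in lborel. \<forall>b\<in>Basis. (F x - G x) \<bullet> b = 0"
    by (subst AE_finite_all) auto
  then show ?thesis
  proof eventually_elim
    fix x assume "\<forall>b\<in>Basis. (F x - G x) \<bullet> b = 0"
    then show "F x = G x" by - (rule euclidean_eqI, simp add: inner_diff_left)
  qed
qed

section \<open>Weak derivatives along segments\<close>

lemma norm_integral_le_nn_integral:
  fixes f :: "'a \<Rightarrow> 'b::{banach, second_countable_topology}"
  shows "ennreal (norm (integral\<^sup>L M f)) \<le> (\<integral>\<^sup>+x. norm (f x) \<partial>M)"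
  by (cases "integrable M f") (auto simp: integral_norm_bound_ennreal not_integrable_integral_eq)

text \<open>For each fixed t the shift by t h preserves the integral, and t runs through an interval
  of length 1.\<close>

lemma nn_integral_segment:
  fixes g :: "'a::euclidean_space \<Rightarrow> ennreal"
  assumes [measurable]: "g \<in> borel_measurable borel"
  shows "(\<integral>\<^sup>+x. \<integral>\<^sup>+t. indicator {0..1} t * g (x + t *\<^sub>R h) \<partial>lborel \<partial>lborel) = (\<integral>\<^sup>+x. g x \<partial>lborel)"
proof -
  have "(\<integral>\<^sup>+x. \<integral>\<^sup>+t. indicator {0..1::real} t * g (x + t *\<^sub>R h) \<partial>lborel \<partial>lborel)
     = (\<integral>\<^sup>+t. \<integral>\<^sup>+x. indicator {0..1::real} t * g (x + t *\<^sub>R h) \<partial>lborel \<partial>lborel)"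
    by (rule lborel_pair.Fubini') simp
  also have "\<dots> = (\<integral>\<^sup>+t. (\<integral>\<^sup>+x. g x \<partial>lborel) * indicator {0..1::real} t \<partial>lborel)"
    by (intro nn_integral_cong) (simp add: nn_integral_cmult nn_integral_shift mult.commute)
  also have "\<dots> = (\<integral>\<^sup>+x. g x \<partial>lborel)" by (simp add: nn_integral_cmult)
  finally show ?thesis .
qed

text \<open>The bounded weight \<open>w\<close> prepares the two uses of Fubini in
  \<open>weak_pair_segment\<close>, where it is a test function and a directional derivative;
  \<open>w\<close> = 1 gives the integrability of almost every section.\<close>

lemma integrable_segment:
  fixes g :: "'a::euclidean_space \<Rightarrow> real"
  assumes g: "integrable lborel g" and [measurable]: "w \<in> borel_measurable (lborel \<Otimes>\<^sub>M lborel)"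
    and "\<And>z. \<bar>w z\<bar> \<le> B"
  shows "integrable (lborel \<Otimes>\<^sub>M lborel) (\<lambda>(x, t::real). indicator {0..1} t * g (x + t *\<^sub>R h) * w (x, t))"
proof -
  have [measurable]: "g \<in> borel_measurable borel" using g by auto
  have "integrable (lborel \<Otimes>\<^sub>M lborel) (\<lambda>(x, t::real). indicator {0..1} t * g (x + t *\<^sub>R h))"
  proof (rule integrableI_bounded)
    have "(\<integral>\<^sup>+z. norm (case z of (x, t::real) \<Rightarrow> indicator {0..1} t * g (x + t *\<^sub>R h)) \<partial>(lborel \<Otimes>\<^sub>M lborel))
      = (\<integral>\<^sup>+x. \<integral>\<^sup>+t. norm (indicator {0..1::real} t * g (x + t *\<^sub>R h)) \<partial>lborel \<partial>lborel)"
      by (subst lborel.nn_integral_fst[symmetric]) auto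
    also have "\<dots> = (\<integral>\<^sup>+x. \<integral>\<^sup>+t. indicator {0..1::real} t * ennreal (norm (g (x + t *\<^sub>R h))) \<partial>lborel \<partial>lborel)"
      by (intro nn_integral_cong) (simp add: abs_mult indicator_def)
    also have "\<dots> = (\<integral>\<^sup>+x. ennreal (norm (g x)) \<partial>lborel)"
      by (rule nn_integral_segment) simp
    also have "\<dots> < \<infinity>" using g by (simp add: integrable_iff_bounded)
    finally show "(\<integral>\<^sup>+z. norm (case z of (x, t::real) \<Rightarrow> indicator {0..1} t * g (x + t *\<^sub>R h)) \<partial>(lborel \<Otimes>\<^sub>M lborel)) < \<infinity>" .
  qed simp
  from integrable_mult_bounded[OF this, of w B] show ?thesis
    using assms(3) by (simp add: case_prod_unfold)
qed

lemma smooth_line_deriv: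
  assumes "smooth \<psi>"
  shows "((\<lambda>s. \<psi> (x + s *\<^sub>R k)) has_real_derivative grad \<psi> (x + s *\<^sub>R k) \<bullet> k) (at s)"
proof -
  have "((\<lambda>s. \<psi> (x + s *\<^sub>R k)) has_derivative (\<lambda>t. grad \<psi> (x + s *\<^sub>R k) \<bullet> (t *\<^sub>R k))) (at s)"
    by (rule has_derivative_compose[of "\<lambda>s. x + s *\<^sub>R k", OF _ smooth_has_derivative[OF assms]])
      (auto intro!: derivative_eq_intros)
  then show ?thesis unfolding has_field_derivative_def
    by (rule has_derivative_eq_rhs) (simp add: fun_eq_iff)
qed

lemma smooth_line_integral:
  assumes "smooth \<phi>"
  shows "(\<integral>t. indicator {0..1} t * (grad \<phi> (x - t *\<^sub>R h) \<bullet> h) \<partial>lborel) = \<phi> x - \<phi> (x - h)"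
proof -
  have "(\<integral>t. indicator {0..1} t *\<^sub>R (grad \<phi> (x + t *\<^sub>R (-h)) \<bullet> (-h)) \<partial>lborel)
     = \<phi> (x + 1 *\<^sub>R (-h)) - \<phi> (x + 0 *\<^sub>R (-h))"
  proof (rule integral_FTC_Icc)
    show "((\<lambda>t. \<phi> (x + t *\<^sub>R - h)) has_vector_derivative grad \<phi> (x + t *\<^sub>R - h) \<bullet> - h) (at t within {0..1})" for t
      using smooth_line_deriv[OF assms, of x "-h" t]
      by (auto simp: has_real_derivative_iff_has_vector_derivative intro: has_vector_derivative_at_within)
    show "continuous_on {0..1} (\<lambda>t. grad \<phi> (x + t *\<^sub>R - h) \<bullet> - h)"
      by (intro continuous_intros continuous_on_compose2[OF smooth_grad_continuous[OF assms, of UNIV]]) auto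
  qed simp
  then show ?thesis by (simp add: algebra_simps)
qed

text \<open>Fubini and a shift by t h move the translation onto the test function, and the weak
  equation moves the derivative there; the classical fundamental theorem of calculus applies to
  \<phi>, and the fundamental lemma returns to a pointwise statement. The exceptional null set may
  depend on h.\<close>

lemma weak_pair_segment:
  fixes f :: "'a::euclidean_space \<Rightarrow> real"
  assumes w: "weak_pair f G"
  shows "AE x in lborel. f (x + h) - f x = (\<integral>t. indicator {0..1} t * (G (x + t *\<^sub>R h) \<bullet> h) \<partial>lborel)"
proof -
  note [measurable] = weak_pairD(3,4)[OF w]
  have f: "integrable lborel f" and g: "integrable lborel (\<lambda>x. G x \<bullet> h)" using weak_pairD(1,2)[OF w] by auto
  define I where "I x = (\<integral>t. indicator {0..1} t * (G (x + t *\<^sub>R h) \<bullet> h) \<partial>lborel)" for x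
  have Ii: "integrable lborel I"
    unfolding I_def using lborel_pair.integrable_fst'[OF integrable_segment[OF g, of "\<lambda>_. 1" 1 h]] by simp
  have "AE x in lborel. f (x + h) - f x - I x = 0"
  proof (rule fundamental_lemma_lborel)
    show "integrable lborel (\<lambda>x. f (x + h) - f x - I x)"
      using f Ii integrable_shift[OF f] by auto
    fix \<phi> :: "'a \<Rightarrow> real" assume t: "test_function UNIV \<phi>"
    note s = test_function_smooth[OF t]
    obtain B where B: "\<And>x. \<bar>\<phi> x\<bar> \<le> B" "\<And>x. norm (grad \<phi> x) \<le> B" "0 \<le> B"
      using test_function_bounds[OF t] by metis
    have B2: "\<bar>grad \<phi> x \<bullet> h\<bar> \<le> B * norm h" for x
      using Cauchy_Schwarz_ineq2[of "grad \<phi> x" h] B(2)[of x] by (meson mult_right_mono norm_ge_zero order_trans)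
    note [measurable] = smooth_measurable[OF s] smooth_grad_measurable[OF s]
    have t': "test_function UNIV (\<lambda>x. \<phi> (x - a))" for a
      using test_function_affine[OF t, of 1 "-a"] by simp
    have gr': "grad (\<lambda>x. \<phi> (x - a)) x = grad \<phi> (x - a)" for x a
      using grad_affine[OF s, of 1 "-a"] by simp
    have "(\<integral>x. I x * \<phi> x \<partial>lborel) = (\<integral>x. (\<integral>t. indicator {0..1} t * (G (x + t *\<^sub>R h) \<bullet> h) * \<phi> x \<partial>lborel) \<partial>lborel)"
      unfolding I_def by simp
    also have "\<dots> = (\<integral>t. (\<integral>x. indicator {0..1} t * (G (x + t *\<^sub>R h) \<bullet> h) * \<phi> x \<partial>lborel) \<partial>lborel)"
    proof (rule lborel_pair.Fubini_integral[symmetric])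
      have "integrable (lborel \<Otimes>\<^sub>M lborel) (\<lambda>(x, t::real). indicator {0..1} t * (G (x + t *\<^sub>R h) \<bullet> h) * (\<lambda>z. \<phi> (fst z)) (x, t))"
        by (rule integrable_segment[OF g, of _ B]) (use B in auto)
      then show "integrable (lborel \<Otimes>\<^sub>M lborel) (\<lambda>(x, t::real). indicator {0..1} t * (G (x + t *\<^sub>R h) \<bullet> h) * \<phi> x)" by simp
    qed
    also have "\<dots> = (\<integral>t. (\<integral>x. indicator {0..1} t * (- f x * (grad \<phi> (x - t *\<^sub>R h) \<bullet> h)) \<partial>lborel) \<partial>lborel)"
    proof (rule Bochner_Integration.integral_cong[OF refl])
      fix t :: real
      have "(\<integral>x. (G (x + t *\<^sub>R h) \<bullet> h) * \<phi> x \<partial>lborel) = (\<integral>x. (\<lambda>y. (G y \<bullet> h) * \<phi> (y - t *\<^sub>R h)) (x + t *\<^sub>R h) \<partial>lborel)"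
        by simp
      also have "\<dots> = (\<integral>y. (G y \<bullet> h) * \<phi> (y - t *\<^sub>R h) \<partial>lborel)"
        by (rule integral_shift) simp
      also have "\<dots> = - (\<integral>y. f y * (grad \<phi> (y - t *\<^sub>R h) \<bullet> h) \<partial>lborel)"
        using weak_pairD(5)[OF w t', of "t *\<^sub>R h" h] by (simp add: gr')
      finally show "(\<integral>x. indicator {0..1} t * (G (x + t *\<^sub>R h) \<bullet> h) * \<phi> x \<partial>lborel)
        = (\<integral>x. indicator {0..1} t * (- f x * (grad \<phi> (x - t *\<^sub>R h) \<bullet> h)) \<partial>lborel)"
        by (simp add: mult.assoc)
    qed
    also have "\<dots> = (\<integral>x. (\<integral>t. indicator {0..1} t * (- f x * (grad \<phi> (x - t *\<^sub>R h) \<bullet> h)) \<partial>lborel) \<partial>lborel)"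
    proof (rule lborel_pair.Fubini_integral)
      have "integrable (lborel \<Otimes>\<^sub>M lborel) (\<lambda>(x, t::real). indicator {0..1} t * f (x + t *\<^sub>R 0) * (\<lambda>z. - (grad \<phi> (fst z - snd z *\<^sub>R h) \<bullet> h)) (x, t))"
        by (rule integrable_segment[OF f, of _ "B * norm h"]) (use B2 in auto)
      then show "integrable (lborel \<Otimes>\<^sub>M lborel) (\<lambda>(x, t::real). indicator {0..1} t * (- f x * (grad \<phi> (x - t *\<^sub>R h) \<bullet> h)))"
        by (simp add: mult.assoc)
    qed
    also have "\<dots> = (\<integral>x. - f x * (\<phi> x - \<phi> (x - h)) \<partial>lborel)"
    proof (rule Bochner_Integration.integral_cong[OF refl])
      fix x
      have "(\<integral>t. indicator {0..1} t * (- f x * (grad \<phi> (x - t *\<^sub>R h) \<bullet> h)) \<partial>lborel)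
        = (\<integral>t. - f x * (indicator {0..1} t * (grad \<phi> (x - t *\<^sub>R h) \<bullet> h)) \<partial>lborel)"
        by (intro Bochner_Integration.integral_cong) auto
      then show "(\<integral>t. indicator {0..1} t * (- f x * (grad \<phi> (x - t *\<^sub>R h) \<bullet> h)) \<partial>lborel) = - f x * (\<phi> x - \<phi> (x - h))"
        using smooth_line_integral[OF s, of x h] by simp
    qed
    also have "\<dots> = (\<integral>x. f x * \<phi> (x - h) \<partial>lborel) - (\<integral>x. f x * \<phi> x \<partial>lborel)"
      using integrable_mult_test(1)[OF f t] integrable_mult_test(1)[OF f t'] by (simp add: right_diff_distrib)
    also have "(\<integral>x. f x * \<phi> (x - h) \<partial>lborel) = (\<integral>x. f (x + h) * \<phi> x \<partial>lborel)"
      using integral_shift[of "\<lambda>x. f x * \<phi> (x - h)" h] by simp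
    finally have "(\<integral>x. I x * \<phi> x \<partial>lborel) = (\<integral>x. f (x + h) * \<phi> x \<partial>lborel) - (\<integral>x. f x * \<phi> x \<partial>lborel)" .
    then show "(\<integral>x. (f (x + h) - f x - I x) * \<phi> x \<partial>lborel) = 0"
      using integrable_mult_test(1)[OF f t] integrable_mult_test(1)[OF integrable_shift[OF f] t]
        integrable_mult_test(1)[OF Ii t]
      by (simp add: left_diff_distrib)
  qed
  then show ?thesis unfolding I_def by eventually_elim simp
qed

text \<open>Convexity keeps the segment from x to x + h inside S, so only the gradient on S enters.
  \<open>faber_krahn\<close> uses it on the whole space, \<open>shrink_level\<close> on a
  ball.\<close>

lemma weak_pair_translate_convex:
  fixes f :: "'a::euclidean_space \<Rightarrow> real"
  assumes w: "weak_pair f G" and "convex S" and [measurable]: "S \<in> sets borel"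
  shows "(\<integral>\<^sup>+x. indicator S x * indicator S (x + h) * ennreal \<bar>f (x + h) - f x\<bar> \<partial>lborel)
    \<le> ennreal (norm h) * (\<integral>\<^sup>+x. indicator S x * ennreal (norm (G x)) \<partial>lborel)"
proof -
  note [measurable] = weak_pairD(3,4)[OF w]
  have "(\<integral>\<^sup>+x. indicator S x * indicator S (x + h) * ennreal \<bar>f (x + h) - f x\<bar> \<partial>lborel)
    \<le> (\<integral>\<^sup>+x. \<integral>\<^sup>+t. indicator {0..1} t * (\<lambda>y. ennreal (norm h) * (indicator S y * ennreal (norm (G y)))) (x + t *\<^sub>R h) \<partial>lborel \<partial>lborel)"
  proof (rule nn_integral_mono_AE, use weak_pair_segment[OF w, of h] in eventually_elim)
    fix x assume eq: "f (x + h) - f x = (\<integral>t. indicator {0..1} t * (G (x + t *\<^sub>R h) \<bullet> h) \<partial>lborel)"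
    show "indicator S x * indicator S (x + h) * ennreal \<bar>f (x + h) - f x\<bar>
      \<le> (\<integral>\<^sup>+t. indicator {0..1} t * (ennreal (norm h) * (indicator S (x + t *\<^sub>R h) * ennreal (norm (G (x + t *\<^sub>R h))))) \<partial>lborel)"
    proof (cases "x \<in> S \<and> x + h \<in> S")
      case True
      have inS: "x + t *\<^sub>R h \<in> S" if "t \<in> {0..1}" for t
        using convexD_alt[OF \<open>convex S\<close>, of x "x + h" t] True that by (simp add: algebra_simps)
      have "ennreal \<bar>f (x + h) - f x\<bar> \<le> (\<integral>\<^sup>+t. norm (indicator {0..1} t * (G (x + t *\<^sub>R h) \<bullet> h)) \<partial>lborel)"
        unfolding eq using norm_integral_le_nn_integral[of lborel "\<lambda>t. indicator {0..1} t * (G (x + t *\<^sub>R h) \<bullet> h)"] by simp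
      also have "\<dots> \<le> (\<integral>\<^sup>+t. indicator {0..1} t * (ennreal (norm h) * (indicator S (x + t *\<^sub>R h) * ennreal (norm (G (x + t *\<^sub>R h))))) \<partial>lborel)"
      proof (rule nn_integral_mono)
        fix t :: real
        have "\<bar>G (x + t *\<^sub>R h) \<bullet> h\<bar> \<le> norm h * norm (G (x + t *\<^sub>R h))"
          using Cauchy_Schwarz_ineq2[of "G (x + t *\<^sub>R h)" h] by (simp add: mult.commute)
        then show "ennreal (norm (indicator {0..1} t * (G (x + t *\<^sub>R h) \<bullet> h)))
          \<le> indicator {0..1} t * (ennreal (norm h) * (indicator S (x + t *\<^sub>R h) * ennreal (norm (G (x + t *\<^sub>R h)))))"
          using inS[of t] by (auto simp: indicator_def ennreal_mult[symmetric] intro!: ennreal_leI)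
      qed
      finally show ?thesis using True by simp
    qed (auto simp: indicator_def)
  qed
  also have "\<dots> = (\<integral>\<^sup>+x. ennreal (norm h) * (indicator S x * ennreal (norm (G x))) \<partial>lborel)"
    by (rule nn_integral_segment) simp
  also have "\<dots> = ennreal (norm h) * (\<integral>\<^sup>+x. indicator S x * ennreal (norm (G x)) \<partial>lborel)"
    by (rule nn_integral_cmult) simp
  finally show ?thesis .
qed

text \<open>By \<open>weak_pair_segment\<close> the error is the average over s in [0,1] of g (x + s
  t h) - g x with g = G . h; its L1 norm is at most the modulus of continuity of g near 0.\<close>

lemma weak_pair_difference_quotient:
  fixes f :: "'a::euclidean_space \<Rightarrow> real"
  assumes w: "weak_pair f G" and t: "t \<longlonglongrightarrow> 0" "\<And>n. t n > 0"
  shows "(\<lambda>n. \<integral>x. \<bar>(f (x + t n *\<^sub>R h) - f x) / t n - G x \<bullet> h\<bar> \<partial>lborel) \<longlonglongrightarrow> 0"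
proof (rule LIMSEQ_I)
  note [measurable] = weak_pairD(3,4)[OF w]
  define g where "g x = G x \<bullet> h" for x
  have [measurable]: "g \<in> borel_measurable borel" unfolding g_def by simp
  have g: "integrable lborel g" unfolding g_def using weak_pairD(2)[OF w] by auto
  fix e :: real assume "e > 0"
  then obtain d where d: "d > 0" "\<And>k. norm k < d \<Longrightarrow> modL1 g k < e/2" using modL1_small[OF g, of "e/2"] by auto
  have "(\<lambda>n. t n * norm h) \<longlonglongrightarrow> 0 * norm h" by (intro tendsto_intros t)
  then have "(\<lambda>n. t n * norm h) \<longlonglongrightarrow> 0" by simp
  from LIMSEQ_D[OF this d(1)] obtain N where N: "\<And>n. n \<ge> N \<Longrightarrow> t n * norm h < d" using t(2)
    by (fastforce simp: less_imp_le abs_mult)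
  have "\<bar>\<integral>x. \<bar>(f (x + t n *\<^sub>R h) - f x) / t n - g x\<bar> \<partial>lborel\<bar> < e" if n: "n \<ge> N" for n
  proof -
    let ?k = "t n *\<^sub>R h"
    have "ennreal \<bar>\<integral>x. \<bar>(f (x + ?k) - f x) / t n - g x\<bar> \<partial>lborel\<bar>
       \<le> (\<integral>\<^sup>+x. ennreal \<bar>(f (x + ?k) - f x) / t n - g x\<bar> \<partial>lborel)"
      using norm_integral_le_nn_integral[of lborel "\<lambda>x. \<bar>(f (x + ?k) - f x) / t n - g x\<bar>"] by simp
    also have "\<dots> \<le> (\<integral>\<^sup>+x. \<integral>\<^sup>+s. indicator {0..1} s * ennreal \<bar>g (x + s *\<^sub>R ?k) - g x\<bar> \<partial>lborel \<partial>lborel)"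
    proof (rule nn_integral_mono_AE)
      \<comment> \<open>This allows the integral over s to be split for almost every x.\<close>
      have "AE x in lborel. integrable lborel (\<lambda>s. indicator {0..1} s * g (x + s *\<^sub>R ?k))"
        using lborel_pair.AE_integrable_fst'[OF integrable_segment[OF g, of "\<lambda>_. 1" 1 ?k]] by simp
      with weak_pair_segment[OF w, of ?k]
      show "AE x in lborel. ennreal \<bar>(f (x + ?k) - f x) / t n - g x\<bar>
         \<le> (\<integral>\<^sup>+s. indicator {0..1} s * ennreal \<bar>g (x + s *\<^sub>R ?k) - g x\<bar> \<partial>lborel)"
      proof eventually_elim
        fix x assume eq: "f (x + ?k) - f x = (\<integral>s. indicator {0..1} s * (G (x + s *\<^sub>R ?k) \<bullet> ?k) \<partial>lborel)"
          and int: "integrable lborel (\<lambda>s. indicator {0..1} s * g (x + s *\<^sub>R ?k))"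
        have "(\<integral>s. indicator {0..1} s * (G (x + s *\<^sub>R ?k) \<bullet> ?k) \<partial>lborel)
           = (\<integral>s. t n * (indicator {0..1} s * g (x + s *\<^sub>R ?k)) \<partial>lborel)"
          unfolding g_def by (intro Bochner_Integration.integral_cong) auto
        then have "(f (x + ?k) - f x) / t n = (\<integral>s. indicator {0..1} s * g (x + s *\<^sub>R ?k) \<partial>lborel)"
          unfolding eq using t(2)[of n] by simp
        moreover have "g x = (\<integral>s. indicator {0..1::real} s * g x \<partial>lborel)" by simp
        ultimately have "(f (x + ?k) - f x) / t n - g x
           = (\<integral>s. indicator {0..1} s * g (x + s *\<^sub>R ?k) \<partial>lborel) - (\<integral>s. indicator {0..1::real} s * g x \<partial>lborel)"
          by simp
        also have "\<dots> = (\<integral>s. indicator {0..1} s * g (x + s *\<^sub>R ?k) - indicator {0..1::real} s * g x \<partial>lborel)"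
          using int by (intro Bochner_Integration.integral_diff[symmetric]) auto
        also have "\<dots> = (\<integral>s. indicator {0..1} s * (g (x + s *\<^sub>R ?k) - g x) \<partial>lborel)"
          by (simp add: right_diff_distrib)
        finally have "ennreal \<bar>(f (x + ?k) - f x) / t n - g x\<bar>
           \<le> (\<integral>\<^sup>+s. norm (indicator {0..1} s * (g (x + s *\<^sub>R ?k) - g x)) \<partial>lborel)"
          using norm_integral_le_nn_integral[of lborel "\<lambda>s. indicator {0..1} s * (g (x + s *\<^sub>R ?k) - g x)"] by simp
        also have "\<dots> = (\<integral>\<^sup>+s. indicator {0..1} s * ennreal \<bar>g (x + s *\<^sub>R ?k) - g x\<bar> \<partial>lborel)"
          by (intro nn_integral_cong) (auto simp: indicator_def)
        finally show "ennreal \<bar>(f (x + ?k) - f x) / t n - g x\<bar>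
           \<le> (\<integral>\<^sup>+s. indicator {0..1} s * ennreal \<bar>g (x + s *\<^sub>R ?k) - g x\<bar> \<partial>lborel)" .
      qed
    qed
    also have "\<dots> = (\<integral>\<^sup>+s. \<integral>\<^sup>+x. indicator {0..1::real} s * ennreal \<bar>g (x + s *\<^sub>R ?k) - g x\<bar> \<partial>lborel \<partial>lborel)"
      by (rule lborel_pair.Fubini') simp
    also have "\<dots> = (\<integral>\<^sup>+s. indicator {0..1::real} s * ennreal (modL1 g (s *\<^sub>R ?k)) \<partial>lborel)"
      unfolding modL1_def
      by (intro nn_integral_cong) (simp add: nn_integral_cmult nn_integral_eq_integral modL1_integrable g)
    also have "\<dots> \<le> (\<integral>\<^sup>+s. ennreal (e/2) * indicator {0..1::real} s \<partial>lborel)"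
    proof (rule nn_integral_mono)
      fix s :: real
      have "modL1 g (s *\<^sub>R ?k) \<le> e/2" if "s \<in> {0..1}"
      proof -
        have "norm (s *\<^sub>R ?k) = s * (t n * norm h)" using that t(2)[of n] by (simp add: abs_mult)
        also have "\<dots> \<le> t n * norm h"
          using that t(2)[of n] by (intro mult_left_le_one_le) auto
        finally have "norm (s *\<^sub>R ?k) < d" using N[OF n] by linarith
        then show ?thesis using d(2) by fastforce
      qed
      then show "indicator {0..1::real} s * ennreal (modL1 g (s *\<^sub>R ?k)) \<le> ennreal (e/2) * indicator {0..1} s"
        by (auto simp: indicator_def intro!: ennreal_leI)
    qed
    also have "\<dots> = ennreal (e/2)" by (simp add: nn_integral_cmult)
    finally have "\<bar>\<integral>x. \<bar>(f (x + ?k) - f x) / t n - g x\<bar> \<partial>lborel\<bar> \<le> e/2"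
      using \<open>e > 0\<close> by (subst (asm) ennreal_le_iff) auto
    then show ?thesis using \<open>e > 0\<close> by linarith
  qed
  then show "\<exists>N. \<forall>n\<ge>N. norm ((\<integral>x. \<bar>(f (x + t n *\<^sub>R h) - f x) / t n - G x \<bullet> h\<bar> \<partial>lborel) - 0) < e"
    unfolding g_def by auto
qed

section \<open>Chain rule and truncation\<close>

lemma smooth_lipschitz:
  assumes "smooth \<psi>" "\<And>x. norm (grad \<psi> x) \<le> B"
  shows "\<bar>\<psi> x - \<psi> y\<bar> \<le> B * norm (x - y)"
proof -
  have "norm (\<psi> x - \<psi> y) \<le> B * norm (x - y)"
  proof (rule differentiable_bound[of UNIV \<psi> "\<lambda>x h. grad \<psi> x \<bullet> h"])
    show "(\<psi> has_derivative (\<lambda>h. grad \<psi> x \<bullet> h)) (at x within UNIV)" for x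
      using smooth_has_derivative[OF assms(1)] .
    show "onorm (\<lambda>h. grad \<psi> x \<bullet> h) \<le> B" for x
    proof (rule onorm_le)
      fix h
      show "norm (grad \<psi> x \<bullet> h) \<le> B * norm h"
        using Cauchy_Schwarz_ineq2[of "grad \<psi> x" h] assms(2)[of x]
        by (metis mult_right_mono norm_ge_zero order_trans real_norm_def)
    qed
  qed auto
  then show ?thesis by simp
qed

text \<open>The second and third claims provide a majorant for dominated convergence. It involves F
  only through its growth constants, so it is common to a whole sequence of functions F.\<close>

lemma integrable_comp_mult_compact:
  fixes f :: "'a::euclidean_space \<Rightarrow> real"
  assumes f: "integrable lborel f" and [measurable]: "F \<in> borel_measurable borel" "\<psi> \<in> borel_measurable borel"
    and F: "\<And>t. \<bar>F t\<bar> \<le> a + L * \<bar>t\<bar>" and \<psi>: "\<And>x. \<bar>\<psi> x\<bar> \<le> B * indicator (cball 0 M) x" and "0 \<le> L" "0 \<le> B"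
  shows "integrable lborel (\<lambda>x. F (f x) * \<psi> x)"
    "integrable lborel (\<lambda>x. B * (a * indicator (cball 0 M) x + L * \<bar>f x\<bar>))"
    "norm (F (f x) * \<psi> x) \<le> B * (a * indicator (cball 0 M) x + L * \<bar>f x\<bar>)"
proof -
  have [measurable]: "f \<in> borel_measurable borel" using f by auto
  have ib: "integrable lborel (indicator (cball (0::'a) M) :: 'a \<Rightarrow> real)"
    using emeasure_lborel_cball_finite[of "0::'a" M] by simp
  show i: "integrable lborel (\<lambda>x. B * (a * indicator (cball 0 M) x + L * \<bar>f x\<bar>))"
    using f ib by simp
  show b: "norm (F (f x) * \<psi> x) \<le> B * (a * indicator (cball 0 M) x + L * \<bar>f x\<bar>)" for x
  proof (cases "x \<in> cball 0 M")
    case True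
    have "norm (F (f x) * \<psi> x) \<le> (a + L * \<bar>f x\<bar>) * B"
      using F[of "f x"] \<psi>[of x] True unfolding real_norm_def abs_mult
      by (intro mult_mono) (auto simp: indicator_def intro: order_trans[OF abs_ge_zero])
    then show ?thesis using True by (simp add: mult.commute)
  next
    case False
    then have "\<psi> x = 0" using \<psi>[of x] by simp
    then show ?thesis using assms False by simp
  qed
  show "integrable lborel (\<lambda>x. F (f x) * \<psi> x)"
    by (rule Bochner_Integration.integrable_bound[OF i])
      (use b in \<open>auto intro!: AE_I2 intro: order_trans[OF _ abs_ge_self]\<close>)
qed

lemma test_function_ball_bounds:
  assumes "test_function S (\<phi> :: 'a::euclidean_space \<Rightarrow> real)"
  obtains M B where "0 \<le> B" "0 \<le> M" "\<And>x. \<bar>\<phi> x\<bar> \<le> B * indicator (cball 0 M) x"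
    "\<And>x. norm (grad \<phi> x) \<le> B * indicator (cball 0 M) x"
proof -
  obtain K B where B: "compact K" "\<And>x. x \<notin> K \<Longrightarrow> \<phi> x = 0" "\<And>x. x \<notin> K \<Longrightarrow> grad \<phi> x = 0"
    "\<And>x. \<bar>\<phi> x\<bar> \<le> B" "\<And>x. norm (grad \<phi> x) \<le> B" "0 \<le> B"
    using test_function_bounds[OF assms] by metis
  obtain M where M: "\<And>x. x \<in> K \<Longrightarrow> norm x \<le> M"
    using compact_imp_bounded[OF B(1)] by (auto simp: bounded_iff)
  have K: "x \<in> K \<Longrightarrow> x \<in> cball 0 (max 0 M)" for x using M[of x] by auto
  have "\<bar>\<phi> x\<bar> \<le> B * indicator (cball 0 (max 0 M)) x" "norm (grad \<phi> x) \<le> B * indicator (cball 0 (max 0 M)) x" for x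
    using B(2-5)[of x] B(6) K[of x] by (cases "x \<in> K"; simp)+
  then show thesis using that[where B=B and M="max 0 M"] B(6) by simp
qed

text \<open>The chain rule is proved by difference quotients: they converge in \<open>L\<^sup>1\<close> to the derivative, and
  the slopes of \<open>F\<close> are bounded and converge almost everywhere along a subsequence.\<close>

lemma weak_pair_chain:
  fixes f :: "'a::euclidean_space \<Rightarrow> real"
  assumes w: "weak_pair f G" and \<psi>: "test_function UNIV \<psi>"
    and F: "\<And>t. (F has_real_derivative F' t) (at t)" and [measurable]: "F' \<in> borel_measurable borel"
    and L: "\<And>t. \<bar>F' t\<bar> \<le> L"
  shows "(\<integral>x. F (f x) * (grad \<psi> x \<bullet> h) \<partial>lborel) = - (\<integral>x. F' (f x) * (G x \<bullet> h) * \<psi> x \<partial>lborel)"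
proof -
  note [measurable] = weak_pairD(3,4)[OF w]
  note f = weak_pairD(1)[OF w]
  note s = test_function_smooth[OF \<psi>]
  note [measurable] = smooth_measurable[OF s] smooth_grad_measurable[OF s]
  have [measurable]: "F \<in> borel_measurable borel"
    using F by (intro borel_measurable_continuous_onI continuous_at_imp_continuous_on) (auto intro: DERIV_isCont)
  define g where "g x = G x \<bullet> h" for x
  have [measurable]: "g \<in> borel_measurable borel" unfolding g_def by simp
  have g: "integrable lborel g" unfolding g_def using weak_pairD(2)[OF w] by auto
  have L0: "0 \<le> L" using L[of 0] by simp
  have lip: "\<bar>F a - F b\<bar> \<le> L * \<bar>a - b\<bar>" for a b
    using field_differentiable_bound[of UNIV F F' L a b] F L by auto
  have Fb: "\<bar>F a\<bar> \<le> \<bar>F 0\<bar> + L * \<bar>a\<bar>" for a using lip[of a 0] by simp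
  obtain M B where B: "0 \<le> B" "0 \<le> M" "\<And>x. \<bar>\<psi> x\<bar> \<le> B * indicator (cball 0 M) x"
    "\<And>x. norm (grad \<psi> x) \<le> B * indicator (cball 0 M) x"
    using test_function_ball_bounds[OF \<psi>] by metis
  have B': "\<bar>\<psi> x\<bar> \<le> B" "norm (grad \<psi> x) \<le> B" for x
    using B(1) B(3)[of x] B(4)[of x] by (cases "x \<in> cball 0 M"; simp)+
  define t where "t n = 1 / real (Suc n)" for n
  have t: "t \<longlonglongrightarrow> 0" "\<And>n. t n > 0" "\<And>n. t n \<le> 1"
    unfolding t_def using LIMSEQ_inverse_real_of_nat by (auto simp: inverse_eq_divide field_simps)
  have "(\<lambda>n. modL1 f (t n *\<^sub>R h)) \<longlonglongrightarrow> 0"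
    using tendsto_scaleR[OF t(1) tendsto_const[of h]] by (intro modL1_tendsto f) simp
  then have "(\<lambda>n. \<integral>x. norm (f (x + t n *\<^sub>R h) - f x) \<partial>lborel) \<longlonglongrightarrow> 0"
    unfolding modL1_def by simp
  from tendsto_L1_AE_subseq[OF _ this]
  obtain r where r: "strict_mono r" "AE x in lborel. (\<lambda>n. f (x + t (r n) *\<^sub>R h) - f x) \<longlonglongrightarrow> 0"
    using f integrable_shift[OF f] by auto
  define u where "u n = t (r n)" for n
  have u: "u \<longlonglongrightarrow> 0" "\<And>n. u n > 0" "\<And>n. u n \<le> 1"
    unfolding u_def using t LIMSEQ_subseq_LIMSEQ[OF t(1) r(1)] by (auto simp: o_def)
  have uf: "AE x in lborel. (\<lambda>n. f (x + u n *\<^sub>R h)) \<longlonglongrightarrow> f x"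
    using r(2) by eventually_elim (simp add: u_def LIM_zero_iff)

  \<comment> \<open>The slope of F between the values at x and at the translate of x, completed by
    F' where these coincide. Thus the increment of F is the slope times the increment of f at every
    point.\<close>
  define m where "m n x = (if f (x + u n *\<^sub>R h) = f x then F' (f x)
     else (F (f (x + u n *\<^sub>R h)) - F (f x)) / (f (x + u n *\<^sub>R h) - f x))" for n x
  have [measurable]: "m n \<in> borel_measurable borel" for n unfolding m_def by measurable
  have m: "F (f (x + u n *\<^sub>R h)) - F (f x) = m n x * (f (x + u n *\<^sub>R h) - f x)" for n x
    by (simp add: m_def)
  have mL: "\<bar>m n x\<bar> \<le> L" for n x
    using L[of "f x"] lip[of "f (x + u n *\<^sub>R h)" "f x"] by (auto simp: m_def abs_divide divide_le_eq)
  have mlim: "AE x in lborel. (\<lambda>n. m n x) \<longlonglongrightarrow> F' (f x)"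
    using uf
  proof eventually_elim
    fix x assume lim: "(\<lambda>n. f (x + u n *\<^sub>R h)) \<longlonglongrightarrow> f x"
    have "((\<lambda>y. if y = f x then F' (f x) else (F y - F (f x)) / (y - f x)) \<longlongrightarrow> F' (f x)) (at (f x))"
      by (rule Lim_transform_eventually[OF F[of "f x", unfolded has_field_derivative_iff]])
        (auto simp: eventually_at_filter)
    then have "isCont (\<lambda>y. if y = f x then F' (f x) else (F y - F (f x)) / (y - f x)) (f x)"
      by (simp add: isCont_def)
    from isCont_tendsto_compose[OF this lim] show "(\<lambda>n. m n x) \<longlonglongrightarrow> F' (f x)"
      by (simp add: m_def)
  qed

  \<comment> \<open>The limit of this sequence is computed twice: here the difference quotient falls
    on \<psi>, where it converges uniformly bounded to a classical derivative.\<close>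
  define l where "l n = (\<integral>x. F (f x) * ((\<psi> (x - u n *\<^sub>R h) - \<psi> x) / u n) \<partial>lborel)" for n
  have \<psi>b: "\<bar>(\<psi> (x - u n *\<^sub>R h) - \<psi> x) / u n\<bar> \<le> (B * norm h) * indicator (cball 0 (M + norm h)) x" for n x
  proof (cases "x \<in> cball 0 (M + norm h)")
    case True
    have "\<bar>\<psi> (x - u n *\<^sub>R h) - \<psi> x\<bar> \<le> B * (u n * norm h)"
      using smooth_lipschitz[OF s B'(2), of "x - u n *\<^sub>R h" x] u(2)[of n] by (simp add: abs_mult)
    then show ?thesis using True u(2)[of n] by (simp add: abs_divide divide_le_eq mult_ac)
  next
    case False
    have "norm (u n *\<^sub>R h) \<le> norm h" using u(2,3)[of n] by (simp add: mult_left_le_one_le less_imp_le)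
    then have "norm x \<le> norm (x - u n *\<^sub>R h) + norm h"
      using norm_triangle_ineq[of "x - u n *\<^sub>R h" "u n *\<^sub>R h"] by simp
    then have "x - u n *\<^sub>R h \<notin> cball 0 M" "x \<notin> cball 0 M"
      using False norm_ge_zero[of h] by (auto simp: not_le simp del: norm_ge_zero)
    then have "\<psi> (x - u n *\<^sub>R h) = 0" "\<psi> x = 0" using B(3)[of x] B(3)[of "x - u n *\<^sub>R h"] by auto
    then show ?thesis using B by simp
  qed
  have lim1: "l \<longlonglongrightarrow> (\<integral>x. F (f x) * (- (grad \<psi> x \<bullet> h)) \<partial>lborel)"
    unfolding l_def
  proof (rule integral_dominated_convergence)
    show "integrable lborel (\<lambda>x. (B * norm h) * (\<bar>F 0\<bar> * indicator (cball 0 (M + norm h)) x + L * \<bar>f x\<bar>))"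
      by (rule integrable_comp_mult_compact(2)[OF f _ _ Fb \<psi>b[of _ 0] L0]) (use B in auto)
    show "AE x in lborel. norm (F (f x) * ((\<psi> (x - u n *\<^sub>R h) - \<psi> x) / u n))
      \<le> (B * norm h) * (\<bar>F 0\<bar> * indicator (cball 0 (M + norm h)) x + L * \<bar>f x\<bar>)" for n
      by (rule AE_I2, rule integrable_comp_mult_compact(3)[OF f _ _ Fb \<psi>b[of _ n] L0]) (use B in auto)
    show "AE x in lborel. (\<lambda>n. F (f x) * ((\<psi> (x - u n *\<^sub>R h) - \<psi> x) / u n)) \<longlonglongrightarrow> F (f x) * (- (grad \<psi> x \<bullet> h))"
    proof (rule AE_I2, rule tendsto_mult[OF tendsto_const])
      fix x
      have "((\<lambda>s. (\<psi> (x + s *\<^sub>R - h) - \<psi> x) / s) \<longlongrightarrow> grad \<psi> x \<bullet> - h) (at 0)"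
        using smooth_line_deriv[OF s, of x "-h" 0] by (simp add: DERIV_def)
      then have "((\<lambda>s. (\<psi> (x - s *\<^sub>R h) - \<psi> x) / s) \<longlongrightarrow> - (grad \<psi> x \<bullet> h)) (at 0)" by simp
      moreover have "filterlim u (at 0) sequentially"
        using u by (intro filterlim_atI) (auto simp: less_le)
      ultimately show "(\<lambda>n. (\<psi> (x - u n *\<^sub>R h) - \<psi> x) / u n) \<longlonglongrightarrow> - (grad \<psi> x \<bullet> h)"
        by (rule filterlim_compose)
    qed
  qed simp_all

  \<comment> \<open>A shift by u n h moves the difference quotient from \<psi> to the composition of
    F and f.\<close>
  have leq: "l n = (\<integral>x. m n x * ((f (x + u n *\<^sub>R h) - f x) / u n) * \<psi> x \<partial>lborel)" for n
  proof -
    have B2: "\<bar>\<psi> (x - u n *\<^sub>R h)\<bar> \<le> B * indicator (cball 0 (M + norm h)) x" for x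
    proof (cases "x \<in> cball 0 (M + norm h)")
      case True then show ?thesis using B'(1)[of "x - u n *\<^sub>R h"] by simp
    next
      case False
      have "norm (u n *\<^sub>R h) \<le> norm h" using u(2,3)[of n] by (simp add: mult_left_le_one_le less_imp_le)
      then have "norm x \<le> norm (x - u n *\<^sub>R h) + norm h"
        using norm_triangle_ineq[of "x - u n *\<^sub>R h" "u n *\<^sub>R h"] by simp
      then have "x - u n *\<^sub>R h \<notin> cball 0 M" using False by (auto simp: not_le)
      then show ?thesis using B(3)[of "x - u n *\<^sub>R h"] False by auto
    qed
    have i1: "integrable lborel (\<lambda>x. F (f x) * \<psi> x)"
      by (rule integrable_comp_mult_compact(1)[OF f _ _ Fb B(3) L0 B(1)]) auto
    have i2: "integrable lborel (\<lambda>x. F (f x) * \<psi> (x - u n *\<^sub>R h))"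
      by (rule integrable_comp_mult_compact(1)[OF f _ _ Fb B2 L0 B(1)]) auto
    have i3: "integrable lborel (\<lambda>x. F (f (x + u n *\<^sub>R h)) * \<psi> x)"
      using integrable_shift[OF i2, of "u n *\<^sub>R h"] by simp
    have "u n * l n = (\<integral>x. u n * (F (f x) * ((\<psi> (x - u n *\<^sub>R h) - \<psi> x) / u n)) \<partial>lborel)"
      unfolding l_def by simp
    also have "\<dots> = (\<integral>x. F (f x) * \<psi> (x - u n *\<^sub>R h) - F (f x) * \<psi> x \<partial>lborel)"
      using u(2)[of n] by (intro Bochner_Integration.integral_cong) (auto simp: field_simps)
    also have "\<dots> = (\<integral>x. F (f x) * \<psi> (x - u n *\<^sub>R h) \<partial>lborel) - (\<integral>x. F (f x) * \<psi> x \<partial>lborel)"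
      using i1 i2 by simp
    also have "(\<integral>x. F (f x) * \<psi> (x - u n *\<^sub>R h) \<partial>lborel) = (\<integral>x. F (f (x + u n *\<^sub>R h)) * \<psi> x \<partial>lborel)"
      using integral_shift[of "\<lambda>x. F (f x) * \<psi> (x - u n *\<^sub>R h)" "u n *\<^sub>R h"] by simp
    also have "\<dots> - (\<integral>x. F (f x) * \<psi> x \<partial>lborel) = (\<integral>x. F (f (x + u n *\<^sub>R h)) * \<psi> x - F (f x) * \<psi> x \<partial>lborel)"
      using i1 i3 by simp
    also have "\<dots> = (\<integral>x. u n * (m n x * ((f (x + u n *\<^sub>R h) - f x) / u n) * \<psi> x) \<partial>lborel)"
      using u(2)[of n] by (intro Bochner_Integration.integral_cong) (auto simp: left_diff_distrib[symmetric] m)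
    also have "\<dots> = u n * (\<integral>x. m n x * ((f (x + u n *\<^sub>R h) - f x) / u n) * \<psi> x \<partial>lborel)" by (rule integral_mult_right_zero)
    finally have eq: "u n * l n = u n * (\<integral>x. m n x * ((f (x + u n *\<^sub>R h) - f x) / u n) * \<psi> x \<partial>lborel)" .
    have nz: "u n \<noteq> 0" using u(2)[of n] by simp
    show ?thesis by (rule mult_left_cancel[OF nz, THEN iffD1, OF eq])
  qed

  have m\<psi>: "\<bar>m n x * \<psi> x\<bar> \<le> L * B" for n x
    unfolding abs_mult using mL[of n x] B'(1)[of x] L0 by (intro mult_mono) auto
  \<comment> \<open>The difference quotient of f is its L1 limit g plus the error q. Against q the
    boundedness of the slopes is used, against g their convergence almost everywhere.\<close>
  define q where "q n x = (f (x + u n *\<^sub>R h) - f x) / u n - g x" for n x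
  have qi: "integrable lborel (q n)" for n
    unfolding q_def using f g integrable_shift[OF f] by auto
  have [measurable]: "q n \<in> borel_measurable borel" for n unfolding q_def by measurable
  have "(\<lambda>n. L * B * (\<integral>x. \<bar>q n x\<bar> \<partial>lborel)) \<longlonglongrightarrow> L * B * 0"
    unfolding q_def g_def by (intro tendsto_intros weak_pair_difference_quotient[OF w u(1,2)])
  then have "(\<lambda>n. L * B * (\<integral>x. \<bar>q n x\<bar> \<partial>lborel)) \<longlonglongrightarrow> 0" by simp
  then have lim2: "(\<lambda>n. \<integral>x. q n x * (m n x * \<psi> x) \<partial>lborel) \<longlonglongrightarrow> 0"
  proof (rule Lim_null_comparison[rotated], intro always_eventually allI)
    fix n
    have "norm (\<integral>x. q n x * (m n x * \<psi> x) \<partial>lborel) \<le> (\<integral>x. norm (q n x * (m n x * \<psi> x)) \<partial>lborel)"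
      by (rule integral_norm_bound)
    also have "\<dots> \<le> (\<integral>x. L * B * \<bar>q n x\<bar> \<partial>lborel)"
    proof (rule integral_mono)
      show "integrable lborel (\<lambda>x. norm (q n x * (m n x * \<psi> x)))"
        by (rule integrable_norm, rule integrable_mult_bounded[OF qi _ m\<psi>]) simp
      show "integrable lborel (\<lambda>x. L * B * \<bar>q n x\<bar>)" using qi by simp
      show "norm (q n x * (m n x * \<psi> x)) \<le> L * B * \<bar>q n x\<bar>" for x
        using mult_right_mono[OF m\<psi>[of n x] abs_ge_zero[of "q n x"]] by (simp add: abs_mult mult_ac)
    qed
    finally show "norm (\<integral>x. q n x * (m n x * \<psi> x) \<partial>lborel) \<le> L * B * (\<integral>x. \<bar>q n x\<bar> \<partial>lborel)" by simp
  qed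
  have lim3: "(\<lambda>n. \<integral>x. g x * (m n x * \<psi> x) \<partial>lborel) \<longlonglongrightarrow> (\<integral>x. g x * (F' (f x) * \<psi> x) \<partial>lborel)"
  proof (rule integral_dominated_convergence)
    show "integrable lborel (\<lambda>x. L * B * \<bar>g x\<bar>)" using g by simp
    show "AE x in lborel. norm (g x * (m n x * \<psi> x)) \<le> L * B * \<bar>g x\<bar>" for n
    proof (rule AE_I2)
      fix x show "norm (g x * (m n x * \<psi> x)) \<le> L * B * \<bar>g x\<bar>"
        using mult_right_mono[OF m\<psi>[of n x] abs_ge_zero[of "g x"]] by (simp add: abs_mult mult_ac)
    qed
    show "AE x in lborel. (\<lambda>n. g x * (m n x * \<psi> x)) \<longlonglongrightarrow> g x * (F' (f x) * \<psi> x)"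
      using mlim by eventually_elim (intro tendsto_intros)
  qed simp_all
  have "l n = (\<integral>x. q n x * (m n x * \<psi> x) \<partial>lborel) + (\<integral>x. g x * (m n x * \<psi> x) \<partial>lborel)" for n
  proof -
    have "l n = (\<integral>x. q n x * (m n x * \<psi> x) + g x * (m n x * \<psi> x) \<partial>lborel)"
      unfolding leq q_def by (intro Bochner_Integration.integral_cong) (auto simp: algebra_simps)
    also have "\<dots> = (\<integral>x. q n x * (m n x * \<psi> x) \<partial>lborel) + (\<integral>x. g x * (m n x * \<psi> x) \<partial>lborel)"
      by (intro Bochner_Integration.integral_add integrable_mult_bounded[OF qi _ m\<psi>] integrable_mult_bounded[OF g _ m\<psi>]) simp_all
    finally show ?thesis .
  qed
  then have "l = (\<lambda>n. (\<integral>x. q n x * (m n x * \<psi> x) \<partial>lborel) + (\<integral>x. g x * (m n x * \<psi> x) \<partial>lborel))"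
    by (rule ext)
  then have "l \<longlonglongrightarrow> 0 + (\<integral>x. g x * (F' (f x) * \<psi> x) \<partial>lborel)"
    using tendsto_add[OF lim2 lim3] by (simp only:)
  from LIMSEQ_unique[OF lim1 this] show ?thesis
    by (simp add: g_def mult_ac)
qed

lemma pos_part_sq_deriv: "((\<lambda>x::real. (max 0 x)\<^sup>2) has_real_derivative 2 * max 0 x) (at x)"
proof -
  consider "x < 0" | "x > 0" | "x = 0" by linarith
  then show ?thesis
  proof cases
    case 1
    have "((\<lambda>x. 0) has_real_derivative 0) (at x)" by simp
    then have "((\<lambda>x::real. (max 0 x)\<^sup>2) has_real_derivative 0) (at x)"
      by (rule has_field_derivative_transform_within_open[where S="{..<0}"]) (use 1 in auto)
    with 1 show ?thesis by simp
  next
    case 2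
    have "((\<lambda>x. x\<^sup>2) has_real_derivative 2 * x) (at x)" by (auto intro!: derivative_eq_intros)
    then have "((\<lambda>x::real. (max 0 x)\<^sup>2) has_real_derivative 2 * x) (at x)"
      by (rule has_field_derivative_transform_within_open[where S="{0<..}"]) (use 2 in auto)
    with 2 show ?thesis by simp
  next
    case 3
    have "((\<lambda>h::real. (max 0 h)\<^sup>2 / h) \<longlongrightarrow> 0) (at 0)"
    proof (rule Lim_null_comparison[where g="\<lambda>h. \<bar>h\<bar>"])
      show "\<forall>\<^sub>F h in at 0. norm ((max 0 h)\<^sup>2 / h) \<le> \<bar>h::real\<bar>"
        by (auto simp: max_def power2_eq_square)
      show "((\<lambda>h::real. \<bar>h\<bar>) \<longlongrightarrow> 0) (at 0)"
        using tendsto_rabs[OF tendsto_ident_at[of "0::real" UNIV]] by simp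
    qed
    then show ?thesis using 3 by (simp add: DERIV_def)
  qed
qed

text \<open>The approximation \<open>sqrt ((l - t)\<^sub>+\<^sup>2 + \<epsilon>\<^sup>2)\<close> is \<open>C\<^sup>1\<close> and its derivative vanishes at \<open>t = l\<close>, so the
  formula comes out without knowing that the weak gradient vanishes on \<open>{f = l}\<close>.\<close>

lemma weak_pair_chain_pos_part:
  fixes f :: "'a::euclidean_space \<Rightarrow> real"
  assumes w: "weak_pair f G" and \<psi>: "test_function UNIV \<psi>"
  shows "(\<integral>x. max 0 (l - f x) * (grad \<psi> x \<bullet> h) \<partial>lborel)
    = (\<integral>x. indicator {x. f x < l} x * (G x \<bullet> h) * \<psi> x \<partial>lborel)"
proof -
  note [measurable] = weak_pairD(3,4)[OF w]
  note f = weak_pairD(1)[OF w]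
  note s = test_function_smooth[OF \<psi>]
  note [measurable] = smooth_measurable[OF s] smooth_grad_measurable[OF s]
  obtain M B where B: "0 \<le> B" "0 \<le> M" "\<And>x. \<bar>\<psi> x\<bar> \<le> B * indicator (cball 0 M) x"
    "\<And>x. norm (grad \<psi> x) \<le> B * indicator (cball 0 M) x"
    using test_function_ball_bounds[OF \<psi>] by metis
  define e where "e n = 1 / real (Suc n)" for n
  have e: "e \<longlonglongrightarrow> 0" "\<And>n. e n > 0" "\<And>n. e n \<le> 1"
    unfolding e_def using LIMSEQ_inverse_real_of_nat by (auto simp: inverse_eq_divide field_simps)
  define F where "F n t = sqrt ((max 0 (l - t))\<^sup>2 + (e n)\<^sup>2)" for n t
  define F' where "F' n t = - (max 0 (l - t) / F n t)" for n t
  have Fpos: "F n t > 0" for n t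
    unfolding F_def using e(2)[of n] by (auto intro!: add_nonneg_pos)
  have F: "(F n has_real_derivative F' n t) (at t)" for n t
  proof -
    have "((\<lambda>t. (max 0 (l - t))\<^sup>2) has_real_derivative 2 * max 0 (l - t) * (- 1)) (at t)"
      by (rule DERIV_chain2[OF pos_part_sq_deriv]) (auto intro!: derivative_eq_intros)
    from DERIV_add[OF this DERIV_const[of "(e n)\<^sup>2"]]
    have "((\<lambda>t. (max 0 (l - t))\<^sup>2 + (e n)\<^sup>2) has_real_derivative - 2 * max 0 (l - t)) (at t)"
      by simp
    note d = this
    have pos: "0 < (max 0 (l - t))\<^sup>2 + (e n)\<^sup>2"
      using e(2)[of n] by (auto intro!: add_nonneg_pos)
    from pos d have "((\<lambda>t. sqrt ((max 0 (l - t))\<^sup>2 + (e n)\<^sup>2)) has_real_derivative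
       (inverse (sqrt ((max 0 (l - t))\<^sup>2 + (e n)\<^sup>2)) / 2) * (- 2 * max 0 (l - t))) (at t)"
      by (rule DERIV_chain2[where g="\<lambda>t. (max 0 (l - t))\<^sup>2 + (e n)\<^sup>2" and f=sqrt, OF DERIV_real_sqrt])
    moreover have "F n = (\<lambda>t. sqrt ((max 0 (l - t))\<^sup>2 + (e n)\<^sup>2))" by (rule ext) (rule F_def)
    moreover have "F' n t = (inverse (sqrt ((max 0 (l - t))\<^sup>2 + (e n)\<^sup>2)) / 2) * (- 2 * max 0 (l - t))"
      unfolding F'_def F_def by (simp only: divide_inverse) simp
    ultimately show ?thesis by (simp only:)
  qed
  have [measurable]: "F n \<in> borel_measurable borel" "F' n \<in> borel_measurable borel" for n
    unfolding F'_def F_def by measurable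
  have ge: "max 0 (l - t) \<le> F n t" for n t
    unfolding F_def by (rule real_le_rsqrt) simp
  have F'1: "\<bar>F' n t\<bar> \<le> 1" for n t
    using ge[of t n] Fpos[of n t] by (simp add: F'_def divide_le_eq)
  have le: "F n t \<le> max 0 (l - t) + e n" for n t
    unfolding F_def by (rule real_le_lsqrt) (use e(2)[of n] in \<open>auto simp: power2_sum less_imp_le\<close>)
  \<comment> \<open>One growth bound for all n, thanks to e n <= 1; it yields the common majorant
    below.\<close>
  have Fb: "\<bar>F n t\<bar> \<le> (\<bar>l\<bar> + 1) + 1 * \<bar>t\<bar>" for n t
    using le[of n t] Fpos[of n t] e(3)[of n] by linarith
  have Flim: "(\<lambda>n. F n t) \<longlonglongrightarrow> max 0 (l - t)" for t
  proof (rule tendsto_sandwich[OF _ _ tendsto_const])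
    show "(\<lambda>n. max 0 (l - t) + e n) \<longlonglongrightarrow> max 0 (l - t)"
      using tendsto_add[OF tendsto_const e(1), of "max 0 (l - t)"] by simp
  qed (use ge le in auto)
  have F'lim: "(\<lambda>n. F' n t) \<longlonglongrightarrow> - indicator {..<l} t" for t
  proof (cases "t < l")
    case True
    have "(\<lambda>n. - (max 0 (l - t) / F n t)) \<longlonglongrightarrow> - (max 0 (l - t) / max 0 (l - t))"
      using True by (intro tendsto_intros Flim) auto
    then show ?thesis using True by (simp add: F'_def)
  next
    case False
    then show ?thesis by (simp add: F'_def)
  qed
  have gb: "\<bar>grad \<psi> x \<bullet> h\<bar> \<le> (B * norm h) * indicator (cball 0 M) x" for x
  proof -
    have "\<bar>grad \<psi> x \<bullet> h\<bar> \<le> norm (grad \<psi> x) * norm h" by (rule Cauchy_Schwarz_ineq2)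
    also have "\<dots> \<le> (B * indicator (cball 0 M) x) * norm h" by (rule mult_right_mono[OF B(4)]) simp
    finally show ?thesis by (simp add: mult_ac)
  qed
  have lim1: "(\<lambda>n. \<integral>x. F n (f x) * (grad \<psi> x \<bullet> h) \<partial>lborel) \<longlonglongrightarrow> (\<integral>x. max 0 (l - f x) * (grad \<psi> x \<bullet> h) \<partial>lborel)"
  proof (rule integral_dominated_convergence)
    show "integrable lborel (\<lambda>x. (B * norm h) * ((\<bar>l\<bar> + 1) * indicator (cball 0 M) x + 1 * \<bar>f x\<bar>))"
      by (rule integrable_comp_mult_compact(2)[OF f, of "F 0", OF _ _ Fb gb]) (use B in auto)
    show "AE x in lborel. norm (F n (f x) * (grad \<psi> x \<bullet> h)) \<le> (B * norm h) * ((\<bar>l\<bar> + 1) * indicator (cball 0 M) x + 1 * \<bar>f x\<bar>)" for n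
      by (rule AE_I2, rule integrable_comp_mult_compact(3)[OF f _ _ Fb gb]) (use B in auto)
    show "AE x in lborel. (\<lambda>n. F n (f x) * (grad \<psi> x \<bullet> h)) \<longlonglongrightarrow> max 0 (l - f x) * (grad \<psi> x \<bullet> h)"
      by (intro AE_I2 tendsto_intros Flim)
  qed simp_all
  have g: "integrable lborel (\<lambda>x. (G x \<bullet> h) * \<psi> x)"
    using weak_pairD(2)[OF w] by (intro integrable_mult_test(1)[OF _ \<psi>]) auto
  have lim2: "(\<lambda>n. \<integral>x. F' n (f x) * (G x \<bullet> h) * \<psi> x \<partial>lborel) \<longlonglongrightarrow> (\<integral>x. - indicator {..<l} (f x) * (G x \<bullet> h) * \<psi> x \<partial>lborel)"
  proof (rule integral_dominated_convergence)
    show "integrable lborel (\<lambda>x. \<bar>(G x \<bullet> h) * \<psi> x\<bar>)" using g by simp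
    show "AE x in lborel. norm (F' n (f x) * (G x \<bullet> h) * \<psi> x) \<le> \<bar>(G x \<bullet> h) * \<psi> x\<bar>" for n
    proof (rule AE_I2)
      fix x show "norm (F' n (f x) * (G x \<bullet> h) * \<psi> x) \<le> \<bar>(G x \<bullet> h) * \<psi> x\<bar>"
        using mult_right_mono[OF F'1[of n "f x"] abs_ge_zero[of "(G x \<bullet> h) * \<psi> x"]]
        by (simp add: abs_mult mult_ac)
    qed
    show "AE x in lborel. (\<lambda>n. F' n (f x) * (G x \<bullet> h) * \<psi> x) \<longlonglongrightarrow> - indicator {..<l} (f x) * (G x \<bullet> h) * \<psi> x"
      by (intro AE_I2 tendsto_mult tendsto_const F'lim)
  qed simp_all
  have "(\<lambda>n. \<integral>x. F n (f x) * (grad \<psi> x \<bullet> h) \<partial>lborel) \<longlonglongrightarrow> - (\<integral>x. - indicator {..<l} (f x) * (G x \<bullet> h) * \<psi> x \<partial>lborel)"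
  proof -
    have "(\<integral>x. F n (f x) * (grad \<psi> x \<bullet> h) \<partial>lborel) = - (\<integral>x. F' n (f x) * (G x \<bullet> h) * \<psi> x \<partial>lborel)" for n
      by (rule weak_pair_chain[OF w \<psi> F _ F'1]) simp
    then show ?thesis using tendsto_minus[OF lim2] by (simp only:)
  qed
  from LIMSEQ_unique[OF lim1 this] show ?thesis
    by (simp add: indicator_def)
qed

text \<open>The product rule is contained in the choice of the test function: the chain rule for the
  positive part is tested with \<eta> \<phi>, whose gradient has the two expected terms.\<close>

lemma weak_pair_truncate:
  fixes f :: "'a::euclidean_space \<Rightarrow> real"
  assumes w: "weak_pair f G" and \<eta>: "test_function UNIV \<eta>"
  shows "weak_pair (\<lambda>x. \<eta> x * max 0 (l - f x))
    (\<lambda>x. max 0 (l - f x) *\<^sub>R grad \<eta> x - (\<eta> x * indicator {x. f x < l} x) *\<^sub>R G x)"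
  unfolding weak_pair_def
proof (intro conjI allI impI)
  note [measurable] = weak_pairD(3,4)[OF w]
  note f = weak_pairD(1)[OF w] and g = weak_pairD(2)[OF w]
  note s = test_function_smooth[OF \<eta>]
  note [measurable] = smooth_measurable[OF s] smooth_grad_measurable[OF s]
  obtain M B where B: "0 \<le> B" "0 \<le> M" "\<And>x. \<bar>\<eta> x\<bar> \<le> B * indicator (cball 0 M) x"
    "\<And>x. norm (grad \<eta> x) \<le> B * indicator (cball 0 M) x"
    using test_function_ball_bounds[OF \<eta>] by metis
  have pb: "\<bar>max 0 (l - t)\<bar> \<le> \<bar>l\<bar> + 1 * \<bar>t\<bar>" for t :: real by linarith
  note ic = integrable_comp_mult_compact[OF f, of "\<lambda>t. max 0 (l - t)", OF _ _ pb _ _ B(1)]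
  show 1: "integrable lborel (\<lambda>x. \<eta> x * max 0 (l - f x))"
    using ic(1)[OF _ _ B(3)] by (simp add: mult.commute)
  have 2: "integrable lborel (\<lambda>x. max 0 (l - f x) *\<^sub>R grad \<eta> x)"
  proof (rule Bochner_Integration.integrable_bound)
    show "integrable lborel (\<lambda>x. max 0 (l - f x) * norm (grad \<eta> x))"
      by (rule ic(1)) (use B(4) in auto)
  qed auto
  have bd: "\<bar>\<eta> x * indicator {x. f x < l} x\<bar> \<le> B" for x
    using B(1) B(3)[of x] by (cases "x \<in> cball 0 M") (auto simp: indicator_def)
  have 3: "integrable lborel (\<lambda>x. (\<eta> x * indicator {x. f x < l} x) *\<^sub>R G x)"
  proof (rule Bochner_Integration.integrable_bound)
    show "integrable lborel (\<lambda>x. B * norm (G x))" using g by simp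
    show "AE x in lborel. norm ((\<eta> x * indicator {x. f x < l} x) *\<^sub>R G x) \<le> norm (B * norm (G x))"
    proof (rule AE_I2)
      fix x
      have "norm ((\<eta> x * indicator {x. f x < l} x) *\<^sub>R G x) \<le> B * norm (G x)"
        unfolding norm_scaleR by (rule mult_right_mono[OF bd]) simp
      also have "\<dots> \<le> norm (B * norm (G x))" by simp
      finally show "norm ((\<eta> x * indicator {x. f x < l} x) *\<^sub>R G x) \<le> norm (B * norm (G x))" .
    qed
  qed simp
  show "integrable lborel (\<lambda>x. max 0 (l - f x) *\<^sub>R grad \<eta> x - (\<eta> x * indicator {x. f x < l} x) *\<^sub>R G x)"
    using 2 3 by (rule Bochner_Integration.integrable_diff)
  fix \<phi> :: "'a \<Rightarrow> real" and h assume \<phi>: "test_function UNIV \<phi>"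
  note s\<phi> = test_function_smooth[OF \<phi>]
  note [measurable] = smooth_measurable[OF s\<phi>] smooth_grad_measurable[OF s\<phi>]
  have \<eta>\<phi>: "test_function UNIV (\<lambda>x. \<eta> x * \<phi> x)" by (rule test_function_mult[OF \<eta> s\<phi>])
  have i1: "integrable lborel (\<lambda>x. \<eta> x * max 0 (l - f x) * (grad \<phi> x \<bullet> h))"
    by (rule integrable_mult_test(2)[OF 1 \<phi>])
  have i2: "integrable lborel (\<lambda>x. ((max 0 (l - f x) *\<^sub>R grad \<eta> x) \<bullet> h) * \<phi> x)"
    by (intro integrable_mult_test(1)[OF _ \<phi>] integrable_inner_left 2)
  have i3: "integrable lborel (\<lambda>x. (((\<eta> x * indicator {x. f x < l} x) *\<^sub>R G x) \<bullet> h) * \<phi> x)"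
    by (intro integrable_mult_test(1)[OF _ \<phi>] integrable_inner_left 3)
  have "(\<integral>x. \<eta> x * max 0 (l - f x) * (grad \<phi> x \<bullet> h) \<partial>lborel) + (\<integral>x. ((max 0 (l - f x) *\<^sub>R grad \<eta> x) \<bullet> h) * \<phi> x \<partial>lborel)
    = (\<integral>x. max 0 (l - f x) * (grad (\<lambda>x. \<eta> x * \<phi> x) x \<bullet> h) \<partial>lborel)"
    unfolding Bochner_Integration.integral_add[OF i1 i2, symmetric] grad_mult[OF s s\<phi>]
    by (intro Bochner_Integration.integral_cong) (auto simp: algebra_simps inner_add_left)
  also have "\<dots> = (\<integral>x. indicator {x. f x < l} x * (G x \<bullet> h) * (\<eta> x * \<phi> x) \<partial>lborel)"
    by (rule weak_pair_chain_pos_part[OF w \<eta>\<phi>])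
  also have "\<dots> = (\<integral>x. (((\<eta> x * indicator {x. f x < l} x) *\<^sub>R G x) \<bullet> h) * \<phi> x \<partial>lborel)"
    by (intro Bochner_Integration.integral_cong) auto
  finally have "(\<integral>x. \<eta> x * max 0 (l - f x) * (grad \<phi> x \<bullet> h) \<partial>lborel)
    = (\<integral>x. (((\<eta> x * indicator {x. f x < l} x) *\<^sub>R G x) \<bullet> h) * \<phi> x \<partial>lborel)
      - (\<integral>x. ((max 0 (l - f x) *\<^sub>R grad \<eta> x) \<bullet> h) * \<phi> x \<partial>lborel)" by simp
  also have "\<dots> = - (\<integral>x. ((max 0 (l - f x) *\<^sub>R grad \<eta> x - (\<eta> x * indicator {x. f x < l} x) *\<^sub>R G x) \<bullet> h) * \<phi> x \<partial>lborel)"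
    using i2 i3 unfolding inner_diff_left left_diff_distrib by (subst Bochner_Integration.integral_diff) auto
  finally show "(\<integral>x. \<eta> x * max 0 (l - f x) * (grad \<phi> x \<bullet> h) \<partial>lborel)
    = - (\<integral>x. ((max 0 (l - f x) *\<^sub>R grad \<eta> x - (\<eta> x * indicator {x. f x < l} x) *\<^sub>R G x) \<bullet> h) * \<phi> x \<partial>lborel)" .
qed

section \<open>De Giorgi's method\<close>

definition sublevel :: "('a::euclidean_space \<Rightarrow> real) \<Rightarrow> 'a \<Rightarrow> real \<Rightarrow> real \<Rightarrow> real" where
  "sublevel f x\<^sub>0 l b = measure lborel (ball x\<^sub>0 b \<inter> {x. f x < l})"

text \<open>Membership in a De Giorgi class, for levels from \<tau> upwards only, since below \<tau>
  the tail is not controlled by the level. The measure of the sublevel set replaces the usual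
  integral of (l - f)_+^p, because f >= 0 makes (l - f)_+ at most l.\<close>

definition caccioppoli ::
    "real \<Rightarrow> real \<Rightarrow> ('a::euclidean_space \<Rightarrow> real) \<Rightarrow> ('a \<Rightarrow> 'a) \<Rightarrow> 'a \<Rightarrow> real \<Rightarrow> real \<Rightarrow> bool" where
  "caccioppoli p C f G x\<^sub>0 r \<tau> \<longleftrightarrow> (\<forall>l a b. \<tau> \<le> l \<longrightarrow> 0 < a \<longrightarrow> a < b \<longrightarrow> b \<le> 8 * r \<longrightarrow>
     (\<integral>\<^sup>+x. indicator (ball x\<^sub>0 a \<inter> {x. f x < l}) x * ennreal (norm (G x) powr p) \<partial>lborel)
       \<le> ennreal (C * (l / (b - a)) powr p * sublevel f x\<^sub>0 l b))"

lemma finite_ball_Int: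
  fixes x\<^sub>0 :: "'a::euclidean_space"
  shows "emeasure lborel (ball x\<^sub>0 b \<inter> S) < \<infinity>"
proof (cases "ball x\<^sub>0 b \<inter> S \<in> sets lborel")
  case True
  have "emeasure lborel (ball x\<^sub>0 b \<inter> S) \<le> emeasure lborel (ball x\<^sub>0 b)"
    by (rule emeasure_mono) auto
  then show ?thesis using emeasure_lborel_ball_finite[of x\<^sub>0 b] by (rule order.strict_trans1)
qed (simp add: emeasure_notin_sets)

lemma emeasure_ball_Int:
  fixes x\<^sub>0 :: "'a::euclidean_space"
  shows "emeasure lborel (ball x\<^sub>0 b \<inter> S) = ennreal (measure lborel (ball x\<^sub>0 b \<inter> S))"
  using finite_ball_Int[of x\<^sub>0 b S] by (simp add: emeasure_eq_ennreal_measure less_top)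

lemma measure_lborel_ball:
  fixes x\<^sub>0 :: "'a::euclidean_space"
  shows "0 \<le> b \<Longrightarrow> measure lborel (ball x\<^sub>0 b) = unit_ball_vol (real DIM('a)) * b ^ DIM('a)"
  by (simp add: measure_def emeasure_ball)

lemma sublevel_nonneg: "0 \<le> sublevel f x\<^sub>0 l b"
  by (simp add: sublevel_def)

lemma sublevel_mono:
  fixes f :: "'a::euclidean_space \<Rightarrow> real"
  assumes [measurable]: "f \<in> borel_measurable borel" and "l \<le> l'" "b \<le> b'"
  shows "sublevel f x\<^sub>0 l b \<le> sublevel f x\<^sub>0 l' b'"
  unfolding sublevel_def using finite_ball_Int[of x\<^sub>0 b'] assms
  by (intro measure_mono_fmeasurable) (auto simp: fmeasurable_def)

lemma sublevel_le_ball: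
  fixes f :: "'a::euclidean_space \<Rightarrow> real"
  assumes [measurable]: "f \<in> borel_measurable borel" and "0 \<le> b"
  shows "sublevel f x\<^sub>0 l b \<le> unit_ball_vol (real DIM('a)) * b ^ DIM('a)"
  unfolding measure_lborel_ball[OF assms(2), of x\<^sub>0, symmetric] sublevel_def
  using finite_ball_Int[of x\<^sub>0 b UNIV]
  by (intro measure_mono_fmeasurable) (auto simp: fmeasurable_def)

text \<open>Optimizing over \<open>c\<close> after integration would give Hoelder's inequality.\<close>

lemma young_linear:
  assumes "1 < p" "0 < c" "0 \<le> (d::real)"
  shows "d \<le> c powr (p - 1) * d powr p + 1 / c"
proof (cases "d \<le> 1 / c")
  case False
  then have d: "1 / c < d" "0 < d" using assms by (auto simp: not_le intro: less_trans[rotated])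
  have "1 \<le> (c * d) powr (p - 1)"
    using d assms by (intro ge_one_powr_ge_zero) (auto simp: field_simps)
  then have "1 * d \<le> (c * d) powr (p - 1) * d" using d by (intro mult_right_mono) auto
  also have "\<dots> = c powr (p - 1) * (d powr (p - 1) * d powr 1)"
    using d assms by (simp add: powr_mult)
  also have "d powr (p - 1) * d powr 1 = d powr p" unfolding powr_add[symmetric] by simp
  finally show ?thesis using assms by (simp add: add_increasing2)
qed (simp add: add_increasing)

lemma nn_integral_young_linear:
  fixes G :: "'a::euclidean_space \<Rightarrow> 'b::euclidean_space"
  assumes "1 < p" "0 < c" and [measurable]: "G \<in> borel_measurable borel" "S \<in> sets borel"
  shows "(\<integral>\<^sup>+x. indicator S x * ennreal (norm (G x)) \<partial>lborel)
    \<le> ennreal (c powr (p - 1)) * (\<integral>\<^sup>+x. indicator S x * ennreal (norm (G x) powr p) \<partial>lborel)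
      + ennreal (1 / c) * emeasure lborel S"
proof -
  have "(\<integral>\<^sup>+x. indicator S x * ennreal (norm (G x)) \<partial>lborel)
    \<le> (\<integral>\<^sup>+x. ennreal (c powr (p - 1)) * (indicator S x * ennreal (norm (G x) powr p)) + ennreal (1 / c) * indicator S x \<partial>lborel)"
  proof (rule nn_integral_mono)
    fix x
    have "ennreal (norm (G x)) \<le> ennreal (c powr (p - 1)) * ennreal (norm (G x) powr p) + ennreal (1 / c)"
      using young_linear[OF assms(1,2), of "norm (G x)"] assms(2)
      by (simp add: ennreal_mult[symmetric] ennreal_plus[symmetric] ennreal_leI del: ennreal_plus)
    then show "indicator S x * ennreal (norm (G x))
      \<le> ennreal (c powr (p - 1)) * (indicator S x * ennreal (norm (G x) powr p)) + ennreal (1 / c) * indicator S x"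
      by (auto simp: indicator_def)
  qed
  also have "\<dots> = ennreal (c powr (p - 1)) * (\<integral>\<^sup>+x. indicator S x * ennreal (norm (G x) powr p) \<partial>lborel)
      + ennreal (1 / c) * emeasure lborel S"
    by (simp add: nn_integral_add nn_integral_cmult)
  finally show ?thesis .
qed

text \<open>The weight in Young's inequality is \<theta> (b - a) / l, which gives both terms the
  same factor l / (b - a). The parameter \<theta> stays free, and T restricts the second term to a
  part of the sublevel set: \<open>degiorgi_step\<close> takes \<theta> = 1 and everything,
  \<open>shrink_level\<close> a thin layer and a \<theta> that is made small afterwards.\<close>

lemma caccioppoli_L1:
  fixes f :: "'a::euclidean_space \<Rightarrow> real"
  assumes c: "caccioppoli p C f G x\<^sub>0 r \<tau>" and p: "1 < p" and "0 < \<tau>" "\<tau> \<le> l" "0 < a" "a < b" "b \<le> 8 * r" "0 < \<theta>" "0 \<le> C"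
    and [measurable]: "f \<in> borel_measurable borel" "G \<in> borel_measurable borel" "T \<in> sets borel"
  shows "(\<integral>\<^sup>+x. indicator (ball x\<^sub>0 a \<inter> {x. f x < l} \<inter> T) x * ennreal (norm (G x)) \<partial>lborel)
    \<le> ennreal (l / (b - a) * (\<theta> powr (p - 1) * C * sublevel f x\<^sub>0 l b
         + measure lborel (ball x\<^sub>0 a \<inter> {x. f x < l} \<inter> T) / \<theta>))"
proof -
  define q where "q = l / (b - a)"
  have q: "q > 0" using assms by (auto simp: q_def intro: less_le_trans)
  define S where "S = ball x\<^sub>0 a \<inter> {x. f x < l} \<inter> T"
  have [measurable]: "S \<in> sets borel" unfolding S_def by measurable
  have mS: "emeasure lborel S = ennreal (measure lborel S)"
    using emeasure_ball_Int[of x\<^sub>0 a "{x. f x < l} \<inter> T"] by (simp add: S_def Int_assoc)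
  have "(\<integral>\<^sup>+x. indicator S x * ennreal (norm (G x)) \<partial>lborel)
    \<le> ennreal ((\<theta> / q) powr (p - 1)) * (\<integral>\<^sup>+x. indicator S x * ennreal (norm (G x) powr p) \<partial>lborel)
      + ennreal (1 / (\<theta> / q)) * emeasure lborel S"
    by (rule nn_integral_young_linear) (use assms q in auto)
  also have "\<dots> \<le> ennreal ((\<theta> / q) powr (p - 1)) * ennreal (C * q powr p * sublevel f x\<^sub>0 l b)
      + ennreal (1 / (\<theta> / q)) * emeasure lborel S"
  proof (intro add_right_mono mult_left_mono)
    have "(\<integral>\<^sup>+x. indicator S x * ennreal (norm (G x) powr p) \<partial>lborel)
      \<le> (\<integral>\<^sup>+x. indicator (ball x\<^sub>0 a \<inter> {x. f x < l}) x * ennreal (norm (G x) powr p) \<partial>lborel)"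
      by (rule nn_integral_mono) (auto simp: S_def indicator_def)
    also have "\<dots> \<le> ennreal (C * q powr p * sublevel f x\<^sub>0 l b)"
      using c assms unfolding caccioppoli_def q_def by blast
    finally show "(\<integral>\<^sup>+x. indicator S x * ennreal (norm (G x) powr p) \<partial>lborel)
      \<le> ennreal (C * q powr p * sublevel f x\<^sub>0 l b)" .
  qed simp
  also have "\<dots> = ennreal ((\<theta> / q) powr (p - 1) * (C * q powr p * sublevel f x\<^sub>0 l b) + q / \<theta> * measure lborel S)"
    using assms q by (simp add: mS ennreal_mult[symmetric] ennreal_plus[symmetric] sublevel_nonneg del: ennreal_plus)
  also have "(\<theta> / q) powr (p - 1) * (C * q powr p * sublevel f x\<^sub>0 l b) + q / \<theta> * measure lborel S
    = q * (\<theta> powr (p - 1) * C * sublevel f x\<^sub>0 l b + measure lborel S / \<theta>)"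
  proof -
    have "q powr p = q powr (p - 1) * q powr 1" unfolding powr_add[symmetric] by simp
    then have "(\<theta> / q) powr (p - 1) * q powr p = \<theta> powr (p - 1) * q"
      using q assms by (simp add: powr_divide)
    then show ?thesis by (simp add: algebra_simps)
  qed
  finally show ?thesis unfolding S_def q_def .
qed

text \<open>Any \<open>x\<close> leaves the support under at least half of the translations by \<open>h\<close> in the ball, and
  then \<open>W x = \<bar>W (x + h) - W x\<bar>\<close>.\<close>

lemma faber_krahn:
  fixes W :: "'a::euclidean_space \<Rightarrow> real"
  assumes w: "weak_pair W D" and W: "\<And>x. 0 \<le> W x"
    and M: "0 < M" "emeasure lborel {x. 0 < W x} \<le> ennreal M"
    and \<rho>: "0 < \<rho>" "unit_ball_vol (real DIM('a)) * \<rho> ^ DIM('a) = 2 * M"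
  shows "(\<integral>\<^sup>+x. ennreal (W x) \<partial>lborel) \<le> ennreal (2 * \<rho>) * (\<integral>\<^sup>+x. ennreal (norm (D x)) \<partial>lborel)"
proof -
  note [measurable] = weak_pairD(3,4)[OF w]
  have [measurable]: "{y. 0 < W y} \<in> sets borel" "{y. W y \<le> 0} \<in> sets borel" "ball (0::'a) \<rho> \<in> sets borel" by measurable
  let ?E = "\<integral>\<^sup>+x. ennreal (norm (D x)) \<partial>lborel"
  have vol: "emeasure lborel (ball (0::'a) \<rho>) = ennreal (2 * M)"
    using \<rho> by (simp add: emeasure_ball)
  have far: "ennreal M \<le> (\<integral>\<^sup>+h. indicator (ball 0 \<rho>) h * indicator {y. W y \<le> 0} (x + h) \<partial>lborel)" for x
  proof -
    have "ennreal M + ennreal M = emeasure lborel (ball (0::'a) \<rho>)"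
      unfolding vol using M by (simp add: ennreal_plus[symmetric] del: ennreal_plus)
    also have "\<dots> = (\<integral>\<^sup>+h. indicator (ball (0::'a) \<rho>) h \<partial>lborel)" by simp
    also have "\<dots> \<le> (\<integral>\<^sup>+h. indicator {y. 0 < W y} (h + x) + indicator (ball 0 \<rho>) h * indicator {y. W y \<le> 0} (x + h) \<partial>lborel)"
      by (rule nn_integral_mono) (auto simp: indicator_def add.commute)
    also have "\<dots> = (\<integral>\<^sup>+h. indicator {y. 0 < W y} (h + x) \<partial>lborel)
        + (\<integral>\<^sup>+h. indicator (ball 0 \<rho>) h * indicator {y. W y \<le> 0} (x + h) \<partial>lborel)"
      by (rule nn_integral_add) measurable
    also have "(\<integral>\<^sup>+h. indicator {y. 0 < W y} (h + x) \<partial>lborel) = (\<integral>\<^sup>+h. indicator {y. 0 < W y} h \<partial>lborel)"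
      by (rule nn_integral_shift) measurable
    also have "\<dots> \<le> ennreal M" using M(2) by simp
    finally show ?thesis by (simp add: ennreal_add_left_cancel_le)
  qed
  have "ennreal M * (\<integral>\<^sup>+x. ennreal (W x) \<partial>lborel) = (\<integral>\<^sup>+x. ennreal (W x) * ennreal M \<partial>lborel)"
    by (subst nn_integral_multc) (simp_all add: mult.commute)
  also have "\<dots> \<le> (\<integral>\<^sup>+x. ennreal (W x) * (\<integral>\<^sup>+h. indicator (ball 0 \<rho>) h * indicator {y. W y \<le> 0} (x + h) \<partial>lborel) \<partial>lborel)"
    by (intro nn_integral_mono mult_left_mono far) auto
  also have "\<dots> = (\<integral>\<^sup>+x. (\<integral>\<^sup>+h. ennreal (W x) * (indicator (ball 0 \<rho>) h * indicator {y. W y \<le> 0} (x + h)) \<partial>lborel) \<partial>lborel)"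
    by (intro nn_integral_cong nn_integral_cmult[symmetric]) measurable
  also have "\<dots> \<le> (\<integral>\<^sup>+x. (\<integral>\<^sup>+h. indicator (ball 0 \<rho>) h * ennreal \<bar>W (x + h) - W x\<bar> \<partial>lborel) \<partial>lborel)"
    by (intro nn_integral_mono) (auto simp: indicator_def W dest: antisym[OF _ W])
  also have "\<dots> = (\<integral>\<^sup>+h. (\<integral>\<^sup>+x. indicator (ball 0 \<rho>) h * ennreal \<bar>W (x + h) - W x\<bar> \<partial>lborel) \<partial>lborel)"
    by (rule lborel_pair.Fubini') measurable
  also have "\<dots> \<le> (\<integral>\<^sup>+h. (ennreal \<rho> * ?E) * indicator (ball (0::'a) \<rho>) h \<partial>lborel)"
  proof (rule nn_integral_mono)
    fix h :: 'a
    have "(\<integral>\<^sup>+x. ennreal \<bar>W (x + h) - W x\<bar> \<partial>lborel) \<le> ennreal (norm h) * ?E"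
      using weak_pair_translate_convex[OF w, of UNIV h] by simp
    moreover have "ennreal (norm h) * ?E \<le> ennreal \<rho> * ?E" if "h \<in> ball 0 \<rho>"
      using that by (intro mult_right_mono ennreal_leI) auto
    ultimately show "(\<integral>\<^sup>+x. indicator (ball 0 \<rho>) h * ennreal \<bar>W (x + h) - W x\<bar> \<partial>lborel)
      \<le> (ennreal \<rho> * ?E) * indicator (ball (0::'a) \<rho>) h"
      by (auto simp: indicator_def)
  qed
  also have "\<dots> = (ennreal \<rho> * ?E) * ennreal (2 * M)"
    by (simp add: nn_integral_cmult vol)
  also have "\<dots> = ennreal M * (ennreal (2 * \<rho>) * ?E)"
    using M \<rho> by (simp add: ennreal_mult mult_ac)
  finally show ?thesis
    using M(1) by (subst (asm) ennreal_mult_le_mult_iff) auto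
qed

text \<open>The ball has twice the measure of the support, as \<open>faber_krahn\<close> asks. Its
  radius, of order M^(1/N), is the origin of the superlinear power in the iteration.\<close>

lemma faber_krahn_radius:
  fixes M :: real
  assumes "0 < M" "0 < (n::nat)"
  defines "\<rho> \<equiv> (2 / unit_ball_vol (real n)) powr (1 / real n) * M powr (1 / real n)"
  shows "0 < \<rho>" "unit_ball_vol (real n) * \<rho> ^ n = 2 * M"
proof -
  have v: "unit_ball_vol (real n) > 0" by simp
  then have nz: "unit_ball_vol (real n) \<noteq> 0" by linarith
  have \<rho>: "\<rho> = (2 / unit_ball_vol (real n) * M) powr (1 / real n)"
    unfolding \<rho>_def using assms v by (subst powr_mult) auto
  show 0: "0 < \<rho>" unfolding \<rho> using assms nz by simp
  have "\<rho> ^ n = \<rho> powr real n" using 0 by (simp add: powr_realpow)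
  also have "\<dots> = 2 / unit_ball_vol (real n) * M"
    unfolding \<rho> powr_powr using assms v by simp
  finally show "unit_ball_vol (real n) * \<rho> ^ n = 2 * M" using nz by simp
qed

text \<open>\<open>faber_krahn\<close> is applied to W = \<phi> (l - f)_+, whose support lies in a
  sublevel set of measure m. This gives a radius of order m^(1/N) times the L1 norm of the gradient,
  which is of order (l / k) m. The ball grows by k twice: once for the cutoff and once for the
  Caccioppoli inequality on the larger ball.\<close>

lemma degiorgi_step:
  fixes f :: "'a::euclidean_space \<Rightarrow> real"
  assumes w: "weak_pair f G" and c: "caccioppoli p C f G x\<^sub>0 r \<tau>" and p: "1 < p" and C: "0 \<le> C" and \<tau>: "0 < \<tau>" "\<tau> \<le> l'" "l' < l"
    and k: "0 < a" "0 < k" "a + 2 * k \<le> 8 * r" and f: "\<And>x. x \<in> ball x\<^sub>0 (8 * r) \<Longrightarrow> 0 \<le> f x"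
    and \<phi>: "cutoff x\<^sub>0 a (a + k) (\<Lambda> / k) \<phi>" and \<Lambda>: "0 \<le> \<Lambda>"
  shows "(l - l') * sublevel f x\<^sub>0 l' a \<le> (2 * (2 / unit_ball_vol (real DIM('a))) powr (1 / real DIM('a)) * (\<Lambda> + C + 1))
     * (l / k) * (sublevel f x\<^sub>0 l (a + 2 * k) * sublevel f x\<^sub>0 l (a + 2 * k) powr (1 / real DIM('a)))"
proof -
  note [measurable] = weak_pairD(3,4)[OF w]
  have [measurable]: "{x. f x < t} \<in> sets borel" "ball x\<^sub>0 t \<in> sets borel" for t by measurable
  define m where "m = sublevel f x\<^sub>0 l (a + 2 * k)"
  have l: "0 < l" using \<tau> by simp
  have \<phi>1: "0 \<le> \<phi> x" "\<phi> x \<le> 1" "x \<in> cball x\<^sub>0 a \<Longrightarrow> \<phi> x = 1" "x \<notin> ball x\<^sub>0 (a + k) \<Longrightarrow> \<phi> x = 0"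
    "norm (grad \<phi> x) \<le> \<Lambda> / k" and s: "smooth \<phi>" for x
    using \<phi> by (auto simp: cutoff_def)
  note [measurable] = smooth_measurable[OF s] smooth_grad_measurable[OF s]
  have \<phi>g: "grad \<phi> x = 0" if "x \<notin> cball x\<^sub>0 (a + k)" for x
    by (rule grad_zero_outside[of "cball x\<^sub>0 (a + k)"]) (use that \<phi>1(4) in auto)
  have t: "test_function UNIV \<phi>" by (rule cutoff_test_function[OF \<phi>]) simp
  define W where "W x = \<phi> x * max 0 (l - f x)" for x
  define D where "D x = max 0 (l - f x) *\<^sub>R grad \<phi> x - (\<phi> x * indicator {x. f x < l} x) *\<^sub>R G x" for x
  have wp: "weak_pair W D" unfolding W_def D_def by (rule weak_pair_truncate[OF w t])
  note [measurable] = weak_pairD(3,4)[OF wp]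
  let ?A = "ball x\<^sub>0 (a + 2 * k) \<inter> {x. f x < l}"
  have mA: "emeasure lborel ?A = ennreal m" unfolding m_def sublevel_def by (rule emeasure_ball_Int)
  have sub: "sublevel f x\<^sub>0 l' a \<le> m"
    unfolding m_def by (rule sublevel_mono) (use \<tau> k in auto)
  show ?thesis
  proof (cases "m = 0")
    case True
    then have "sublevel f x\<^sub>0 l' a = 0" using sub sublevel_nonneg[of f x\<^sub>0 l' a] by simp
    then show ?thesis using True by (simp add: m_def)
  next
    case False
    then have m: "0 < m" using sublevel_nonneg[of f x\<^sub>0 l "a + 2 * k"] by (simp add: m_def)
    define \<rho> where "\<rho> = (2 / unit_ball_vol (real DIM('a))) powr (1 / real DIM('a)) * m powr (1 / real DIM('a))"
    note \<rho> = faber_krahn_radius[OF m, of "DIM('a)", folded \<rho>_def, OF DIM_positive]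
    have W0: "0 \<le> W x" for x unfolding W_def using \<phi>1 by simp
    have supp: "{x. 0 < W x} \<subseteq> ?A"
    proof
      fix x assume "x \<in> {x. 0 < W x}"
      then have "\<phi> x \<noteq> 0" "f x < l" using \<phi>1(1)[of x] by (auto simp: W_def max_def zero_less_mult_iff split: if_splits)
      then show "x \<in> ?A" using \<phi>1(4)[of x] k by force
    qed
    have "emeasure lborel {x. 0 < W x} \<le> emeasure lborel ?A" by (rule emeasure_mono[OF supp]) measurable
    with faber_krahn[OF wp W0 m _ \<rho>]
    have FK: "(\<integral>\<^sup>+x. ennreal (W x) \<partial>lborel) \<le> ennreal (2 * \<rho>) * (\<integral>\<^sup>+x. ennreal (norm (D x)) \<partial>lborel)"
      by (simp add: mA)
    have cu: "(\<integral>\<^sup>+x. indicator (ball x\<^sub>0 (a + k) \<inter> {x. f x < l} \<inter> UNIV) x * ennreal (norm (G x)) \<partial>lborel)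
      \<le> ennreal (l / k * (C * m + measure lborel (ball x\<^sub>0 (a + k) \<inter> {x. f x < l} \<inter> UNIV)))"
      using caccioppoli_L1[OF c p, where l=l and a="a + k" and b="a + 2 * k" and \<theta>=1 and T=UNIV] \<tau> k C by (simp add: m_def)
    also have "\<dots> \<le> ennreal (l / k * (C * m + m))"
      using sublevel_mono[of f l l "a + k" "a + 2 * k" x\<^sub>0] l k
      by (intro ennreal_leI mult_left_mono add_left_mono) (auto simp: m_def sublevel_def)
    finally have cu: "(\<integral>\<^sup>+x. indicator (ball x\<^sub>0 (a + k) \<inter> {x. f x < l}) x * ennreal (norm (G x)) \<partial>lborel) \<le> ennreal (l / k * (C * m + m))"
      by simp
    \<comment> \<open>Nonnegativity of f enters here: where the cutoff varies, (l - f)_+ is at most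
      l.\<close>
    have Dle: "ennreal (norm (D x)) \<le> ennreal (l * (\<Lambda> / k)) * indicator ?A x + indicator (ball x\<^sub>0 (a + k) \<inter> {x. f x < l}) x * ennreal (norm (G x))" for x
    proof (cases "x \<in> ?A")
      case True
      then have fx: "f x < l" "0 \<le> f x" using f[of x] k by auto
      have "norm (D x) \<le> max 0 (l - f x) * norm (grad \<phi> x) + \<phi> x * norm (G x)"
        unfolding D_def using norm_triangle_ineq4[of "max 0 (l - f x) *\<^sub>R grad \<phi> x" "(\<phi> x * indicator {x. f x < l} x) *\<^sub>R G x"] fx \<phi>1(1)[of x]
        by simp
      also have "\<dots> \<le> l * (\<Lambda> / k) + indicator (ball x\<^sub>0 (a + k) \<inter> {x. f x < l}) x * norm (G x)"
      proof (rule add_mono)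
        show "max 0 (l - f x) * norm (grad \<phi> x) \<le> l * (\<Lambda> / k)"
          using fx l \<phi>1(5)[of x] by (intro mult_mono) auto
        show "\<phi> x * norm (G x) \<le> indicator (ball x\<^sub>0 (a + k) \<inter> {x. f x < l}) x * norm (G x)"
          using \<phi>1(2,4)[of x] fx by (intro mult_right_mono) (auto simp: indicator_def)
      qed
      finally have "norm (D x) \<le> l * (\<Lambda> / k) + indicator (ball x\<^sub>0 (a + k) \<inter> {x. f x < l}) x * norm (G x)" .
      then have "ennreal (norm (D x)) \<le> ennreal (l * (\<Lambda> / k)) + ennreal (indicator (ball x\<^sub>0 (a + k) \<inter> {x. f x < l}) x * norm (G x))"
        using l \<Lambda> k by (simp add: ennreal_plus[symmetric] ennreal_leI del: ennreal_plus)
      then show ?thesis using True by (auto simp: indicator_def split: if_splits)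
    next
      case False
      have "D x = 0"
      proof (cases "f x < l")
        case True
        then have "x \<notin> ball x\<^sub>0 (a + 2 * k)" using False by simp
        then have "x \<notin> cball x\<^sub>0 (a + k)" "x \<notin> ball x\<^sub>0 (a + k)" using k by auto
        then show ?thesis using \<phi>g \<phi>1(4) by (simp add: D_def)
      qed (simp add: D_def)
      then show ?thesis by simp
    qed
    have "(\<integral>\<^sup>+x. ennreal (norm (D x)) \<partial>lborel)
      \<le> (\<integral>\<^sup>+x. ennreal (l * (\<Lambda> / k)) * indicator ?A x + indicator (ball x\<^sub>0 (a + k) \<inter> {x. f x < l}) x * ennreal (norm (G x)) \<partial>lborel)"
      by (rule nn_integral_mono) (rule Dle)
    also have "\<dots> = ennreal (l * (\<Lambda> / k)) * ennreal m + (\<integral>\<^sup>+x. indicator (ball x\<^sub>0 (a + k) \<inter> {x. f x < l}) x * ennreal (norm (G x)) \<partial>lborel)"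
      by (subst nn_integral_add) (auto simp: nn_integral_cmult mA)
    also have "\<dots> \<le> ennreal (l * (\<Lambda> / k)) * ennreal m + ennreal (l / k * (C * m + m))"
      by (intro add_left_mono cu)
    also have "\<dots> = ennreal (l / k * (\<Lambda> + C + 1) * m)"
      using l k m \<Lambda> C by (simp add: ennreal_mult[symmetric] ennreal_plus[symmetric] del: ennreal_plus) (simp add: algebra_simps add_divide_distrib)
    finally have DE: "(\<integral>\<^sup>+x. ennreal (norm (D x)) \<partial>lborel) \<le> ennreal (l / k * (\<Lambda> + C + 1) * m)" .
    \<comment> \<open>Chebyshev's inequality: on B_a the cutoff is 1, and W >= l - l' where f <
      l'.\<close>
    have "ennreal ((l - l') * sublevel f x\<^sub>0 l' a) = ennreal (l - l') * emeasure lborel (ball x\<^sub>0 a \<inter> {x. f x < l'})"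
      unfolding sublevel_def emeasure_ball_Int using \<tau> by (simp add: ennreal_mult)
    also have "\<dots> = (\<integral>\<^sup>+x. ennreal (l - l') * indicator (ball x\<^sub>0 a \<inter> {x. f x < l'}) x \<partial>lborel)"
      by (subst nn_integral_cmult_indicator) auto
    also have "\<dots> \<le> (\<integral>\<^sup>+x. ennreal (W x) \<partial>lborel)"
    proof (rule nn_integral_mono)
      fix x
      show "ennreal (l - l') * indicator (ball x\<^sub>0 a \<inter> {x. f x < l'}) x \<le> ennreal (W x)"
      proof (cases "x \<in> ball x\<^sub>0 a \<inter> {x. f x < l'}")
        case True
        then have "\<phi> x = 1" using \<phi>1(3) by auto
        then show ?thesis using True by (simp add: W_def ennreal_leI le_max_iff_disj)
      qed simp
    qed
    also have "\<dots> \<le> ennreal (2 * \<rho>) * ennreal (l / k * (\<Lambda> + C + 1) * m)"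
      using FK mult_left_mono[OF DE, of "ennreal (2 * \<rho>)"] by (meson order_trans zero_le)
    also have "\<dots> = ennreal (2 * \<rho> * (l / k * (\<Lambda> + C + 1) * m))"
      using \<rho> l k m \<Lambda> C by (simp add: ennreal_mult[symmetric])
    finally have "(l - l') * sublevel f x\<^sub>0 l' a \<le> 2 * \<rho> * (l / k * (\<Lambda> + C + 1) * m)"
      using \<rho> l k m \<Lambda> C by (subst (asm) ennreal_le_iff) auto
    then show ?thesis by (simp add: \<rho>_def m_def mult_ac)
  qed
qed

text \<open>De Giorgi's isoperimetric inequality, combined with the Caccioppoli inequality. On B_6r
  the truncation W is 0 where f >= l and l / 2 where f < l / 2, with a gradient carried by the layer
  in between. Every pair of points from the two extreme sets costs at least l / 2, while the sum
  over all pairs is bounded through the translation estimate by the L1 norm of the gradient on the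
  layer.\<close>

lemma shrink_level:
  fixes f :: "'a::euclidean_space \<Rightarrow> real"
  assumes w: "weak_pair f G" and c: "caccioppoli p C f G x\<^sub>0 r \<tau>" and p: "1 < p" and C: "0 \<le> C" and l: "0 < \<tau>" "\<tau> \<le> l"
    and r: "0 < r" and \<theta>: "0 < \<theta>"
  defines "v \<equiv> unit_ball_vol (real DIM('a))" and "N \<equiv> DIM('a)"
  shows "measure lborel ({x. l \<le> f x} \<inter> ball x\<^sub>0 r) * sublevel f x\<^sub>0 (l / 2) (6 * r)
    \<le> 12 * (v * (12 * r) ^ N) *
      (\<theta> powr (p - 1) * C * (v * (8 * r) ^ N) + measure lborel (ball x\<^sub>0 (6 * r) \<inter> {x. f x < l} \<inter> {x. l / 2 \<le> f x}) / \<theta>)"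
proof -
  note [measurable] = weak_pairD(3,4)[OF w]
  have [measurable]: "{x. f x < t} \<in> sets borel" "{x. t \<le> f x} \<in> sets borel" "ball (y::'a) t \<in> sets borel" for t y by measurable
  have l0: "0 < l" using l by simp
  \<comment> \<open>The cutoff is 1 on B_6r, where all the estimates take place; it only makes W
    globally integrable.\<close>
  obtain \<Lambda> \<phi> where \<phi>: "cutoff x\<^sub>0 (6 * r) (7 * r) \<Lambda> \<phi>"
  proof -
    have "0 < 6 * r" "6 * r < 7 * r" using r by auto
    then show ?thesis using cutoff_exists[where 'a='a] that by blast
  qed
  have \<phi>1: "x \<in> cball x\<^sub>0 (6 * r) \<Longrightarrow> \<phi> x = 1" and s: "smooth \<phi>" for x
    using \<phi> by (auto simp: cutoff_def)
  have \<phi>g: "grad \<phi> x = 0" if "x \<in> ball x\<^sub>0 (6 * r)" for x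
    by (rule grad_const_open[of "ball x\<^sub>0 (6 * r)" _ 1]) (use that \<phi>1 in auto)
  have t: "test_function UNIV \<phi>" by (rule cutoff_test_function[OF \<phi>]) simp
  \<comment> \<open>Where the cutoff is 1 this is l - f clamped to [0, l / 2] after subtracting
    nothing above l: the difference of the truncations at l and at l / 2, so that the gradients
    cancel below l / 2.\<close>
  define W where "W x = \<phi> x * max 0 (l - f x) - \<phi> x * max 0 (l / 2 - f x)" for x
  define D where "D x = (max 0 (l - f x) *\<^sub>R grad \<phi> x - (\<phi> x * indicator {x. f x < l} x) *\<^sub>R G x)
     - (max 0 (l / 2 - f x) *\<^sub>R grad \<phi> x - (\<phi> x * indicator {x. f x < l / 2} x) *\<^sub>R G x)" for x
  have wp: "weak_pair W D" unfolding W_def D_def by (intro weak_pair_diff weak_pair_truncate[OF w t])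
  note [measurable] = weak_pairD(3,4)[OF wp]
  define B where "B = ball x\<^sub>0 (6 * r)"
  have [measurable]: "B \<in> sets borel" by (simp add: B_def)
  define S where "S = B \<inter> {x. f x < l} \<inter> {x. l / 2 \<le> f x}"
  have [measurable]: "S \<in> sets borel" unfolding S_def by measurable
  define P where "P = {x. l \<le> f x} \<inter> ball x\<^sub>0 r"
  define Q where "Q = B \<inter> {x. f x < l / 2}"
  have [measurable]: "P \<in> sets borel" "Q \<in> sets borel" unfolding P_def Q_def by measurable
  define E where "E = (\<integral>\<^sup>+x. indicator B x * ennreal (norm (D x)) \<partial>lborel)"
  have "E = (\<integral>\<^sup>+x. indicator S x * ennreal (norm (G x)) \<partial>lborel)"
    unfolding E_def
  proof (rule nn_integral_cong)
    fix x
    show "indicator B x * ennreal (norm (D x)) = indicator S x * ennreal (norm (G x))"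
    proof (cases "x \<in> B")
      case True
      then have "\<phi> x = 1" "grad \<phi> x = 0" using \<phi>1[of x] \<phi>g[of x] by (auto simp: B_def)
      then show ?thesis using True l0 by (auto simp: D_def S_def indicator_def)
    qed (simp add: S_def)
  qed
  also have "\<dots> \<le> ennreal (l / (8 * r - 6 * r) * (\<theta> powr (p - 1) * C * sublevel f x\<^sub>0 l (8 * r) + measure lborel S / \<theta>))"
    using caccioppoli_L1[OF c p l(1,2), of "6 * r" "8 * r" \<theta> "{x. l / 2 \<le> f x}"] r \<theta> C by (simp add: S_def B_def)
  also have "\<dots> \<le> ennreal (l / (2 * r) * (\<theta> powr (p - 1) * C * (v * (8 * r) ^ N) + measure lborel S / \<theta>))"
    using sublevel_le_ball[of f "8 * r" x\<^sub>0 l] r l0 C unfolding v_def N_def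
    by (intro ennreal_leI mult_mono add_mono) (auto intro!: add_nonneg_nonneg simp: sublevel_nonneg \<theta> less_imp_le)
  finally have E: "E \<le> ennreal (l / (2 * r) * (\<theta> powr (p - 1) * C * (v * (8 * r) ^ N) + measure lborel S / \<theta>))" .

  have mP: "emeasure lborel P = ennreal (measure lborel P)"
    using emeasure_ball_Int[of x\<^sub>0 r "{x. l \<le> f x}"] by (simp add: P_def Int_commute)
  have mQ: "emeasure lborel Q = ennreal (sublevel f x\<^sub>0 (l / 2) (6 * r))"
    unfolding Q_def B_def sublevel_def by (rule emeasure_ball_Int)
  \<comment> \<open>The pairs of points are written as x in P and x + h in Q, which brings in the
    translations of W.\<close>
  have "ennreal (l / 2) * emeasure lborel Q * emeasure lborel P
    = (\<integral>\<^sup>+x. (ennreal (l / 2) * emeasure lborel Q) * indicator P x \<partial>lborel)"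
    by (subst nn_integral_cmult_indicator) auto
  also have "\<dots> = (\<integral>\<^sup>+x. (\<integral>\<^sup>+h. ennreal (l / 2) * indicator P x * indicator Q (h + x) \<partial>lborel) \<partial>lborel)"
  proof (rule nn_integral_cong)
    fix x
    have "(\<integral>\<^sup>+h. indicator Q (h + x) \<partial>lborel) = (\<integral>\<^sup>+h. indicator Q h \<partial>lborel)"
      by (rule nn_integral_shift) measurable
    then have "(\<integral>\<^sup>+h. indicator Q (h + x) \<partial>lborel) = emeasure lborel Q" by simp
    then show "(ennreal (l / 2) * emeasure lborel Q) * indicator P x
      = (\<integral>\<^sup>+h. ennreal (l / 2) * indicator P x * indicator Q (h + x) \<partial>lborel)"
      by (subst nn_integral_cmult) (simp_all add: mult_ac)
  qed
  also have "\<dots> \<le> (\<integral>\<^sup>+x. (\<integral>\<^sup>+h. indicator (ball 0 (12 * r)) h * (indicator B x * indicator B (x + h) * ennreal \<bar>W (x + h) - W x\<bar>) \<partial>lborel) \<partial>lborel)"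
  proof (intro nn_integral_mono)
    fix x h :: 'a
    show "ennreal (l / 2) * indicator P x * indicator Q (h + x)
      \<le> indicator (ball 0 (12 * r)) h * (indicator B x * indicator B (x + h) * ennreal \<bar>W (x + h) - W x\<bar>)"
    proof (cases "x \<in> P \<and> h + x \<in> Q")
      case True
      then have x: "x \<in> B" "l \<le> f x" and h: "x + h \<in> B" "f (x + h) < l / 2" using r by (auto simp: P_def B_def Q_def add.commute)
      \<comment> \<open>Two points of B_6r are less than 12r apart, so h stays in a fixed
        ball.\<close>
      have "norm h \<le> norm ((x + h) - x\<^sub>0) + norm (x - x\<^sub>0)"
        using norm_triangle_ineq4[of "(x + h) - x\<^sub>0" "x - x\<^sub>0"] by simp
      then have "h \<in> ball 0 (12 * r)" using x(1) h(1) by (simp add: B_def dist_norm norm_minus_commute)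
      moreover have "W x = 0" using x(2) l0 by (simp add: W_def)
      moreover have "W (x + h) = l / 2" using h \<phi>1[of "x + h"] l0 by (simp add: W_def B_def)
      ultimately show ?thesis using True x h l0 by simp
    qed auto
  qed
  also have "\<dots> = (\<integral>\<^sup>+h. (\<integral>\<^sup>+x. indicator (ball 0 (12 * r)) h * (indicator B x * indicator B (x + h) * ennreal \<bar>W (x + h) - W x\<bar>) \<partial>lborel) \<partial>lborel)"
    by (rule lborel_pair.Fubini') measurable
  also have "\<dots> \<le> (\<integral>\<^sup>+h. (ennreal (12 * r) * E) * indicator (ball (0::'a) (12 * r)) h \<partial>lborel)"
  proof (rule nn_integral_mono)
    fix h :: 'a
    have "(\<integral>\<^sup>+x. indicator B x * indicator B (x + h) * ennreal \<bar>W (x + h) - W x\<bar> \<partial>lborel) \<le> ennreal (norm h) * E"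
      unfolding E_def by (rule weak_pair_translate_convex[OF wp]) (auto simp: B_def)
    moreover have "ennreal (norm h) * E \<le> ennreal (12 * r) * E" if "h \<in> ball 0 (12 * r)"
      using that by (intro mult_right_mono ennreal_leI) auto
    ultimately show "(\<integral>\<^sup>+x. indicator (ball 0 (12 * r)) h * (indicator B x * indicator B (x + h) * ennreal \<bar>W (x + h) - W x\<bar>) \<partial>lborel)
      \<le> (ennreal (12 * r) * E) * indicator (ball (0::'a) (12 * r)) h"
      by (auto simp: indicator_def)
  qed
  also have "\<dots> = (ennreal (12 * r) * E) * ennreal (v * (12 * r) ^ N)"
    using r by (simp add: nn_integral_cmult emeasure_ball v_def N_def)
  also have "\<dots> \<le> (ennreal (12 * r) * ennreal (l / (2 * r) * (\<theta> powr (p - 1) * C * (v * (8 * r) ^ N) + measure lborel S / \<theta>))) * ennreal (v * (12 * r) ^ N)"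
    by (intro mult_right_mono mult_left_mono E) auto
  also have "\<dots> = ennreal ((12 * r) * (l / (2 * r) * (\<theta> powr (p - 1) * C * (v * (8 * r) ^ N) + measure lborel S / \<theta>)) * (v * (12 * r) ^ N))"
    using r l0 C \<theta> by (simp add: ennreal_mult[symmetric] v_def)
  also have "ennreal (l / 2) * emeasure lborel Q * emeasure lborel P = ennreal (l / 2 * (sublevel f x\<^sub>0 (l / 2) (6 * r) * measure lborel P))"
    using l0 by (simp add: mP mQ ennreal_mult[symmetric] sublevel_nonneg mult.assoc)
  finally have "l / 2 * (sublevel f x\<^sub>0 (l / 2) (6 * r) * measure lborel P)
    \<le> (12 * r) * (l / (2 * r) * (\<theta> powr (p - 1) * C * (v * (8 * r) ^ N) + measure lborel S / \<theta>)) * (v * (12 * r) ^ N)"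
    using r l0 C \<theta> by (subst (asm) ennreal_le_iff) (auto simp: v_def)
  also have "\<dots> = l / 2 * (12 * (v * (12 * r) ^ N) * (\<theta> powr (p - 1) * C * (v * (8 * r) ^ N) + measure lborel S / \<theta>))"
    using r by simp
  finally show ?thesis using l0 by (simp add: P_def S_def B_def mult.commute)
qed

text \<open>The bound reproduces itself: the 1/N-th power of the j-th bound is 4^(-j) / (K 4^N),
  which cancels the factor K 4^j of the recursion and leaves exactly the ratio 4^(-N).\<close>

lemma fast_geometric_decay:
  fixes Y :: "nat \<Rightarrow> real"
  assumes "0 < K" "0 < N" and nn: "\<And>j. 0 \<le> Y j"
    and step: "\<And>j. Y (Suc j) \<le> K * 4 ^ j * (Y j * Y j powr (1 / real N))"
    and 0: "Y 0 \<le> (1 / (K * 4 ^ N)) ^ N"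
  shows "Y j \<le> (1 / (K * 4 ^ N)) ^ N * (1 / 4 ^ N) ^ j"
proof (induction j)
  case 0
  then show ?case using assms by simp
next
  case (Suc j)
  define \<nu> where "\<nu> = (1 / (K * 4 ^ N)) ^ N"
  define q where "q = 1 / (K * 4 ^ N) * (1 / 4) ^ j"
  have pos: "0 < q" using assms by (simp add: q_def)
  have "\<nu> * (1 / 4 ^ N) ^ j = q ^ N"
    unfolding \<nu>_def q_def power_mult_distrib by (simp add: power_one_over power_mult[symmetric] mult.commute)
  also have "\<dots> powr (1 / real N) = q"
    using pos \<open>0 < N\<close> by (simp add: powr_realpow[OF pos, symmetric] powr_powr)
  finally have root: "(\<nu> * (1 / 4 ^ N) ^ j) powr (1 / real N) = 1 / (K * 4 ^ N) * (1 / 4) ^ j"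
    by (simp only: q_def)
  have "Y (Suc j) \<le> K * 4 ^ j * (Y j * Y j powr (1 / real N))" by (rule step)
  also have "\<dots> \<le> K * 4 ^ j * ((\<nu> * (1 / 4 ^ N) ^ j) * (\<nu> * (1 / 4 ^ N) ^ j) powr (1 / real N))"
    using Suc nn[of j] assms(1,2) unfolding \<nu>_def[symmetric]
    by (intro mult_left_mono mult_mono powr_mono2) auto
  also have "\<dots> = \<nu> * (1 / 4 ^ N) ^ Suc j * ((K * (1 / K)) * (4 ^ j * (1 / 4) ^ j))"
    unfolding root by (simp add: field_simps)
  also have "\<dots> = \<nu> * (1 / 4 ^ N) ^ Suc j"
    using assms(1) by (simp add: power_mult_distrib[symmetric])
  finally show ?case unfolding \<nu>_def .
qed

text \<open>The constants are chosen backwards: \<nu> is the smallness that starts the iteration,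
  \<theta> makes the first term of \<open>shrink_level\<close> at most half of it, the number J of
  levels does the same for the second term, and \<delta> lies below all J levels. None of them
  depends on f, r or \<zeta>.\<close>

theorem degiorgi_positivity:
  fixes p C \<sigma> :: real
  assumes p: "1 < p" and C: "0 \<le> C" and \<sigma>: "0 < \<sigma>"
  shows "\<exists>\<delta>>0. \<delta> < 1 / 4 \<and> (\<forall>(f :: 'a::euclidean_space \<Rightarrow> real) G x\<^sub>0 r \<zeta>.
    weak_pair f G \<longrightarrow> 0 < r \<longrightarrow> 0 < \<zeta> \<longrightarrow> (\<forall>x\<in>ball x\<^sub>0 (8 * r). 0 \<le> f x) \<longrightarrow>
    caccioppoli p C f G x\<^sub>0 r (\<delta> * \<zeta>) \<longrightarrow>
    \<sigma> * measure lborel (ball x\<^sub>0 r) \<le> measure lborel ({x. \<zeta> \<le> f x} \<inter> ball x\<^sub>0 r) \<longrightarrow>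
    sublevel f x\<^sub>0 (\<delta> * \<zeta>) (4 * r) = 0)"
proof -
  obtain \<Lambda> where \<Lambda>: "1 \<le> \<Lambda>" "\<And>(x\<^sub>0::'a) a b. 0 < a \<Longrightarrow> a < b \<Longrightarrow> \<exists>\<phi>. cutoff x\<^sub>0 a b (\<Lambda> / (b - a)) \<phi>"
    using cutoff_exists[where 'a='a] by blast
  define N where "N = DIM('a)"
  have N: "0 < N" by (simp add: N_def)
  define v where "v = unit_ball_vol (real N)"
  have v: "0 < v" by (simp add: v_def)
  \<comment> \<open>The constant of \<open>degiorgi_step\<close>.\<close>
  define K0 where "K0 = 2 * (2 / v) powr (1 / real N) * (\<Lambda> + C + 1)"
  have K0: "0 < K0" using v \<Lambda> C by (simp add: K0_def)
  \<comment> \<open>The factor 8 is 2 for levels up to 2 \<tau>, 2 for the width r / 2^(i+1) and 2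
    for the level gap \<tau> / 2^(i+1). The two powers of 2^i make up the 4^i of the
    recursion.\<close>
  define K where "K = 8 * K0"
  have K: "0 < K" using K0 by (simp add: K_def)
  \<comment> \<open>The threshold of \<open>fast_geometric_decay\<close>.\<close>
  define \<nu> where "\<nu> = (1 / (K * 4 ^ N)) ^ N"
  have \<nu>: "0 < \<nu>" using K by (simp add: \<nu>_def)
  \<comment> \<open>c0 and c2 are the coefficients in \<open>shrink_level\<close> after division by
    the measure \<sigma> v r^N of the good set; 12, 8 and 6 are the radii occurring there.\<close>
  define c0 where "c0 = 12 * 12 ^ N / \<sigma> * (C * v * 8 ^ N)"
  have c0: "0 \<le> c0" using \<sigma> C v by (simp add: c0_def)
  define c2 where "c2 = 12 * 12 ^ N / \<sigma> * (v * 6 ^ N)"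
  have c2: "0 < c2" using \<sigma> v by (simp add: c2_def)
  \<comment> \<open>Adding 1 to c0 covers the case C = 0, where c0 vanishes.\<close>
  define \<theta> where "\<theta> = (\<nu> / (2 * (c0 + 1))) powr (1 / (p - 1))"
  have \<theta>: "0 < \<theta>" using \<nu> c0 by (simp add: \<theta>_def)
  have \<theta>p: "\<theta> powr (p - 1) = \<nu> / (2 * (c0 + 1))" unfolding \<theta>_def powr_powr using p \<nu> c0 by simp
  have "c0 * \<theta> powr (p - 1) \<le> (c0 + 1) * \<theta> powr (p - 1)" by (intro mult_right_mono) auto
  also have "\<dots> = \<nu> / 2" unfolding \<theta>p using c0 by (simp add: field_simps)
  finally have small1: "c0 * \<theta> powr (p - 1) \<le> \<nu> / 2" .
  obtain J0 :: nat where J0: "2 * c2 / (\<theta> * \<nu>) < real J0" using reals_Archimedean2 by blast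
  \<comment> \<open>J >= 2 guarantees \<delta> <= 1/8.\<close>
  define J where "J = max 2 J0"
  have J: "2 \<le> J" "2 * c2 / (\<theta> * \<nu>) \<le> real J" using J0 by (auto simp: J_def)
  have small2: "c2 / (\<theta> * real J) \<le> \<nu> / 2"
    using J \<theta> \<nu> c2 by (simp add: field_simps)
  \<comment> \<open>One halving more than J: then 2 \<delta> \<zeta> = \<zeta> / 2^J is at most l /
    2 for each candidate level l = \<zeta> / 2^j with j < J.\<close>
  define \<delta> where "\<delta> = (1 / 2 :: real) ^ Suc J"
  have "(1 / 2 :: real) ^ Suc J \<le> (1 / 2) ^ 3" using J by (intro power_decreasing) auto
  then have \<delta>: "0 < \<delta>" "\<delta> < 1 / 4" by (auto simp: \<delta>_def power3_eq_cube)
  have main: "sublevel f x\<^sub>0 (\<delta> * \<zeta>) (4 * r) = 0"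
    if w: "weak_pair f G" and r: "0 < r" and \<zeta>: "0 < \<zeta>" and f: "\<forall>x\<in>ball x\<^sub>0 (8 * r). 0 \<le> f x"
      and c: "caccioppoli p C f G x\<^sub>0 r (\<delta> * \<zeta>)"
      and dens: "\<sigma> * measure lborel (ball x\<^sub>0 r) \<le> measure lborel ({x. \<zeta> \<le> f x} \<inter> ball x\<^sub>0 r)"
    for f :: "'a \<Rightarrow> real" and G x\<^sub>0 r \<zeta>
  proof -
    note [measurable] = weak_pairD(3,4)[OF w]
    have [measurable]: "{x. f x < t} \<in> sets borel" "{x. t \<le> f x} \<in> sets borel" "ball (y::'a) t \<in> sets borel" for t y by measurable
    define \<tau> where "\<tau> = \<delta> * \<zeta>"
    have \<tau>: "0 < \<tau>" using \<delta> \<zeta> by (simp add: \<tau>_def)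
    note c' = c[folded \<tau>_def]
    \<comment> \<open>The layers between consecutive levels are disjoint subsets of B_6r, so one of
      the first J has at most the J-th part of the measure of that ball.\<close>
    define S where "S j = ball x\<^sub>0 (6 * r) \<inter> {x. f x < \<zeta> / 2 ^ j} \<inter> {x. \<zeta> / 2 ^ j / 2 \<le> f x}" for j :: nat
    have Sm [measurable]: "S j \<in> sets borel" for j unfolding S_def by measurable
    have lev_mono: "\<zeta> / 2 ^ j \<le> \<zeta> / 2 ^ i" if "i \<le> j" for i j
      using \<zeta> that by (intro divide_left_mono) (auto simp: power_increasing)
    have Sfin: "emeasure lborel (S j) < \<infinity>" for j
      unfolding S_def Int_assoc by (rule finite_ball_Int)
    have disj: "disjoint_family_on S {..<J}"
    proof -
      have "S i \<inter> S j = {}" if "i < j" for i j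
      proof -
        have "\<zeta> / 2 ^ j \<le> \<zeta> / 2 ^ i / 2" using lev_mono[of "Suc i" j] that by (simp add: mult.commute)
        then have "\<not> (f x < \<zeta> / 2 ^ j \<and> \<zeta> / 2 ^ i / 2 \<le> f x)" for x by linarith
        then show ?thesis unfolding S_def by blast
      qed
      then show ?thesis unfolding disjoint_family_on_def by (metis Int_commute linorder_neqE_nat)
    qed
    have "(\<Sum>j<J. measure lborel (S j)) = measure lborel (\<Union>j<J. S j)"
      using Sfin disj by (intro measure_finite_Union[symmetric]) (auto simp: less_top)
    also have "\<dots> \<le> measure lborel (ball x\<^sub>0 (6 * r))"
      using finite_ball_Int[of x\<^sub>0 "6 * r" UNIV]
      by (intro measure_mono_fmeasurable) (auto simp: fmeasurable_def S_def)
    also have "\<dots> = v * (6 * r) ^ N" using r by (simp add: measure_lborel_ball v_def N_def)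
    finally have sumS: "(\<Sum>j<J. measure lborel (S j)) \<le> v * (6 * r) ^ N" .
    obtain j where j: "j < J" "measure lborel (S j) \<le> v * (6 * r) ^ N / real J"
    proof (rule ccontr)
      assume "\<not> thesis"
      then have "\<And>j. j < J \<Longrightarrow> v * (6 * r) ^ N / real J < measure lborel (S j)" using that by force
      then have "(\<Sum>j<J. v * (6 * r) ^ N / real J) < (\<Sum>j<J. measure lborel (S j))"
        using J by (intro sum_strict_mono) (auto simp: lessThan_empty_iff)
      then show False using sumS J by simp
    qed
    define l where "l = \<zeta> / 2 ^ j"
    have l\<tau>: "2 * \<tau> \<le> l / 2"
    proof -
      have "2 * \<tau> = \<zeta> / 2 ^ J" by (simp add: \<tau>_def \<delta>_def power_one_over)
      also have "\<dots> \<le> \<zeta> / 2 ^ Suc j" using j(1) by (intro lev_mono) simp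
      finally show ?thesis by (simp add: l_def)
    qed
    have "l \<le> \<zeta>" using lev_mono[of 0 j] by (simp add: l_def)
    have "\<sigma> * (v * r ^ N) \<le> measure lborel ({x. \<zeta> \<le> f x} \<inter> ball x\<^sub>0 r)"
      using dens r by (simp add: measure_lborel_ball v_def N_def)
    also have "\<dots> \<le> measure lborel (ball x\<^sub>0 r \<inter> {x. l \<le> f x})"
      using finite_ball_Int[of x\<^sub>0 r "{x. l \<le> f x}"] \<open>l \<le> \<zeta>\<close>
      by (intro measure_mono_fmeasurable) (auto simp: fmeasurable_def)
    finally have P: "\<sigma> * (v * r ^ N) \<le> measure lborel ({x. l \<le> f x} \<inter> ball x\<^sub>0 r)" by (simp add: Int_commute)
    let ?Q = "sublevel f x\<^sub>0 (l / 2) (6 * r)"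
    have "\<sigma> * (v * r ^ N) * ?Q \<le> measure lborel ({x. l \<le> f x} \<inter> ball x\<^sub>0 r) * ?Q"
      using P by (rule mult_right_mono) (rule sublevel_nonneg)
    also have "\<dots> \<le> 12 * (v * (12 * r) ^ N) * (\<theta> powr (p - 1) * C * (v * (8 * r) ^ N) + measure lborel (S j) / \<theta>)"
      using shrink_level[OF w c' p C \<tau> _ r \<theta>, of l] l\<tau> \<tau> by (simp add: S_def l_def v_def N_def)
    also have "\<dots> \<le> 12 * (v * (12 * r) ^ N) * (\<theta> powr (p - 1) * C * (v * (8 * r) ^ N) + v * (6 * r) ^ N / real J / \<theta>)"
      using j(2) v r \<theta> by (intro mult_left_mono add_left_mono divide_right_mono) auto
    also have "\<dots> = \<sigma> * (v * r ^ N) * ((c0 * \<theta> powr (p - 1) + c2 / (\<theta> * real J)) * r ^ N)"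
      using \<sigma> \<theta> J by (simp add: c0_def c2_def power_mult_distrib field_simps)
    finally have "?Q \<le> (c0 * \<theta> powr (p - 1) + c2 / (\<theta> * real J)) * r ^ N"
      using \<sigma> v r by (subst (asm) mult_le_cancel_left_pos) auto
    also have "\<dots> \<le> \<nu> * r ^ N"
    proof (rule mult_right_mono)
      show "c0 * \<theta> powr (p - 1) + c2 / (\<theta> * real J) \<le> \<nu>" using small1 small2 by linarith
    qed (use r in simp)
    finally have start: "sublevel f x\<^sub>0 (2 * \<tau>) (6 * r) \<le> \<nu> * r ^ N"
      using sublevel_mono[of f "2 * \<tau>" "l / 2" "6 * r" "6 * r" x\<^sub>0] l\<tau> by simp

    \<comment> \<open>Levels decrease from 2 \<tau> to \<tau> and radii from 6r to 4r.\<close>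
    define lv where "lv i = \<tau> * (1 + 1 / 2 ^ i)" for i :: nat
    define rd where "rd i = 4 * r + 2 * r / 2 ^ i" for i :: nat
    \<comment> \<open>Division by r^N makes the recursion independent of r: the factor 1 / r from
      the width is absorbed by the 1/N-th power.\<close>
    define Y where "Y i = sublevel f x\<^sub>0 (lv i) (rd i) / r ^ N" for i
    have Y0: "0 \<le> Y i" for i using r by (simp add: Y_def sublevel_nonneg)
    have Ystep: "Y (Suc i) \<le> K * 4 ^ i * (Y i * Y i powr (1 / real N))" for i
    proof -
      \<comment> \<open>Half the gap between consecutive radii, since \<open>degiorgi_step\<close>
        enlarges the ball by k twice.\<close>
      define k where "k = r / 2 ^ i / 2"
      have k: "0 < k" using r by (simp add: k_def)
      have rdk: "rd i = rd (Suc i) + 2 * k" by (simp add: rd_def k_def field_simps)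
      have rd0: "0 < rd (Suc i)" using r by (simp add: rd_def add_pos_pos)
      have "1 / 2 ^ i \<le> (1::real)" by simp
      then have "2 * r * (1 / 2 ^ i) \<le> 2 * r * 1" using r by (intro mult_left_mono) auto
      then have rd8: "rd (Suc i) + 2 * k \<le> 8 * r" unfolding rdk[symmetric] using r by (simp add: rd_def)
      obtain \<phi> where \<phi>: "cutoff x\<^sub>0 (rd (Suc i)) (rd (Suc i) + k) (\<Lambda> / k) \<phi>"
        using \<Lambda>(2)[OF rd0, of "rd (Suc i) + k" x\<^sub>0] k by auto
      have lv1: "\<tau> \<le> lv (Suc i)" "lv (Suc i) < lv i" using \<tau> by (auto simp: lv_def field_simps)
      have dl: "lv i - lv (Suc i) = \<tau> / 2 ^ i / 2" by (simp add: lv_def field_simps)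
      have "1 / 2 ^ i \<le> (1::real)" by simp
      then have "\<tau> * (1 / 2 ^ i) \<le> \<tau> * 1" using \<tau> by (intro mult_left_mono) auto
      then have lv2: "lv i \<le> 2 * \<tau>" by (simp add: lv_def distrib_left)
      define m where "m = sublevel f x\<^sub>0 (lv i) (rd i)"
      have m0: "0 \<le> m" by (simp add: m_def sublevel_nonneg)
      have "\<tau> / 2 ^ i / 2 * sublevel f x\<^sub>0 (lv (Suc i)) (rd (Suc i)) \<le> K0 * (lv i / k) * (m * m powr (1 / real N))"
        using degiorgi_step[OF w c' p C \<tau> lv1 rd0 k rd8 _ \<phi>] f \<Lambda>
        by (simp add: dl K0_def N_def v_def rdk m_def)
      also have "\<dots> \<le> K0 * (2 * \<tau> / k) * (m * m powr (1 / real N))"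
        using lv2 K0 k m0 by (intro mult_right_mono mult_left_mono divide_right_mono) auto
      also have "\<dots> = \<tau> / 2 ^ i / 2 * (K * 4 ^ i / r * (m * m powr (1 / real N)))"
        using r by (simp add: K_def k_def field_simps power_mult_distrib[symmetric])
      finally have "sublevel f x\<^sub>0 (lv (Suc i)) (rd (Suc i)) \<le> K * 4 ^ i / r * (m * m powr (1 / real N))"
        using \<tau> by (subst (asm) mult_le_cancel_left_pos) auto
      then have "Y (Suc i) \<le> (K * 4 ^ i / r * (m * m powr (1 / real N))) / r ^ N"
        unfolding Y_def using r by (intro divide_right_mono) auto
      also have "\<dots> = K * 4 ^ i * (m / r ^ N * (m powr (1 / real N) / r))" by simp
      also have "m powr (1 / real N) / r = (m / r ^ N) powr (1 / real N)"
        using m0 r N by (simp add: powr_divide powr_realpow[symmetric] powr_powr)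
      finally show ?thesis by (simp add: Y_def m_def)
    qed
    have "lv 0 = 2 * \<tau>" "rd 0 = 6 * r" by (auto simp: lv_def rd_def)
    then have "Y 0 \<le> \<nu>" using start r by (simp add: Y_def divide_le_eq)
    from fast_geometric_decay[OF K N Y0 Ystep this[unfolded \<nu>_def]]
    have Yj: "Y i \<le> \<nu> * (1 / 4 ^ N) ^ i" for i by (simp only: \<nu>_def)
    \<comment> \<open>The limiting level and ball lie inside those of every stage.\<close>
    have "sublevel f x\<^sub>0 \<tau> (4 * r) \<le> \<nu> * (1 / 4 ^ N) ^ i * r ^ N" for i
    proof -
      have "sublevel f x\<^sub>0 \<tau> (4 * r) \<le> sublevel f x\<^sub>0 (lv i) (rd i)"
        using \<tau> r by (intro sublevel_mono) (auto simp: lv_def rd_def)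
      also have "\<dots> = Y i * r ^ N" using r by (simp add: Y_def)
      also have "\<dots> \<le> \<nu> * (1 / 4 ^ N) ^ i * r ^ N" using Yj[of i] r by (intro mult_right_mono) auto
      finally show ?thesis .
    qed
    moreover have "(\<lambda>i. \<nu> * (1 / 4 ^ N) ^ i * r ^ N) \<longlonglongrightarrow> \<nu> * 0 * r ^ N"
      using N by (intro tendsto_intros LIMSEQ_realpow_zero) (auto simp: one_less_power)
    ultimately have "sublevel f x\<^sub>0 \<tau> (4 * r) \<le> 0"
      by (intro LIMSEQ_le_const[of _ _ "sublevel f x\<^sub>0 \<tau> (4 * r)"]) auto
    then show ?thesis unfolding \<tau>_def[symmetric] using sublevel_nonneg[of f x\<^sub>0 \<tau> "4 * r"] by simp
  qed
  then show ?thesis using \<delta> by blast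
qed

section \<open>Borel representatives and local weak gradients\<close>

lemma lebesgue_measurable_AE_eq:
  fixes F :: "'a::euclidean_space \<Rightarrow> 'b::topological_space"
  assumes h: "h \<in> borel_measurable borel" and ae: "AE x in lborel. F x = h x"
  shows "F \<in> borel_measurable lebesgue"
proof (rule measurableI)
  fix A :: "'b set" assume A: "A \<in> sets borel"
  have h': "h -` A \<in> sets lebesgue" using measurable_sets_borel[OF h A] by simp
  have "{x \<in> space (completion lborel). F x \<in> A \<and> F x \<noteq> h x} \<in> sets (completion lborel)"
    "{x \<in> space (completion lborel). F x \<notin> A \<and> F x \<noteq> h x} \<in> sets (completion lborel)"
    using ae by (intro predE[OF sets_completion_AE]; force elim: eventually_mono)+
  then have "(h -` A \<union> {x. F x \<in> A \<and> F x \<noteq> h x}) - {x. F x \<notin> A \<and> F x \<noteq> h x} \<in> sets lebesgue"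
    using h' by auto
  also have "(h -` A \<union> {x. F x \<in> A \<and> F x \<noteq> h x}) - {x. F x \<notin> A \<and> F x \<noteq> h x} = F -` A \<inter> space lebesgue" by force
  finally show "F -` A \<inter> space lebesgue \<in> sets lebesgue" .
qed simp

text \<open>Integrals in the definitions are over the completed measure; this evaluates them by
  Borel representatives, for which Fubini and translations are available.\<close>

lemma integral_lebesgue_AE_eq:
  fixes F h :: "'a::euclidean_space \<Rightarrow> real"
  assumes h: "h \<in> borel_measurable borel" and ae: "AE x in lborel. F x = h x"
  shows "integral\<^sup>L lebesgue F = integral\<^sup>L lborel h"
proof -
  have "integral\<^sup>L lebesgue F = integral\<^sup>L lebesgue h"
    using lebesgue_measurable_AE_eq[OF h ae] h ae
    by (intro integral_cong_AE) (auto intro: measurable_completion AE_completion)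
  then show ?thesis using h by (simp add: integral_completion)
qed

lemma lebesgue_measurable_borel_version:
  fixes F :: "'a::euclidean_space \<Rightarrow> 'b::euclidean_space"
  assumes "F \<in> borel_measurable lebesgue"
  shows "\<exists>h\<in>borel_measurable borel. AE x in lborel. F x = h x"
proof -
  have "\<exists>h\<in>borel_measurable lborel. AE x in lborel. F x \<bullet> b = h x" for b
    using assms by (intro completion_ex_borel_measurable_real) simp
  then have "\<forall>b. \<exists>h. h \<in> borel_measurable borel \<and> (AE x in lborel. F x \<bullet> b = h x)"
    by (auto simp: Bex_def)
  from choice[OF this] obtain h
    where h: "\<And>b. h b \<in> borel_measurable borel" "\<And>b. AE x in lborel. F x \<bullet> b = h b x" by blast
  have "AE x in lborel. \<forall>b\<in>Basis. F x \<bullet> b = h b x" by (subst AE_finite_all) (auto simp: h)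
  then have "AE x in lborel. F x = (\<Sum>b\<in>Basis. h b x *\<^sub>R b)"
  proof eventually_elim
    fix x assume "\<forall>b\<in>Basis. F x \<bullet> b = h b x"
    then have "(\<Sum>b\<in>Basis. h b x *\<^sub>R b) = (\<Sum>b\<in>Basis. (F x \<bullet> b) *\<^sub>R b)" by simp
    then show "F x = (\<Sum>b\<in>Basis. h b x *\<^sub>R b)" by (simp add: euclidean_representation)
  qed
  moreover have "(\<lambda>x. \<Sum>b\<in>Basis. h b x *\<^sub>R b) \<in> borel_measurable borel" using h by measurable
  ultimately show ?thesis by (rule bexI)
qed

lemma Lp_on_compact_borel_version:
  fixes F :: "'a::euclidean_space \<Rightarrow> 'b::euclidean_space"
  assumes "Lp_on q K F" and K: "compact K"
  obtains h where "h \<in> borel_measurable borel" "AE x in lborel. indicator K x *\<^sub>R F x = h x"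
    "integrable lborel (\<lambda>x. norm (h x) powr q)"
proof -
  have K': "K \<in> sets lebesgue" using K by (simp add: lmeasurable_compact fmeasurableD)
  have F: "F \<in> borel_measurable (lebesgue_on K)" "integrable (lebesgue_on K) (\<lambda>x. norm (F x) powr q)"
    using assms by (auto simp: Lp_on_def)
  have 1: "(\<lambda>x. indicator K x *\<^sub>R F x) \<in> borel_measurable lebesgue"
    using F(1) K' by (simp add: borel_measurable_restrict_space_iff)
  have 2: "integrable lebesgue (\<lambda>x. indicator K x *\<^sub>R norm (F x) powr q)"
    using F(2) K' by (simp add: integrable_restrict_space)
  obtain h where h: "h \<in> borel_measurable borel" "AE x in lborel. indicator K x *\<^sub>R F x = h x"
    using lebesgue_measurable_borel_version[OF 1] by blast
  have "integrable lebesgue (\<lambda>x. norm (h x) powr q)"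
  proof (rule integrable_cong_AE_imp[OF 2])
    show "(\<lambda>x. norm (h x) powr q) \<in> borel_measurable lebesgue"
      by (rule measurable_completion) (use h(1) in measurable)
    have "AE x in lborel. indicator K x *\<^sub>R norm (F x) powr q = norm (h x) powr q"
      using h(2) by eventually_elim (auto simp: indicator_def)
    then show "AE x in lebesgue. indicator K x *\<^sub>R norm (F x) powr q = norm (h x) powr q"
      by (rule AE_completion)
  qed
  then have "integrable lborel (\<lambda>x. norm (h x) powr q)"
    by (rule integrable_completion[THEN iffD1, rotated]) (use h(1) in measurable)
  then show thesis using that h by blast
qed

section \<open>Localization and uniqueness of weak gradients\<close>

lemma weak_pairI_Basis:
  assumes f: "integrable lborel f" and G: "integrable lborel G"
    and eq: "\<And>\<phi> b. test_function UNIV \<phi> \<Longrightarrow> b \<in> Basis \<Longrightarrow>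
      (\<integral>x. f x * (grad \<phi> x \<bullet> b) \<partial>lborel) = - (\<integral>x. (G x \<bullet> b) * \<phi> x \<partial>lborel)"
  shows "weak_pair f G"
  unfolding weak_pair_def
proof (intro conjI allI impI f G)
  fix \<phi> :: "'a \<Rightarrow> real" and h assume \<phi>: "test_function UNIV \<phi>"
  have rep: "z \<bullet> h = (\<Sum>b\<in>Basis. (h \<bullet> b) * (z \<bullet> b))" for z :: 'a
    by (subst euclidean_inner) (simp add: mult.commute)
  have "(\<integral>x. f x * (grad \<phi> x \<bullet> h) \<partial>lborel) = (\<integral>x. (\<Sum>b\<in>Basis. (h \<bullet> b) * (f x * (grad \<phi> x \<bullet> b))) \<partial>lborel)"
    by (subst rep) (simp add: sum_distrib_left mult_ac)
  also have "\<dots> = (\<Sum>b\<in>Basis. (h \<bullet> b) * (\<integral>x. f x * (grad \<phi> x \<bullet> b) \<partial>lborel))"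
    using integrable_mult_test(2)[OF f \<phi>] by (subst Bochner_Integration.integral_sum) auto
  also have "\<dots> = - (\<Sum>b\<in>Basis. (h \<bullet> b) * (\<integral>x. (G x \<bullet> b) * \<phi> x \<partial>lborel))"
    using eq[OF \<phi>] by (simp add: sum_negf)
  also have "(\<Sum>b\<in>Basis. (h \<bullet> b) * (\<integral>x. (G x \<bullet> b) * \<phi> x \<partial>lborel)) = (\<integral>x. (\<Sum>b\<in>Basis. (h \<bullet> b) * ((G x \<bullet> b) * \<phi> x)) \<partial>lborel)"
    using integrable_mult_test(1)[OF integrable_inner_left[OF G] \<phi>]
    by (subst Bochner_Integration.integral_sum) auto
  also have "\<dots> = (\<integral>x. (G x \<bullet> h) * \<phi> x \<partial>lborel)"
    by (subst rep) (simp only: sum_distrib_right mult.assoc)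
  finally show "(\<integral>x. f x * (grad \<phi> x \<bullet> h) \<partial>lborel) = - (\<integral>x. (G x \<bullet> h) * \<phi> x \<partial>lborel)" .
qed

lemma integrable_scaleR_bounded_left:
  fixes f :: "'a \<Rightarrow> 'b::{banach, second_countable_topology}" and g :: "'a \<Rightarrow> real"
  assumes f: "integrable M f" and [measurable]: "g \<in> borel_measurable M" and B: "\<And>x. \<bar>g x\<bar> \<le> B"
  shows "integrable M (\<lambda>x. g x *\<^sub>R f x)"
proof (rule Bochner_Integration.integrable_bound)
  have [measurable]: "f \<in> borel_measurable M" using f by auto
  show "(\<lambda>x. g x *\<^sub>R f x) \<in> borel_measurable M" by measurable
  show "integrable M (\<lambda>x. B * norm (f x))" using f by simp
  show "AE x in M. norm (g x *\<^sub>R f x) \<le> norm (B * norm (f x))"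
  proof (rule AE_I2)
    fix x
    have "norm (g x *\<^sub>R f x) \<le> B * norm (f x)" unfolding norm_scaleR by (rule mult_right_mono[OF B]) simp
    then show "norm (g x *\<^sub>R f x) \<le> norm (B * norm (f x))" by simp
  qed
qed

lemma integrable_scaleR_bounded_right:
  fixes f :: "'a \<Rightarrow> real" and g :: "'a \<Rightarrow> 'b::{banach, second_countable_topology}"
  assumes f: "integrable M f" and [measurable]: "g \<in> borel_measurable M" and B: "\<And>x. norm (g x) \<le> B"
  shows "integrable M (\<lambda>x. f x *\<^sub>R g x)"
proof (rule Bochner_Integration.integrable_bound)
  have [measurable]: "f \<in> borel_measurable M" using f by auto
  show "(\<lambda>x. f x *\<^sub>R g x) \<in> borel_measurable M" by measurable
  show "integrable M (\<lambda>x. B * \<bar>f x\<bar>)" using f by simp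
  show "AE x in M. norm (f x *\<^sub>R g x) \<le> norm (B * \<bar>f x\<bar>)"
  proof (rule AE_I2)
    fix x
    have "norm (f x *\<^sub>R g x) \<le> \<bar>f x\<bar> * B" unfolding norm_scaleR by (rule mult_left_mono[OF B]) simp
    then show "norm (f x *\<^sub>R g x) \<le> norm (B * \<bar>f x\<bar>)" by (simp add: mult.commute)
  qed
qed

text \<open>For a test function \<phi> on the whole space, \<xi> \<phi> is a test function on S;
  testing u with it gives the product rule for \<xi> u. The compact support of \<xi> turns local
  integrability into global integrability.\<close>

lemma weak_grad_localize:
  fixes u :: "'a::euclidean_space \<Rightarrow> real"
  assumes g: "is_weak_grad S u g" and \<xi>: "test_function S \<xi>"
  obtains f G where "weak_pair f G" "AE x in lborel. f x = \<xi> x * u x"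
    "AE x in lborel. G x = \<xi> x *\<^sub>R g x + u x *\<^sub>R grad \<xi> x"
proof -
  obtain K B where K: "compact K" "K \<subseteq> S" "\<And>x. x \<notin> K \<Longrightarrow> \<xi> x = 0" "\<And>x. x \<notin> K \<Longrightarrow> grad \<xi> x = 0"
    and B: "\<And>x. \<bar>\<xi> x\<bar> \<le> B" "\<And>x. norm (grad \<xi> x) \<le> B" "0 \<le> B"
    using test_function_bounds[OF \<xi>] by metis
  note s = test_function_smooth[OF \<xi>]
  note [measurable] = smooth_measurable[OF s] smooth_grad_measurable[OF s]
  have Lp: "Lp_on 1 K u" "Lp_on 1 K g" using g K by (auto simp: is_weak_grad_def Lp_loc_def)
  obtain uB where uB: "uB \<in> borel_measurable borel" "AE x in lborel. indicator K x *\<^sub>R u x = uB x"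
      "integrable lborel (\<lambda>x. norm (uB x) powr 1)"
    using Lp_on_compact_borel_version[OF Lp(1) K(1)] .
  obtain gB where gB: "gB \<in> borel_measurable borel" "AE x in lborel. indicator K x *\<^sub>R g x = gB x"
      "integrable lborel (\<lambda>x. norm (gB x) powr 1)"
    using Lp_on_compact_borel_version[OF Lp(2) K(1)] .
  note [measurable] = uB(1) gB(1)
  have iu: "integrable lborel uB" and ig: "integrable lborel gB"
    using integrable_norm_cancel[of lborel uB] integrable_norm_cancel[of lborel gB] uB(3) gB(3) by auto
  define f where "f x = \<xi> x * uB x" for x
  define G where "G x = \<xi> x *\<^sub>R gB x + uB x *\<^sub>R grad \<xi> x" for x
  have if1: "integrable lborel f" unfolding f_def
    using integrable_mult_bounded[OF iu, of \<xi> B] B by (simp add: mult.commute)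
  have i1: "integrable lborel (\<lambda>x. \<xi> x *\<^sub>R gB x)"
    by (rule integrable_scaleR_bounded_left[OF ig _ B(1)]) measurable
  have i2: "integrable lborel (\<lambda>x. uB x *\<^sub>R grad \<xi> x)"
    by (rule integrable_scaleR_bounded_right[OF iu _ B(2)]) measurable
  have iG: "integrable lborel G" unfolding G_def using i1 i2 by simp
  have "weak_pair f G"
  proof (rule weak_pairI_Basis[OF if1 iG])
    fix \<phi> :: "'a \<Rightarrow> real" and b :: 'a assume \<phi>: "test_function UNIV \<phi>" and b: "b \<in> Basis"
    note s\<phi> = test_function_smooth[OF \<phi>]
    note [measurable] = smooth_measurable[OF s\<phi>] smooth_grad_measurable[OF s\<phi>]
    have t: "test_function S (\<lambda>x. \<xi> x * \<phi> x)" by (rule test_function_mult[OF \<xi> s\<phi>])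
    have gr: "grad (\<lambda>x. \<xi> x * \<phi> x) x = \<xi> x *\<^sub>R grad \<phi> x + \<phi> x *\<^sub>R grad \<xi> x" for x
      by (rule grad_mult[OF s s\<phi>])
    have "(LINT x:S|lebesgue. u x * frechet_derivative (\<lambda>x. \<xi> x * \<phi> x) (at x) b)
      = (\<integral>x. uB x * (grad (\<lambda>x. \<xi> x * \<phi> x) x \<bullet> b) \<partial>lborel)"
      unfolding set_lebesgue_integral_def
    proof (rule integral_lebesgue_AE_eq)
      show "AE x in lborel. indicator S x *\<^sub>R (u x * frechet_derivative (\<lambda>x. \<xi> x * \<phi> x) (at x) b)
        = uB x * (grad (\<lambda>x. \<xi> x * \<phi> x) x \<bullet> b)"
        using uB(2)
      proof eventually_elim
        fix x assume e: "indicator K x *\<^sub>R u x = uB x"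
        show "indicator S x *\<^sub>R (u x * frechet_derivative (\<lambda>x. \<xi> x * \<phi> x) (at x) b)
          = uB x * (grad (\<lambda>x. \<xi> x * \<phi> x) x \<bullet> b)"
          using K(2,3,4) b unfolding e[symmetric] grad_inner_Basis[OF b, symmetric] gr
          by (cases "x \<in> K") (auto simp: indicator_def)
      qed
    qed (simp add: gr)
    moreover have "(LINT x:S|lebesgue. (g x \<bullet> b) * (\<xi> x * \<phi> x)) = (\<integral>x. (gB x \<bullet> b) * (\<xi> x * \<phi> x) \<partial>lborel)"
      unfolding set_lebesgue_integral_def
    proof (rule integral_lebesgue_AE_eq)
      show "AE x in lborel. indicator S x *\<^sub>R ((g x \<bullet> b) * (\<xi> x * \<phi> x)) = (gB x \<bullet> b) * (\<xi> x * \<phi> x)"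
        using gB(2)
      proof eventually_elim
        fix x assume e: "indicator K x *\<^sub>R g x = gB x"
        show "indicator S x *\<^sub>R ((g x \<bullet> b) * (\<xi> x * \<phi> x)) = (gB x \<bullet> b) * (\<xi> x * \<phi> x)"
          using K(2,3) unfolding e[symmetric] by (cases "x \<in> K") (auto simp: indicator_def)
      qed
    qed simp
    ultimately have eq: "(\<integral>x. uB x * (grad (\<lambda>x. \<xi> x * \<phi> x) x \<bullet> b) \<partial>lborel) = - (\<integral>x. (gB x \<bullet> b) * (\<xi> x * \<phi> x) \<partial>lborel)"
      using g t b unfolding is_weak_grad_def by metis
    have j1: "integrable lborel (\<lambda>x. ((uB x *\<^sub>R grad \<xi> x) \<bullet> b) * \<phi> x)"
      by (intro integrable_mult_test(1)[OF _ \<phi>] integrable_inner_left i2)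
    have j2: "integrable lborel (\<lambda>x. ((\<xi> x *\<^sub>R gB x) \<bullet> b) * \<phi> x)"
      by (intro integrable_mult_test(1)[OF _ \<phi>] integrable_inner_left i1)
    have "(\<integral>x. uB x * (grad (\<lambda>x. \<xi> x * \<phi> x) x \<bullet> b) \<partial>lborel)
      = (\<integral>x. f x * (grad \<phi> x \<bullet> b) + ((uB x *\<^sub>R grad \<xi> x) \<bullet> b) * \<phi> x \<partial>lborel)"
      unfolding gr f_def by (intro Bochner_Integration.integral_cong) (auto simp: inner_add_left algebra_simps)
    also have "\<dots> = (\<integral>x. f x * (grad \<phi> x \<bullet> b) \<partial>lborel) + (\<integral>x. ((uB x *\<^sub>R grad \<xi> x) \<bullet> b) * \<phi> x \<partial>lborel)"
      by (intro Bochner_Integration.integral_add integrable_mult_test(2)[OF if1 \<phi>] j1)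
    finally have "(\<integral>x. f x * (grad \<phi> x \<bullet> b) \<partial>lborel)
      = - ((\<integral>x. (gB x \<bullet> b) * (\<xi> x * \<phi> x) \<partial>lborel) + (\<integral>x. ((uB x *\<^sub>R grad \<xi> x) \<bullet> b) * \<phi> x \<partial>lborel))"
      using eq by simp
    also have "(\<integral>x. (gB x \<bullet> b) * (\<xi> x * \<phi> x) \<partial>lborel) = (\<integral>x. ((\<xi> x *\<^sub>R gB x) \<bullet> b) * \<phi> x \<partial>lborel)"
      by (intro Bochner_Integration.integral_cong) auto
    also have "\<dots> + (\<integral>x. ((uB x *\<^sub>R grad \<xi> x) \<bullet> b) * \<phi> x \<partial>lborel) = (\<integral>x. (G x \<bullet> b) * \<phi> x \<partial>lborel)"
      unfolding Bochner_Integration.integral_add[OF j2 j1, symmetric] G_def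
      by (intro Bochner_Integration.integral_cong) (auto simp: inner_add_left algebra_simps)
    finally show "(\<integral>x. f x * (grad \<phi> x \<bullet> b) \<partial>lborel) = - (\<integral>x. (G x \<bullet> b) * \<phi> x \<partial>lborel)" .
  qed
  moreover have "AE x in lborel. f x = \<xi> x * u x"
    using uB(2)
  proof eventually_elim
    fix x assume e: "indicator K x *\<^sub>R u x = uB x"
    show "f x = \<xi> x * u x" using K(3)[of x] by (cases "x \<in> K") (auto simp: f_def e[symmetric])
  qed
  moreover have "AE x in lborel. G x = \<xi> x *\<^sub>R g x + u x *\<^sub>R grad \<xi> x"
    using uB(2) gB(2)
  proof eventually_elim
    fix x assume e: "indicator K x *\<^sub>R u x = uB x" "indicator K x *\<^sub>R g x = gB x"
    show "G x = \<xi> x *\<^sub>R g x + u x *\<^sub>R grad \<xi> x"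
      using K(3,4)[of x] by (cases "x \<in> K") (auto simp: G_def e[symmetric])
  qed
  ultimately show thesis by (rule that)
qed

text \<open>\<open>weak_grad\<close> is an arbitrary choice among the weak gradients; this
  identifies it with a constructed one wherever some test function equals 1.\<close>

lemma weak_grad_unique:
  assumes "is_weak_grad S u g" "is_weak_grad S u g'" "test_function S \<xi>"
  shows "AE x in lborel. \<xi> x *\<^sub>R g x = \<xi> x *\<^sub>R g' x"
proof -
  obtain f G where 1: "weak_pair f G" "AE x in lborel. f x = \<xi> x * u x"
    "AE x in lborel. G x = \<xi> x *\<^sub>R g x + u x *\<^sub>R grad \<xi> x"
    using weak_grad_localize[OF assms(1,3)] .
  obtain f' G' where 2: "weak_pair f' G'" "AE x in lborel. f' x = \<xi> x * u x"
    "AE x in lborel. G' x = \<xi> x *\<^sub>R g' x + u x *\<^sub>R grad \<xi> x"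
    using weak_grad_localize[OF assms(2,3)] .
  have "AE x in lborel. f x = f' x" using 1(2) 2(2) by eventually_elim simp
  from weak_pair_unique[OF 1(1) 2(1) this] 1(3) 2(3) show ?thesis
    by eventually_elim simp
qed

lemma weak_pair_cong_AE:
  assumes w: "weak_pair f G" and [measurable]: "f' \<in> borel_measurable borel" and ae: "AE x in lborel. f x = f' x"
  shows "weak_pair f' G"
proof -
  note [measurable] = weak_pairD(3,4)[OF w]
  have "(\<integral>x. f x * (grad \<phi> x \<bullet> h) \<partial>lborel) = (\<integral>x. f' x * (grad \<phi> x \<bullet> h) \<partial>lborel)"
    if "test_function UNIV \<phi>" for \<phi> h
    using ae smooth_grad_measurable[OF test_function_smooth[OF that]]
    by (intro integral_cong_AE) (auto elim: eventually_mono)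
  moreover have "integrable lborel f'"
    by (rule integrable_cong_AE_imp[OF weak_pairD(1)[OF w]]) (use ae in \<open>auto elim: eventually_mono\<close>)
  ultimately show ?thesis using w unfolding weak_pair_def by metis
qed

text \<open>The way back to the definitions, by which a truncation becomes an admissible test
  function.\<close>

lemma weak_pair_is_weak_grad:
  assumes w: "weak_pair f G"
  shows "is_weak_grad UNIV f G"
  unfolding is_weak_grad_def
proof (intro conjI allI impI ballI)
  note [measurable] = weak_pairD(3,4)[OF w]
  have "Lp_on 1 K F" if F: "integrable lborel F" and K: "compact K" for K and F :: "'a \<Rightarrow> 'c::euclidean_space"
  proof -
    have K': "K \<in> sets lebesgue" using K by (simp add: lmeasurable_compact fmeasurableD)
    have i: "integrable lebesgue F" using F by (simp add: integrable_completion)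
    have "integrable (lebesgue_on K) F"
      using integrable_mult_indicator[OF K' i] K' by (simp add: integrable_restrict_space)
    then show ?thesis by (auto simp: Lp_on_def)
  qed
  then show "Lp_loc 1 UNIV f" "Lp_loc 1 UNIV G" using weak_pairD(1,2)[OF w] by (auto simp: Lp_loc_def)
  fix \<phi> :: "'a \<Rightarrow> real" and b :: 'a assume \<phi>: "test_function UNIV \<phi>" and b: "b \<in> Basis"
  note s = test_function_smooth[OF \<phi>]
  note [measurable] = smooth_measurable[OF s] smooth_grad_measurable[OF s]
  have "(LINT x:UNIV|lebesgue. f x * frechet_derivative \<phi> (at x) b) = (\<integral>x. f x * (grad \<phi> x \<bullet> b) \<partial>lborel)"
    unfolding set_lebesgue_integral_def grad_inner_Basis[OF b, symmetric]
    by (rule integral_lebesgue_AE_eq) auto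
  moreover have "(LINT x:UNIV|lebesgue. (G x \<bullet> b) * \<phi> x) = (\<integral>x. (G x \<bullet> b) * \<phi> x \<partial>lborel)"
    unfolding set_lebesgue_integral_def
    by (rule integral_lebesgue_AE_eq) auto
  ultimately show "(LINT x:UNIV|lebesgue. f x * frechet_derivative \<phi> (at x) b) = - (LINT x:UNIV|lebesgue. (G x \<bullet> b) * \<phi> x)"
    using weak_pairD(5)[OF w \<phi>, of b] by simp
qed

section \<open>The fractional kernels\<close>

lemma dyadic_bracket:
  assumes "1 \<le> (y::real)"
  shows "\<exists>k::nat. 2 ^ k \<le> y \<and> y < 2 ^ Suc k"
proof -
  obtain n :: nat where n: "y < 2 ^ n" using real_arch_pow[of 2 y] by auto
  define m where "m = (LEAST n. y < (2::real) ^ n)"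
  have m: "y < 2 ^ m" unfolding m_def using n by (rule LeastI)
  obtain k where k: "m = Suc k" using m assms by (cases m) auto
  have "\<not> y < 2 ^ k"
  proof
    assume "y < 2 ^ k"
    then have "m \<le> k" unfolding m_def by (rule Least_le)
    then show False using k by simp
  qed
  then show ?thesis using m k by (intro exI[of _ k]) auto
qed

text \<open>A geometric series of ratio 2^(-\<beta>) diverges like 1 / \<beta> as \<beta> tends to
  0, uniformly for \<beta> <= p; this follows from exp x >= 1 + x. The values \<beta> = p (1 - s)
  and \<beta> = s p produce the singularities in s of the kernel integral.\<close>

lemma geometric_gap:
  assumes "0 < \<beta>" "\<beta> \<le> (p::real)"
  shows "1 / (1 - 2 powr (- \<beta>)) \<le> (1 + p * ln 2) / ln 2 * (1 / \<beta>)"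
proof -
  have l: "0 < ln (2::real)" by simp
  have b: "0 < \<beta> * ln 2" using assms l by simp
  have "2 powr (- \<beta>) = exp (- (\<beta> * ln 2))" by (simp add: powr_def)
  also have "\<dots> \<le> 1 / (1 + \<beta> * ln 2)"
    using exp_ge_add_one_self[of "\<beta> * ln 2"] b by (simp add: exp_minus field_simps)
  finally have le: "\<beta> * ln 2 / (1 + \<beta> * ln 2) \<le> 1 - 2 powr (- \<beta>)"
    using b by (simp add: field_simps)
  have x: "0 < \<beta> * ln 2 / (1 + \<beta> * ln 2)" using b by (intro divide_pos_pos) linarith+
  have "1 / (1 - 2 powr (- \<beta>)) \<le> 1 / (\<beta> * ln 2 / (1 + \<beta> * ln 2))"
    by (rule divide_left_mono[OF le zero_le_one mult_pos_pos[OF less_le_trans[OF x le] x]])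
  also have "\<dots> = (1 + \<beta> * ln 2) / ln 2 * (1 / \<beta>)" by simp
  also have "\<dots> \<le> (1 + p * ln 2) / ln 2 * (1 / \<beta>)"
    using assms l by (intro mult_right_mono divide_right_mono add_left_mono) auto
  finally show ?thesis .
qed

lemma nn_integral_dyadic_sum:
  fixes g :: "'a::euclidean_space \<Rightarrow> ennreal"
  assumes g: "\<And>z. g z \<le> (\<Sum>k. ennreal (c k) * indicator (cball 0 (\<rho> k)) z)"
    and c: "\<And>k. 0 \<le> c k" "\<And>k. 0 \<le> \<rho> k"
    and sum: "\<And>k. c k * \<rho> k ^ DIM('a) \<le> A * q ^ k" and q: "0 \<le> q" "q < 1" and "0 \<le> A"
  shows "(\<integral>\<^sup>+z. g z \<partial>lborel) \<le> ennreal (unit_ball_vol (real DIM('a)) * A * (1 / (1 - q)))"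
proof -
  let ?v = "unit_ball_vol (real DIM('a))"
  have [measurable]: "cball (0::'a) t \<in> sets borel" for t by simp
  have "(\<integral>\<^sup>+z. g z \<partial>lborel) \<le> (\<integral>\<^sup>+z. (\<Sum>k. ennreal (c k) * indicator (cball (0::'a) (\<rho> k)) z) \<partial>lborel)"
    by (rule nn_integral_mono) (rule g)
  also have "\<dots> = (\<Sum>k. \<integral>\<^sup>+z. ennreal (c k) * indicator (cball (0::'a) (\<rho> k)) z \<partial>lborel)"
    by (rule nn_integral_suminf) auto
  also have "\<dots> = (\<Sum>k. ennreal (?v * (c k * \<rho> k ^ DIM('a))))"
    using c by (simp add: nn_integral_cmult emeasure_cball ennreal_mult[symmetric] mult_ac)
  also have "\<dots> \<le> (\<Sum>k. ennreal (?v * A * q ^ k))"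
  proof (rule suminf_le)
    show "ennreal (?v * (c k * \<rho> k ^ DIM('a))) \<le> ennreal (?v * A * q ^ k)" for k
      using mult_left_mono[OF sum[of k], of ?v] by (intro ennreal_leI) (simp add: mult.assoc)
  qed auto
  also have "\<dots> = ennreal (\<Sum>k. ?v * A * q ^ k)"
    using q assms by (intro suminf_ennreal2) (auto intro!: summable_mult summable_geometric)
  also have "(\<Sum>k. ?v * A * q ^ k) = ?v * A * (1 / (1 - q))"
    using q by (simp add: suminf_mult summable_geometric suminf_geometric)
  finally show ?thesis .
qed

lemma le_suminf_single:
  fixes x :: ennreal
  assumes "x \<le> f k"
  shows "x \<le> (\<Sum>k. f k)"
proof -
  have "f k = sum f {k}" by simp
  also have "\<dots> \<le> (\<Sum>k. f k)" by (rule sum_le_suminf) auto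
  finally show ?thesis using assms by order
qed

text \<open>The contribution of the dyadic shell of radius 2^(-t) / L: numerator, kernel and volume,
  with the powers of 2 and of L collected. The next lemma does the same for a shell beyond 1 /
  L.\<close>

lemma powr_collect_inner:
  fixes L :: real
  assumes "0 < L"
  shows "(2 powr (- t)) powr p * (L * (2 * 2 powr t)) powr Q * (1 / (L * 2 powr t)) powr n
    = 2 powr (- t * p + Q + t * Q - t * n) * L powr (Q - n)"
  using assms by (simp add: powr_def ln_mult ln_div exp_add[symmetric] algebra_simps)

lemma powr_collect_outer:
  fixes L :: real
  assumes "0 < L"
  shows "(L / 2 powr t) powr Q * (2 * 2 powr t / L) powr n
    = 2 powr (- t * Q + n + t * n) * L powr (Q - n)"
  using assms by (simp add: powr_def ln_mult ln_div exp_add[symmetric] algebra_simps)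

text \<open>Dyadic shells are summed on both sides of |z| = 1 / L. Inside, the numerator (L |z|)^p
  beats the singularity and the shells have ratio 2^(-p (1 - s)); outside, the decay of the kernel
  gives the ratio 2^(-sp). Both sums carry the scaling factor L^(sp).\<close>

lemma kernel_integral_bound:
  fixes p s L :: real
  assumes p: "1 < p" and s: "0 < s" "s < 1" and L: "1 \<le> L"
  shows "(\<integral>\<^sup>+z. ennreal ((min 1 (L * norm z)) powr p / norm (z::'a::euclidean_space) powr (real DIM('a) + s * p)) \<partial>lborel)
    \<le> ennreal (unit_ball_vol (real DIM('a)) * 2 powr (real DIM('a) + p) * ((1 + p * ln 2) / (p * ln 2)) * L powr p * (1 / (s * (1 - s))))"
proof -
  define N where "N = DIM('a)"
  let ?v = "unit_ball_vol (real N)"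
  define Q where "Q = real N + s * p"
  have Q0: "0 < Q" using p s by (simp add: Q_def N_def add_pos_pos)
  define g where "g z = ennreal ((min 1 (L * norm z)) powr p / norm (z::'a) powr Q)" for z
  have L0: "0 < L" using L by simp
  have QN: "Q - real N = s * p" by (simp add: Q_def)
  have pk: "(2 powr y) ^ k = 2 powr (real k * y)" for y :: real and k :: nat
    by (simp add: powr_realpow[symmetric] powr_powr mult.commute)
  have inner: "(\<integral>\<^sup>+z. g z * indicator {z. L * norm z < 1} z \<partial>lborel)
    \<le> ennreal (?v * (2 powr Q * L powr (s * p)) * (1 / (1 - 2 powr (- (p * (1 - s))))))"
    unfolding N_def
  proof (rule nn_integral_dyadic_sum)
    define c where "c k = (1 / 2 ^ k) powr p * (L * 2 ^ Suc k) powr Q" for k :: nat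
    define \<rho> where "\<rho> k = 1 / (L * 2 ^ k)" for k :: nat
    show "0 \<le> c k" "0 \<le> \<rho> k" for k using L0 by (auto simp: c_def \<rho>_def)
    show "c k * \<rho> k ^ DIM('a) \<le> (2 powr Q * L powr (s * p)) * (2 powr (- (p * (1 - s)))) ^ k" for k
    proof -
      have "c k * \<rho> k ^ DIM('a) = (2 powr (- real k)) powr p * (L * (2 * 2 powr real k)) powr Q * (1 / (L * 2 powr real k)) powr real N"
        using L0 by (simp add: c_def \<rho>_def N_def powr_minus powr_realpow inverse_eq_divide)
      also have "\<dots> = 2 powr (- real k * p + Q + real k * Q - real k * real N) * L powr (Q - real N)"
        by (rule powr_collect_inner[OF L0])
      also have "- real k * p + Q + real k * Q - real k * real N = Q + real k * (- (p * (1 - s)))"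
        by (simp add: Q_def algebra_simps)
      also have "2 powr (Q + real k * (- (p * (1 - s)))) * L powr (Q - real N) = (2 powr Q * L powr (s * p)) * (2 powr (- (p * (1 - s)))) ^ k"
        unfolding pk powr_add QN by (simp only: mult_ac)
      finally show ?thesis by simp
    qed
    fix z :: 'a
    show "g z * indicator {z. L * norm z < 1} z \<le> (\<Sum>k. ennreal (c k) * indicator (cball 0 (\<rho> k)) z)"
    proof (cases "L * norm z < 1 \<and> z \<noteq> 0")
      case True
      then have z: "0 < norm z" "L * norm z < 1" by auto
      have "1 \<le> 1 / (L * norm z)" using z L0 by simp
      then obtain k :: nat where k: "2 ^ k \<le> 1 / (L * norm z)" "1 / (L * norm z) < 2 ^ Suc k"
        using dyadic_bracket by blast
      have a: "L * norm z \<le> 1 / 2 ^ k" using k(1) z L0 by (simp add: field_simps)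
      have b: "1 / norm z \<le> L * 2 ^ Suc k" using k(2) z L0 by (simp add: field_simps)
      have "(min 1 (L * norm z)) powr p / norm z powr Q = (L * norm z) powr p * (1 / norm z) powr Q"
        using z by (simp add: powr_divide min_def)
      also have "\<dots> \<le> c k" unfolding c_def
        using a b z L0 p Q0 by (intro mult_mono powr_mono2) auto
      finally have "g z \<le> ennreal (c k)" unfolding g_def by (rule ennreal_leI)
      moreover have "norm z \<le> \<rho> k" using a L0 by (simp add: \<rho>_def field_simps)
      ultimately have "g z * indicator {z. L * norm z < 1} z \<le> ennreal (c k) * indicator (cball 0 (\<rho> k)) z"
        using z by simp
      then show ?thesis by (rule le_suminf_single)
    next
      case False
      then have zero: "g z * indicator {z. L * norm z < 1} z = 0" using p by (auto simp: g_def)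
      show ?thesis unfolding zero by (rule zero_le)
    qed
    have "2 powr (- (p * (1 - s))) < 2 powr (0::real)" using p s by (intro powr_less_mono) auto
    then show "2 powr (- (p * (1 - s))) < (1::real)" by simp
  qed (use L0 in auto)
  have outer: "(\<integral>\<^sup>+z. g z * indicator {z. 1 \<le> L * norm z} z \<partial>lborel)
    \<le> ennreal (?v * (2 powr Q * L powr (s * p)) * (1 / (1 - 2 powr (- (s * p)))))"
    unfolding N_def
  proof (rule nn_integral_dyadic_sum)
    define c where "c k = (L / 2 ^ k) powr Q" for k :: nat
    define \<rho> where "\<rho> k = 2 ^ Suc k / L" for k :: nat
    show "0 \<le> c k" "0 \<le> \<rho> k" for k using L0 by (auto simp: c_def \<rho>_def)
    show "c k * \<rho> k ^ DIM('a) \<le> (2 powr Q * L powr (s * p)) * (2 powr (- (s * p))) ^ k" for k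
    proof -
      have "c k * \<rho> k ^ DIM('a) = (L / 2 powr real k) powr Q * (2 * 2 powr real k / L) powr real N"
        using L0 by (simp add: c_def \<rho>_def N_def powr_realpow)
      also have "\<dots> = 2 powr (- real k * Q + real N + real k * real N) * L powr (Q - real N)"
        by (rule powr_collect_outer[OF L0])
      also have "- real k * Q + real N + real k * real N = real N + real k * (- (s * p))"
        by (simp add: Q_def algebra_simps)
      also have "2 powr (real N + real k * (- (s * p))) * L powr (Q - real N) = (2 powr real N * L powr (s * p)) * (2 powr (- (s * p))) ^ k"
        unfolding pk powr_add QN by (simp only: mult_ac)
      also have "\<dots> \<le> (2 powr Q * L powr (s * p)) * (2 powr (- (s * p))) ^ k"
        using p s by (intro mult_right_mono powr_mono) (auto simp: Q_def)
      finally show ?thesis .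
    qed
    fix z :: 'a
    show "g z * indicator {z. 1 \<le> L * norm z} z \<le> (\<Sum>k. ennreal (c k) * indicator (cball 0 (\<rho> k)) z)"
    proof (cases "1 \<le> L * norm z")
      case True
      then have z: "0 < norm z" by (cases "z = 0") auto
      obtain k :: nat where k: "2 ^ k \<le> L * norm z" "L * norm z < 2 ^ Suc k"
        using dyadic_bracket[OF True] by blast
      have b: "1 / norm z \<le> L / 2 ^ k" using k(1) z L0 by (simp add: field_simps)
      have "(min 1 (L * norm z)) powr p / norm z powr Q = (1 / norm z) powr Q"
        using True z by (simp add: powr_divide min_def)
      also have "\<dots> \<le> c k" unfolding c_def
        using b z L0 Q0 by (intro powr_mono2) auto
      finally have "g z \<le> ennreal (c k)" unfolding g_def by (rule ennreal_leI)
      moreover have "norm z \<le> \<rho> k" using k(2) L0 by (simp add: \<rho>_def field_simps)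
      ultimately have "g z * indicator {z. 1 \<le> L * norm z} z \<le> ennreal (c k) * indicator (cball 0 (\<rho> k)) z"
        using True by simp
      then show ?thesis by (rule le_suminf_single)
    qed simp
    have "2 powr (- (s * p)) < 2 powr (0::real)" using p s by (intro powr_less_mono) auto
    then show "2 powr (- (s * p)) < (1::real)" by simp
  qed (use L0 in auto)
  have [measurable]: "g \<in> borel_measurable borel" unfolding g_def by measurable
  define w where "w = ?v * (2 powr Q * L powr (s * p))"
  \<comment> \<open>Here L >= 1 and s < 1 remove the dependence on s from L^(sp) and from 2^(N +
    sp).\<close>
  have w: "0 \<le> w" "w \<le> ?v * (2 powr (real N + p) * L powr p)"
    unfolding w_def using L p s by (auto intro!: mult_left_mono mult_mono powr_mono simp: Q_def mult_left_le_one_le)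
  define e where "e = (1 + p * ln 2) / ln 2"
  have e: "0 < e" using p by (simp add: e_def add_pos_pos)
  have "(\<integral>\<^sup>+z. g z \<partial>lborel) = (\<integral>\<^sup>+z. g z * indicator {z. L * norm z < 1} z + g z * indicator {z. 1 \<le> L * norm z} z \<partial>lborel)"
    by (rule nn_integral_cong) (auto simp: indicator_def)
  also have "\<dots> = (\<integral>\<^sup>+z. g z * indicator {z. L * norm z < 1} z \<partial>lborel) + (\<integral>\<^sup>+z. g z * indicator {z. 1 \<le> L * norm z} z \<partial>lborel)"
    by (rule nn_integral_add) measurable
  also have "\<dots> \<le> ennreal (w * (1 / (1 - 2 powr (- (p * (1 - s)))))) + ennreal (w * (1 / (1 - 2 powr (- (s * p)))))"
    unfolding w_def by (rule add_mono[OF inner outer])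
  also have "\<dots> \<le> ennreal (w * (e * (1 / (p * (1 - s))))) + ennreal (w * (e * (1 / (s * p))))"
    unfolding e_def using geometric_gap[of "p * (1 - s)" p] geometric_gap[of "s * p" p] p s w(1)
    by (intro add_mono ennreal_leI mult_left_mono) (auto simp: mult_le_cancel_left1)
  \<comment> \<open>Partial fractions: 1 / s + 1 / (1 - s) = 1 / (s (1 - s)).\<close>
  also have "\<dots> = ennreal (w * (e / p * (1 / (s * (1 - s)))))"
  proof -
    have "w * (e * (1 / (p * (1 - s)))) + w * (e * (1 / (s * p))) = w * (e / p * (1 / (s * (1 - s))))"
      using p s by (simp add: field_simps)
    then show ?thesis using w e p s by (subst ennreal_plus[symmetric]) auto
  qed
  also have "\<dots> \<le> ennreal (?v * (2 powr (real N + p) * L powr p) * (e / p * (1 / (s * (1 - s)))))"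
    using w e p s by (intro ennreal_leI mult_right_mono) auto
  finally show ?thesis unfolding g_def Q_def N_def e_def by (simp add: mult_ac)
qed

text \<open>The factor s (1 - s) is explicit in \<open>C_norm\<close>, and the remaining factor B is
  continuous on [0,1] because the arguments of all the Gamma functions stay positive. Continuity
  also yields measurability in s later.\<close>

lemma C_norm_bound:
  assumes "0 < n" "0 < p"
  shows "\<exists>M. continuous_on {0..1} (C_norm n p) \<and> 0 < M \<and> (\<forall>s\<in>{0<..<1}. 0 \<le> C_norm n p s \<and> C_norm n p s \<le> M * (s * (1 - s)))"
proof -
  define B where "B s = p / 2 * 2 powr (2 * s - 1) / (pi powr ((n - 1) / 2)) * (Gamma ((n + p * s) / 2) / (Gamma ((p + 1) / 2) * Gamma (2 - s)))" for s
  have CB: "C_norm n p s = s * (1 - s) * B s" for s by (simp add: C_norm_def B_def)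
  have cG: "continuous_on {0<..} (Gamma :: real \<Rightarrow> real)"
    by (rule continuous_on_Gamma) (auto elim!: nonpos_Ints_cases)
  have c1: "continuous_on {0..1} (\<lambda>s. Gamma ((n + p * s) / 2))"
    by (rule continuous_on_compose2[OF cG]) (use assms in \<open>auto intro!: continuous_intros add_pos_nonneg\<close>)
  have c2: "continuous_on {0..1} (\<lambda>s. Gamma (2 - s :: real))"
    by (rule continuous_on_compose2[OF cG]) (auto intro!: continuous_intros)
  have G1: "0 < Gamma ((p + 1) / 2)" using assms by (intro Gamma_real_pos) auto
  have G2: "0 < Gamma (2 - s)" if "s \<in> {0..1}" for s :: real using that by (intro Gamma_real_pos) auto
  have G3: "0 < Gamma ((n + p * s) / 2)" if "s \<in> {0..1}" for s
    using that assms by (intro Gamma_real_pos) (auto intro!: add_pos_nonneg)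
  have cB: "continuous_on {0..1} B"
    unfolding B_def
    by (intro continuous_intros c1 c2) (use G1 G2 in \<open>auto simp: less_imp_neq[symmetric]\<close>)
  have B0: "0 \<le> B s" if "s \<in> {0..1}" for s
    unfolding B_def using assms G1 G2[OF that] G3[OF that] by (intro mult_nonneg_nonneg divide_nonneg_nonneg) auto
  obtain x where x: "x \<in> {0..1}" "\<And>s. s \<in> {0..1} \<Longrightarrow> B s \<le> B x"
    using continuous_attains_sup[of "{0..1::real}" B] cB by auto
  have bound: "0 \<le> C_norm n p s \<and> C_norm n p s \<le> (B x + 1) * (s * (1 - s))" if "s \<in> {0<..<1}" for s
  proof -
    have "B s \<le> B x + 1" using x(2)[of s] that by auto
    then have "(s * (1 - s)) * B s \<le> (s * (1 - s)) * (B x + 1)" using that by (intro mult_left_mono) auto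
    then show ?thesis using B0[of s] that by (simp add: CB mult.commute)
  qed
  have "continuous_on {0..1} (C_norm n p)"
    unfolding CB[abs_def] by (intro continuous_intros cB)
  moreover have "0 < B x + 1" using B0[OF x(1)] by simp
  ultimately show ?thesis using bound by (intro exI[of _ "B x + 1"] conjI) auto
qed

section \<open>Pointwise estimates of the interaction\<close>

lemma pow_diff_le:
  fixes t s :: real
  assumes "0 \<le> s" "s \<le> t"
  shows "t ^ n - s ^ n \<le> real n * t ^ (n - 1) * (t - s)"
proof (induction n)
  case (Suc n)
  have "t ^ Suc n - s ^ Suc n = t * (t ^ n - s ^ n) + s ^ n * (t - s)" by (simp add: algebra_simps)
  also have "\<dots> \<le> t * (real n * t ^ (n - 1) * (t - s)) + t ^ n * (t - s)"
    using Suc assms by (intro add_mono mult_left_mono mult_right_mono power_mono) auto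
  also have "\<dots> = real (Suc n) * t ^ n * (t - s)" by (cases n) (auto simp: algebra_simps)
  finally show ?case by simp
qed simp

text \<open>If Y <= Z / 2 the first term on the right is enough, otherwise Z < 2 Y and the second
  one is.\<close>

lemma young_absorb:
  fixes Z Y p :: real
  assumes "1 < p" "0 \<le> Z" "0 \<le> Y"
  shows "Z powr (p - 1) * Y \<le> Z powr p / 2 + 2 powr (p - 1) * Y powr p"
proof (cases "Y \<le> Z / 2")
  case True
  have "Z powr (p - 1) * Y \<le> Z powr (p - 1) * (Z / 2)" using True by (intro mult_left_mono) auto
  also have "\<dots> = Z powr p / 2" using assms powr_add[of Z "p - 1" 1] by (cases "Z = 0") auto
  finally show ?thesis by (simp add: add_increasing2)
next
  case False
  have "Z powr (p - 1) * Y \<le> (2 * Y) powr (p - 1) * Y"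
    using False assms by (intro mult_right_mono powr_mono2) auto
  also have "\<dots> = 2 powr (p - 1) * Y powr p" using assms powr_add[of Y "p - 1" 1] by (cases "Y = 0") (auto simp: powr_mult)
  finally show ?thesis by (simp add: add_increasing)
qed

text \<open>This is what makes \<open>\<phi>\<^sup>n\<close> with an integer \<open>n \<ge> p\<close>, which is smooth, as good a cutoff as \<open>\<phi>\<^sup>p\<close>.\<close>

lemma power_le_powr:
  fixes t p :: real
  assumes t: "0 \<le> t" "t \<le> 1" and p: "1 < p" "p \<le> real n"
  shows "t ^ (n - 1) \<le> (t ^ n) powr ((p - 1) / p)"
proof (cases "t = 0")
  case True
  have "n - 1 \<noteq> 0" using p by auto
  then show ?thesis using True by (simp add: power_0_left)
next
  case False
  then have t0: "0 < t" using t by simp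
  have n: "1 \<le> n" using p by linarith
  have "real n * ((p - 1) / p) \<le> real n - 1"
    using p by (simp add: field_simps)
  then have "t powr real (n - 1) \<le> t powr (real n * ((p - 1) / p))"
    using t0 t n by (intro powr_mono') (auto simp: of_nat_diff)
  then show ?thesis using t0 by (simp add: powr_realpow[symmetric] powr_powr)
qed

text \<open>Here a, b are the values of u and t, s those of the cutoff at two points. The increment
  of the test function is - (a - b) t^n + (l - b) (t^n - s^n). The first summand is coercive and
  absorbs the second by Young's inequality, which leaves only the variation t - s of the
  cutoff.\<close>

lemma interaction_near_aux:
  fixes a b t s l p :: real
  assumes p: "1 < p" "p \<le> real n" and b: "0 \<le> b" "b < a" and t: "0 \<le> t" "t \<le> 1" "0 \<le> s"
  shows "\<bar>a - b\<bar> powr (p - 2) * (a - b) * (t ^ n * max 0 (l - a) - s ^ n * max 0 (l - b))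
    \<le> 2 powr p * real n powr p * l powr p * \<bar>t - s\<bar> powr p * (if a < l \<and> 0 < t then 1 else 0)"
    (is "?T \<le> ?R")
proof -
  have e: "\<bar>a - b\<bar> powr (p - 2) * (a - b) = (a - b) powr (p - 1)"
    using b powr_add[of "a - b" "p - 2" 1] by simp
  have n1: "1 \<le> n" using p by linarith
  show ?thesis
  proof (cases "a < l \<and> s < t")
    case False
    \<comment> \<open>The test function is not larger at the point where u is larger, so the
      interaction has the favourable sign.\<close>
    have "t ^ n * max 0 (l - a) \<le> s ^ n * max 0 (l - b)"
    proof (cases "a < l")
      case True
      then have "t \<le> s" using False by simp
      then show ?thesis using b t by (intro mult_mono power_mono) auto
    qed (use t in simp)
    then have "?T \<le> 0" unfolding e by (simp add: mult_le_0_iff)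
    also have "0 \<le> ?R" by simp
    finally show ?thesis .
  next
    case True
    then have al: "a < l" and st: "s < t" by auto
    have t0: "0 < t" using st t by simp
    \<comment> \<open>Z^p is the coercive quantity (a - b)^p t^n, and Y is the variation of the
      cutoff weighted by l - b.\<close>
    define Z where "Z = (a - b) * (t ^ n) powr (1 / p)"
    define Y where "Y = real n * (l - b) * (t - s)"
    have Z0: "0 \<le> Z" using b by (simp add: Z_def)
    have Y0: "0 \<le> Y" using b al st by (simp add: Y_def)
    have Zp: "Z powr p = (a - b) powr p * t ^ n"
      unfolding Z_def using b p t by (simp add: powr_mult powr_powr)
    have Zp1: "Z powr (p - 1) = (a - b) powr (p - 1) * (t ^ n) powr ((p - 1) / p)"
      unfolding Z_def using b p t by (simp add: powr_mult powr_powr)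
    have "t ^ n * max 0 (l - a) - s ^ n * max 0 (l - b) = - ((a - b) * t ^ n) + (l - b) * (t ^ n - s ^ n)"
      using al b by (simp add: algebra_simps)
    also have "\<dots> \<le> - ((a - b) * t ^ n) + (l - b) * (real n * t ^ (n - 1) * (t - s))"
      using pow_diff_le[of s t n] t st al b by (intro add_left_mono mult_left_mono) auto
    also have "\<dots> = - ((a - b) * t ^ n) + t ^ (n - 1) * Y" by (simp add: Y_def mult_ac)
    also have "\<dots> \<le> - ((a - b) * t ^ n) + (t ^ n) powr ((p - 1) / p) * Y"
      using power_le_powr[OF t(1,2) p] Y0 by (intro add_left_mono mult_right_mono) auto
    finally have "?T \<le> (a - b) powr (p - 1) * (- ((a - b) * t ^ n) + (t ^ n) powr ((p - 1) / p) * Y)"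
      unfolding e by (rule mult_left_mono) simp
    also have "\<dots> = - (Z powr p) + Z powr (p - 1) * Y"
    proof -
      have pe: "(a - b) powr p = (a - b) powr (p - 1) * (a - b)"
        using b powr_add[of "a - b" "p - 1" 1] by simp
      show ?thesis unfolding Zp Zp1 pe by (simp add: algebra_simps)
    qed
    also have "\<dots> \<le> - (Z powr p) + (Z powr p / 2 + 2 powr (p - 1) * Y powr p)"
      using young_absorb[OF p(1) Z0 Y0] by simp
    \<comment> \<open>The remaining - Z^p / 2 is the nonlocal energy, of which only the sign is
      used.\<close>
    also have "\<dots> \<le> 2 powr (p - 1) * Y powr p" by simp
    also have "\<dots> \<le> 2 powr p * (real n * l * (t - s)) powr p"
      using Y0 b al st p unfolding Y_def by (intro mult_mono powr_mono powr_mono2 mult_right_mono mult_left_mono) auto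
    also have "\<dots> = ?R" using al b st t0 n1 by (simp add: powr_mult)
    finally show ?thesis .
  qed
qed

text \<open>The expression is symmetric in the two points, hence one indicator for each of
  them.\<close>

lemma interaction_near:
  fixes a b t s l p :: real
  assumes p: "1 < p" "p \<le> real n" and b: "0 \<le> a" "0 \<le> b" and t: "0 \<le> t" "t \<le> 1" "0 \<le> s" "s \<le> 1"
  shows "\<bar>a - b\<bar> powr (p - 2) * (a - b) * (t ^ n * max 0 (l - a) - s ^ n * max 0 (l - b))
    \<le> 2 powr p * real n powr p * l powr p * \<bar>t - s\<bar> powr p *
      ((if a < l \<and> 0 < t then 1 else 0) + (if b < l \<and> 0 < s then 1 else 0))"
proof -
  have mono: "c * x \<le> c * (x + y)" "c * y \<le> c * (x + y)" if "0 \<le> c" "0 \<le> x" "0 \<le> y" for c x y :: real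
    using that by (auto intro!: mult_left_mono)
  consider "b < a" | "a < b" | "a = b" by linarith
  then show ?thesis
  proof cases
    case 1
    show ?thesis
      by (rule order_trans[OF interaction_near_aux[OF p b(2) 1 t(1-3)] mono(1)]) auto
  next
    case 2
    have eq: "\<bar>a - b\<bar> powr (p - 2) * (a - b) * (t ^ n * max 0 (l - a) - s ^ n * max 0 (l - b))
      = \<bar>b - a\<bar> powr (p - 2) * (b - a) * (s ^ n * max 0 (l - b) - t ^ n * max 0 (l - a))"
      by (simp add: abs_minus_commute algebra_simps)
    show ?thesis unfolding eq
      using order_trans[OF interaction_near_aux[OF p b(1) 2 t(3,4,1)] mono(2)]
      by (simp add: abs_minus_commute[of s t])
  qed simp
qed

text \<open>The second point lies where the test function vanishes. Only b < a < l contributes with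
  a positive sign, and then a - b <= l + b_- <= 2 max l b_-, so negative values of u outside B_R are
  the only source of a tail.\<close>

lemma interaction_far:
  fixes a b t l p :: real
  assumes p: "1 < p" and b: "0 \<le> a" and t: "0 \<le> t" "t \<le> 1" and l: "0 < l"
  shows "\<bar>a - b\<bar> powr (p - 2) * (a - b) * (t ^ n * max 0 (l - a))
    \<le> (if a < l then 2 powr p * (l powr p + l * (max 0 (- b)) powr (p - 1)) else 0)"
proof (cases "a < l \<and> b < a")
  case False
  then consider "l \<le> a" | "a \<le> b" by linarith
  then show ?thesis
  proof cases
    case 2
    then have "\<bar>a - b\<bar> powr (p - 2) * (a - b) * (t ^ n * max 0 (l - a)) \<le> 0"
      using t by (intro mult_nonpos_nonneg mult_nonneg_nonpos) auto
    also have "0 \<le> (if a < l then 2 powr p * (l powr p + l * (max 0 (- b)) powr (p - 1)) else 0)" using l by simp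
    finally show ?thesis .
  qed simp
next
  case True
  define m where "m = max 0 (- b)"
  have e: "\<bar>a - b\<bar> powr (p - 2) * (a - b) = (a - b) powr (p - 1)"
    using True powr_add[of "a - b" "p - 2" 1] by simp
  have "(a - b) powr (p - 1) \<le> (2 * max l m) powr (p - 1)"
    using True b p by (intro powr_mono2) (auto simp: m_def)
  also have "\<dots> = 2 powr (p - 1) * (max l m) powr (p - 1)" using l by (simp add: powr_mult)
  also have "\<dots> \<le> 2 powr p * (l powr (p - 1) + m powr (p - 1))"
    by (intro mult_mono powr_mono) (auto simp: max_def)
  finally have 1: "(a - b) powr (p - 1) \<le> 2 powr p * (l powr (p - 1) + m powr (p - 1))" .
  have 2: "t ^ n * max 0 (l - a) \<le> 1 * l" using t b l by (intro mult_mono power_le_one) auto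
  have "(a - b) powr (p - 1) * (t ^ n * max 0 (l - a)) \<le> (2 powr p * (l powr (p - 1) + m powr (p - 1))) * (1 * l)"
    by (rule mult_mono[OF 1 2]) (use t in auto)
  also have "\<dots> = 2 powr p * (l powr p + l * m powr (p - 1))"
    using l powr_add[of l "p - 1" 1] by (simp add: algebra_simps)
  finally show ?thesis using True unfolding e m_def by simp
qed

section \<open>The Caccioppoli inequality\<close>

text \<open>Bochner integrals of non-integrable functions are \<open>0\<close>, so no integrability is assumed. This is why
  neither the nonlocal form nor its integral over \<open>s\<close> needs to be shown to converge.\<close>

lemma ennreal_integral_le_nn_integral:
  fixes f :: "'a \<Rightarrow> real"
  shows "ennreal (integral\<^sup>L M f) \<le> (\<integral>\<^sup>+x. ennreal (f x) \<partial>M)"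
proof (cases "integrable M f")
  case True
  then have i: "integrable M (\<lambda>x. max 0 (f x))" by simp
  have "integral\<^sup>L M f \<le> (\<integral>x. max 0 (f x) \<partial>M)" using True i by (intro integral_mono) auto
  then have "ennreal (integral\<^sup>L M f) \<le> ennreal (\<integral>x. max 0 (f x) \<partial>M)" by (rule ennreal_leI)
  also have "\<dots> = (\<integral>\<^sup>+x. ennreal (max 0 (f x)) \<partial>M)"
    using i by (intro nn_integral_eq_integral[symmetric]) auto
  also have "\<dots> = (\<integral>\<^sup>+x. ennreal (f x) \<partial>M)"
    by (intro nn_integral_cong) (auto simp: max_def ennreal_neg)
  finally show ?thesis .
qed (simp add: not_integrable_integral_eq)

lemma AE_lborel_prod:
  fixes P :: "'a::euclidean_space \<Rightarrow> bool"
  assumes "AE x in lborel. P x"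
  shows "AE z in (lborel :: ('a \<times> 'a) measure). P (fst z) \<and> P (snd z)"
proof -
  obtain N where N: "N \<in> null_sets lborel" "{x. \<not> P x} \<subseteq> N"
    using assms by (auto elim!: AE_E simp: null_sets_def)
  then have Nb: "N \<in> sets borel" and N0: "emeasure lborel N = 0" by auto
  have "N \<times> UNIV \<in> null_sets (lborel \<Otimes>\<^sub>M (lborel :: 'a measure))" "UNIV \<times> N \<in> null_sets ((lborel :: 'a measure) \<Otimes>\<^sub>M lborel)"
    using Nb N0 by (auto simp: null_sets_def lborel.emeasure_pair_measure_Times)
  then have 1: "AE z in lborel \<Otimes>\<^sub>M (lborel :: 'a measure). z \<notin> N \<times> UNIV" "AE z in (lborel :: 'a measure) \<Otimes>\<^sub>M lborel. z \<notin> UNIV \<times> N"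
    by (auto intro: AE_not_in)
  have "AE z in lborel \<Otimes>\<^sub>M (lborel :: 'a measure). P (fst z) \<and> P (snd z)"
    using 1 by eventually_elim (use N(2) in auto)
  then show ?thesis by (simp only: lborel_prod)
qed

text \<open>The integrand is majorized by h x y + h y x, where h is the indicator of the sublevel
  set in x times a kernel of x - y plus a tail density in y. Integrating in y first gives a number
  independent of x, so the measure of the sublevel set factors out. When both points lie outside
  B_R, both values of v vanish.\<close>

lemma nonlocal_bound:
  fixes u U v :: "'a::euclidean_space \<Rightarrow> real"
  assumes p: "1 < p" "p \<le> real n" and s: "0 < s" "s < 1"
    and [measurable]: "U \<in> borel_measurable borel" and ae: "AE x in lborel. u x = U x"
    and U: "\<And>x. x \<in> ball x\<^sub>0 R \<Longrightarrow> 0 \<le> U x"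
    and l: "0 < l" and b: "b \<le> 8 * r" "16 * r < R" "0 < r"
    and \<phi>: "cutoff x\<^sub>0 a b L \<phi>" and L: "1 \<le> L * (8 * r)"
    and v: "\<And>x. v x = \<phi> x ^ n * max 0 (l - U x)"
  defines "Q \<equiv> real DIM('a) + s * p"
  shows "(\<integral>\<^sup>+z. ennreal (case z of (x, y) \<Rightarrow>
        \<bar>u x - u y\<bar> powr (p - 2) * (u x - u y) * (v x - v y) / norm (x - y) powr (real DIM('a) + s * p)) \<partial>(lebesgue :: ('a \<times> 'a) measure))
    \<le> 2 * emeasure lborel (ball x\<^sub>0 b \<inter> {x. U x < l}) *
      (ennreal (2 powr p * real n powr p * l powr p) * (\<integral>\<^sup>+z. ennreal ((min 1 (L * norm (z::'a))) powr p / norm z powr Q) \<partial>lborel)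
       + ennreal (2 powr p * 2 powr (real DIM('a) + p) * l) *
         (\<integral>\<^sup>+y. indicator (- ball x\<^sub>0 R) y * ennreal ((max 0 (- U y)) powr (p - 1) / norm (y - x\<^sub>0) powr Q) \<partial>lborel))"
proof -
  define A where "A = ball x\<^sub>0 b \<inter> {x. U x < l}"
  have [measurable]: "A \<in> sets borel" unfolding A_def by measurable
  define kr where "kr z = (min 1 (L * norm z)) powr p / norm z powr Q" for z :: 'a
  define wr where "wr y = indicator (- ball x\<^sub>0 R) y * ((max 0 (- U y)) powr (p - 1) / norm (y - x\<^sub>0) powr Q)" for y
  have [measurable]: "ball x\<^sub>0 R \<in> sets borel" by simp
  have [measurable]: "kr \<in> borel_measurable borel" "wr \<in> borel_measurable borel"
    unfolding kr_def wr_def by measurable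
  define c1 where "c1 = 2 powr p * real n powr p * l powr p"
  define c2 where "c2 = 2 powr p * 2 powr (real DIM('a) + p) * l"
  have c: "0 \<le> c1" "0 \<le> c2" using l by (auto simp: c1_def c2_def)
  \<comment> \<open>\<open>kr\<close> controls the variation of the cutoff, \<open>wr\<close> the
    negative part of u outside B_R.\<close>
  define h where "h x y = indicator A x * (c1 * kr (x - y) + c2 * wr y)" for x y
  have kr0: "0 \<le> kr z" and wr0: "0 \<le> wr y" for z y by (auto simp: kr_def wr_def)
  have h0: "0 \<le> h x y" for x y unfolding h_def using c kr0 wr0 by simp
  have krs: "kr (x - y) = kr (y - x)" for x y by (simp add: kr_def norm_minus_commute)
  have Q0: "0 < Q" using p s by (simp add: Q_def add_pos_pos)
  have n0: "0 < n" "1 \<le> real n" using p by linarith+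
  have \<phi>1: "0 \<le> \<phi> x" "\<phi> x \<le> 1" "x \<notin> ball x\<^sub>0 b \<Longrightarrow> \<phi> x = 0" "norm (grad \<phi> x) \<le> L" and sm: "smooth \<phi>" for x
    using \<phi> by (auto simp: cutoff_def)
  have L0: "0 < L" using L b by (metis less_le_trans mult_pos_pos zero_less_mult_pos2 zero_less_numeral zero_less_one)
  have v0: "v x = 0" if "x \<notin> ball x\<^sub>0 R" for x
    using that \<phi>1(3)[of x] b n0 by (auto simp: v)
  define F where "F x y = \<bar>U x - U y\<bar> powr (p - 2) * (U x - U y) * (v x - v y) / norm (x - y) powr Q" for x y
  have Fs: "F x y = F y x" for x y
    unfolding F_def norm_minus_commute[of x y] abs_minus_commute[of "U x" "U y"] by (simp add: algebra_simps)
  have main: "F x y \<le> h x y + h y x" if x: "x \<in> ball x\<^sub>0 R" for x y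
  proof (cases "y \<in> ball x\<^sub>0 R")
    case True
    have "\<bar>\<phi> x - \<phi> y\<bar> \<le> L * norm (x - y)" by (rule smooth_lipschitz[OF sm \<phi>1(4)])
    moreover have "\<bar>\<phi> x - \<phi> y\<bar> \<le> 1" using \<phi>1(1,2)[of x] \<phi>1(1,2)[of y] by linarith
    ultimately have m: "\<bar>\<phi> x - \<phi> y\<bar> powr p \<le> (min 1 (L * norm (x - y))) powr p"
      using p by (intro powr_mono2) auto
    have i: "(if U x < l \<and> 0 < \<phi> x then 1 else 0) \<le> (indicator A x :: real)" for x
      using \<phi>1(3)[of x] by (auto simp: A_def indicator_def)
    have "\<bar>U x - U y\<bar> powr (p - 2) * (U x - U y) * (v x - v y)
      \<le> 2 powr p * real n powr p * l powr p * \<bar>\<phi> x - \<phi> y\<bar> powr p *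
      ((if U x < l \<and> 0 < \<phi> x then 1 else 0) + (if U y < l \<and> 0 < \<phi> y then 1 else 0))"
      unfolding v by (rule interaction_near[OF p]) (use U x True \<phi>1 in auto)
    also have "\<dots> \<le> 2 powr p * real n powr p * l powr p * (min 1 (L * norm (x - y))) powr p * (indicator A x + indicator A y)"
      using m i[of x] i[of y] by (intro mult_mono add_mono mult_left_mono) auto
    finally have "F x y \<le> c1 * (min 1 (L * norm (x - y))) powr p * (indicator A x + indicator A y) / norm (x - y) powr Q"
      unfolding F_def c1_def by (rule divide_right_mono) simp
    also have "\<dots> = indicator A x * (c1 * kr (x - y)) + indicator A y * (c1 * kr (y - x))"
      unfolding krs[of y x] by (simp add: kr_def add_divide_distrib algebra_simps)
    also have "\<dots> \<le> h x y + h y x"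
      unfolding h_def using c wr0 by (intro add_mono mult_left_mono) auto
    finally show ?thesis .
  next
    case False
    show ?thesis
    proof (cases "\<phi> x = 0")
      case True
      then have "v x = 0" using n0(1) by (simp add: v power_0_left)
      then have "F x y = 0" using v0[OF False] by (simp add: F_def)
      then show ?thesis using h0 by (simp add: add_nonneg_nonneg)
    next
      case nz: False
      then have xb: "x \<in> ball x\<^sub>0 b" using \<phi>1(3) by blast
      have d1: "norm (x - x\<^sub>0) < 8 * r" using xb b by (simp add: dist_norm norm_minus_commute)
      have d2: "R \<le> norm (y - x\<^sub>0)" using False by (simp add: dist_norm norm_minus_commute)
      have d3: "norm (y - x\<^sub>0) \<le> norm (x - y) + norm (x - x\<^sub>0)"
        using norm_triangle_ineq[of "y - x" "x - x\<^sub>0"] by (simp add: norm_minus_commute)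
      \<comment> \<open>From |x - \<open>x\<^sub>0\<close>| < 8r and |y - \<open>x\<^sub>0\<close>|
        >= R > 16r: the distance of x and y is at least half that of y and \<open>x\<^sub>0\<close>,
        so the kernel may be recentred at the cost of 2^Q.\<close>
      have d4: "8 * r \<le> norm (x - y)" "norm (y - x\<^sub>0) \<le> 2 * norm (x - y)" using d1 d2 d3 b by linarith+
      have pos: "0 < norm (x - y)" "0 < norm (y - x\<^sub>0)" using d4 d2 b by linarith+
      \<comment> \<open>At such distances the minimum in \<open>kr\<close> equals 1, so that the
        part l^p of the far interaction is covered by the same kernel as the near one.\<close>
      have "1 \<le> L * norm (x - y)" using L mult_left_mono[OF d4(1), of L] L0 by linarith
      then have kr1: "kr (x - y) = 1 / norm (x - y) powr Q" by (simp add: kr_def min_def)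
      have "\<bar>U x - U y\<bar> powr (p - 2) * (U x - U y) * (v x - v y)
        \<le> (if U x < l then 2 powr p * (l powr p + l * (max 0 (- U y)) powr (p - 1)) else 0)"
        unfolding v0[OF False] diff_0_right unfolding v
        by (rule interaction_far[OF p(1)]) (use U x \<phi>1 l in auto)
      also have "\<dots> = indicator A x * (2 powr p * l powr p + 2 powr p * l * (max 0 (- U y)) powr (p - 1))"
        using xb by (auto simp: A_def algebra_simps)
      finally have "F x y \<le> indicator A x * (2 powr p * l powr p + 2 powr p * l * (max 0 (- U y)) powr (p - 1)) / norm (x - y) powr Q"
        unfolding F_def by (rule divide_right_mono) simp
      also have "\<dots> = indicator A x * (2 powr p * l powr p * kr (x - y) + 2 powr p * l * ((max 0 (- U y)) powr (p - 1) * (1 / norm (x - y) powr Q)))"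
        unfolding kr1 by (cases "x \<in> A") (simp_all add: add_divide_distrib)
      also have "\<dots> \<le> indicator A x * (c1 * kr (x - y) + c2 * wr y)"
      proof (intro mult_left_mono add_mono)
        show "2 powr p * l powr p * kr (x - y) \<le> c1 * kr (x - y)"
          unfolding c1_def using n0 p kr0 ge_one_powr_ge_zero[of "real n" p]
          by (intro mult_right_mono) (auto simp: mult_le_cancel_left1)
        have "1 / norm (x - y) powr Q \<le> 2 powr Q / norm (y - x\<^sub>0) powr Q"
        proof -
          have "norm (y - x\<^sub>0) powr Q \<le> (2 * norm (x - y)) powr Q"
            using d4 Q0 by (intro powr_mono2) auto
          then show ?thesis using pos by (simp add: powr_mult field_simps)
        qed
        also have "\<dots> \<le> 2 powr (real DIM('a) + p) / norm (y - x\<^sub>0) powr Q"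
          using p s by (intro divide_right_mono powr_mono) (auto simp: Q_def)
        finally have "(max 0 (- U y)) powr (p - 1) * (1 / norm (x - y) powr Q)
           \<le> (max 0 (- U y)) powr (p - 1) * (2 powr (real DIM('a) + p) / norm (y - x\<^sub>0) powr Q)"
          by (rule mult_left_mono) simp
        also have "\<dots> = 2 powr (real DIM('a) + p) * wr y" using False by (simp add: wr_def)
        finally have "2 powr p * l * ((max 0 (- U y)) powr (p - 1) * (1 / norm (x - y) powr Q)) \<le> 2 powr p * l * (2 powr (real DIM('a) + p) * wr y)"
          using l by (intro mult_left_mono) auto
        then show "2 powr p * l * ((max 0 (- U y)) powr (p - 1) * (1 / norm (x - y) powr Q)) \<le> c2 * wr y"
          by (simp add: c2_def mult_ac)
      qed auto
      also have "\<dots> \<le> h x y + h y x" using h0[of y x] by (simp add: h_def)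
      finally show ?thesis .
    qed
  qed
  have Fh: "F x y \<le> h x y + h y x" for x y
  proof -
    consider "x \<in> ball x\<^sub>0 R" | "y \<in> ball x\<^sub>0 R" | "x \<notin> ball x\<^sub>0 R" "y \<notin> ball x\<^sub>0 R" by blast
    then show ?thesis
    proof cases
      case 1 then show ?thesis by (rule main)
    next
      case 2 then show ?thesis using main[of y x] by (simp add: Fs[of x y])
    next
      case 3 then show ?thesis using v0 h0[of x y] h0[of y x] by (simp add: F_def)
    qed
  qed
  have hm [measurable]: "(\<lambda>z. h (fst z) (snd z)) \<in> borel_measurable (borel \<Otimes>\<^sub>M borel)"
    unfolding h_def by measurable
  have hm2 [measurable]: "(\<lambda>z. h (snd z) (fst z)) \<in> borel_measurable (borel \<Otimes>\<^sub>M borel)"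
    unfolding h_def by measurable
  define I where "I = (\<integral>\<^sup>+x. \<integral>\<^sup>+y. ennreal (h x y) \<partial>lborel \<partial>lborel)"
  have I: "I = emeasure lborel A * (ennreal c1 * (\<integral>\<^sup>+z. ennreal (kr z) \<partial>lborel) + ennreal c2 * (\<integral>\<^sup>+y. ennreal (wr y) \<partial>lborel))"
  proof -
    have inner: "(\<integral>\<^sup>+y. ennreal (h x y) \<partial>lborel) = indicator A x * (ennreal c1 * (\<integral>\<^sup>+z. ennreal (kr z) \<partial>lborel) + ennreal c2 * (\<integral>\<^sup>+y. ennreal (wr y) \<partial>lborel))" for x
    proof -
      have "(\<integral>\<^sup>+y. ennreal (h x y) \<partial>lborel) = (\<integral>\<^sup>+y. indicator A x * (ennreal c1 * ennreal (kr (y + - x)) + ennreal c2 * ennreal (wr y)) \<partial>lborel)"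
        using c kr0 wr0 unfolding h_def krs[of x]
        by (intro nn_integral_cong) (auto simp: indicator_def ennreal_mult)
      also have "\<dots> = indicator A x * ((\<integral>\<^sup>+y. ennreal c1 * ennreal (kr (y + - x)) \<partial>lborel) + (\<integral>\<^sup>+y. ennreal c2 * ennreal (wr y) \<partial>lborel))"
        by (subst nn_integral_cmult, simp, subst nn_integral_add) simp_all
      also have "(\<integral>\<^sup>+y. ennreal c1 * ennreal (kr (y + - x)) \<partial>lborel) = ennreal c1 * (\<integral>\<^sup>+z. ennreal (kr z) \<partial>lborel)"
        using nn_integral_shift[of "\<lambda>z. ennreal (kr z)" "- x"] by (subst nn_integral_cmult) simp_all
      also have "(\<integral>\<^sup>+y. ennreal c2 * ennreal (wr y) \<partial>lborel) = ennreal c2 * (\<integral>\<^sup>+y. ennreal (wr y) \<partial>lborel)"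
        by (subst nn_integral_cmult) simp_all
      finally show ?thesis .
    qed
    show ?thesis unfolding I_def inner by (subst nn_integral_multc) simp_all
  qed
  have "(\<integral>\<^sup>+z. ennreal (case z of (x, y) \<Rightarrow>
        \<bar>u x - u y\<bar> powr (p - 2) * (u x - u y) * (v x - v y) / norm (x - y) powr (real DIM('a) + s * p)) \<partial>(lebesgue :: ('a \<times> 'a) measure))
     = (\<integral>\<^sup>+z. ennreal (case z of (x, y) \<Rightarrow>
        \<bar>u x - u y\<bar> powr (p - 2) * (u x - u y) * (v x - v y) / norm (x - y) powr Q) \<partial>(lborel :: ('a \<times> 'a) measure))"
    by (simp add: nn_integral_completion Q_def)
  also have "\<dots> \<le> (\<integral>\<^sup>+z. ennreal (h (fst z) (snd z)) + ennreal (h (snd z) (fst z)) \<partial>(lborel :: ('a \<times> 'a) measure))"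
  proof (rule nn_integral_mono_AE)
    show "AE z in (lborel :: ('a \<times> 'a) measure). ennreal (case z of (x, y) \<Rightarrow>
        \<bar>u x - u y\<bar> powr (p - 2) * (u x - u y) * (v x - v y) / norm (x - y) powr Q)
      \<le> ennreal (h (fst z) (snd z)) + ennreal (h (snd z) (fst z))"
      using AE_lborel_prod[OF ae]
    proof eventually_elim
      fix z :: "'a \<times> 'a" assume "u (fst z) = U (fst z) \<and> u (snd z) = U (snd z)"
      then have "(case z of (x, y) \<Rightarrow> \<bar>u x - u y\<bar> powr (p - 2) * (u x - u y) * (v x - v y) / norm (x - y) powr Q) = F (fst z) (snd z)"
        by (simp add: F_def case_prod_beta)
      also have "ennreal \<dots> \<le> ennreal (h (fst z) (snd z) + h (snd z) (fst z))" by (rule ennreal_leI[OF Fh])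
      also have "\<dots> = ennreal (h (fst z) (snd z)) + ennreal (h (snd z) (fst z))" by (rule ennreal_plus[OF h0 h0])
      finally show "ennreal (case z of (x, y) \<Rightarrow>
          \<bar>u x - u y\<bar> powr (p - 2) * (u x - u y) * (v x - v y) / norm (x - y) powr Q)
        \<le> ennreal (h (fst z) (snd z)) + ennreal (h (snd z) (fst z))" .
    qed
  qed
  also have "\<dots> = (\<integral>\<^sup>+z. ennreal (h (fst z) (snd z)) + ennreal (h (snd z) (fst z)) \<partial>(lborel \<Otimes>\<^sub>M lborel))"
    by (simp add: lborel_prod)
  also have "\<dots> = (\<integral>\<^sup>+z. ennreal (h (fst z) (snd z)) \<partial>(lborel \<Otimes>\<^sub>M lborel)) + (\<integral>\<^sup>+z. ennreal (h (snd z) (fst z)) \<partial>(lborel \<Otimes>\<^sub>M lborel))"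
    by (rule nn_integral_add) simp_all
  also have "(\<integral>\<^sup>+z. ennreal (h (fst z) (snd z)) \<partial>(lborel \<Otimes>\<^sub>M lborel)) = I"
    unfolding I_def by (subst lborel.nn_integral_fst[symmetric]) simp_all
  also have "(\<integral>\<^sup>+z. ennreal (h (snd z) (fst z)) \<partial>(lborel \<Otimes>\<^sub>M lborel)) = (\<integral>\<^sup>+x. \<integral>\<^sup>+y. ennreal (h y x) \<partial>lborel \<partial>lborel)"
    by (subst lborel.nn_integral_fst[symmetric]) simp_all
  also have "(\<integral>\<^sup>+x. \<integral>\<^sup>+y. ennreal (h y x) \<partial>lborel \<partial>lborel) = I"
    unfolding I_def by (rule lborel_pair.Fubini') (simp add: case_prod_beta)
  also have "I + I = 2 * emeasure lborel A * (ennreal c1 * (\<integral>\<^sup>+z. ennreal (kr z) \<partial>lborel) + ennreal c2 * (\<integral>\<^sup>+y. ennreal (wr y) \<partial>lborel))"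
    unfolding I by (simp add: mult_2 mult.assoc distrib_right)
  also have "(\<integral>\<^sup>+y. ennreal (wr y) \<partial>lborel)
    = (\<integral>\<^sup>+y. indicator (- ball x\<^sub>0 R) y * ennreal ((max 0 (- U y)) powr (p - 1) / norm (y - x\<^sub>0) powr Q) \<partial>lborel)"
    by (intro nn_integral_cong) (auto simp: wr_def indicator_def)
  finally show ?thesis unfolding A_def c1_def c2_def kr_def by simp
qed

section \<open>The energy of the p-Laplacian\<close>

lemma truncation_grad_bound:
  fixes f :: "'a::euclidean_space \<Rightarrow> real"
  assumes p: "1 < p" "p \<le> real n" and \<phi>: "cutoff x\<^sub>0 a b L \<phi>" and l: "0 < l"
    and f0: "\<And>x. x \<in> ball x\<^sub>0 b \<Longrightarrow> 0 \<le> f x"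
  shows "x \<notin> ball x\<^sub>0 b \<Longrightarrow> grad (\<lambda>x. \<phi> x ^ n) x = 0"
    "norm (grad (\<lambda>x. \<phi> x ^ n) x) \<le> real n * \<phi> x ^ (n - 1) * L"
    "norm (max 0 (l - f x) *\<^sub>R grad (\<lambda>x. \<phi> x ^ n) x - (\<phi> x ^ n * indicator {x. f x < l} x) *\<^sub>R G x)
      \<le> indicator (ball x\<^sub>0 b) x * (l * (real n * L) + norm (G x))"
proof -
  have \<phi>1: "0 \<le> \<phi> x" "\<phi> x \<le> 1" "x \<notin> ball x\<^sub>0 b \<Longrightarrow> \<phi> x = 0" "norm (grad \<phi> x) \<le> L" and sm: "smooth \<phi>" for x
    using \<phi> by (auto simp: cutoff_def)
  have L0: "0 \<le> L" using \<phi>1(4)[of x] norm_ge_zero[of "grad \<phi> x"] by linarith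
  have n: "2 \<le> n" using p by linarith
  note gp = grad_power[OF sm, of n]
  show out: "grad (\<lambda>x. \<phi> x ^ n) x = 0" if "x \<notin> ball x\<^sub>0 b"
    using \<phi>1(3)[OF that] n by (simp add: gp power_0_left)
  have "norm (grad (\<lambda>x. \<phi> x ^ n) x) = (real n * \<phi> x ^ (n - 1)) * norm (grad \<phi> x)"
    using \<phi>1(1)[of x] by (simp add: gp)
  also have "\<dots> \<le> (real n * \<phi> x ^ (n - 1)) * L"
    using \<phi>1 by (intro mult_left_mono) auto
  finally show g: "norm (grad (\<lambda>x. \<phi> x ^ n) x) \<le> real n * \<phi> x ^ (n - 1) * L" .
  let ?D = "max 0 (l - f x) *\<^sub>R grad (\<lambda>x. \<phi> x ^ n) x - (\<phi> x ^ n * indicator {x. f x < l} x) *\<^sub>R G x"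
  show "norm ?D \<le> indicator (ball x\<^sub>0 b) x * (l * (real n * L) + norm (G x))"
  proof (cases "x \<in> ball x\<^sub>0 b")
    case True
    have "norm ?D \<le> norm (max 0 (l - f x) *\<^sub>R grad (\<lambda>x. \<phi> x ^ n) x) + norm ((\<phi> x ^ n * indicator {x. f x < l} x) *\<^sub>R G x)"
      by (rule norm_triangle_ineq4)
    also have "\<dots> \<le> l * (real n * L) + 1 * norm (G x)"
    proof (rule add_mono)
      have "real n * \<phi> x ^ (n - 1) * L \<le> real n * 1 * L"
        using \<phi>1 L0 by (intro mult_right_mono mult_left_mono power_le_one) auto
      then have "norm (grad (\<lambda>x. \<phi> x ^ n) x) \<le> real n * L" using g by simp
      then show "norm (max 0 (l - f x) *\<^sub>R grad (\<lambda>x. \<phi> x ^ n) x) \<le> l * (real n * L)"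
        unfolding norm_scaleR using l f0[OF True] by (intro mult_mono) auto
      have "\<phi> x ^ n \<le> 1" using \<phi>1 by (intro power_le_one) auto
      then show "norm ((\<phi> x ^ n * indicator {x. f x < l} x) *\<^sub>R G x) \<le> 1 * norm (G x)"
        unfolding norm_scaleR using \<phi>1(1)[of x] by (intro mult_right_mono) (auto simp: indicator_def)
    qed
    finally show ?thesis using True by simp
  next
    case False
    have "?D = 0" using out[OF False] \<phi>1(3)[OF False] n by (simp add: power_0_left)
    then show ?thesis using False by simp
  qed
qed

lemma powr_add_le:
  fixes a b p :: real
  assumes "0 < p" "0 \<le> a" "0 \<le> b"
  shows "(a + b) powr p \<le> 2 powr p * (a powr p + b powr p)"
proof -
  have "(a + b) powr p \<le> (2 * max a b) powr p" using assms by (intro powr_mono2) auto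
  also have "\<dots> = 2 powr p * (max a b) powr p" using assms by (simp add: powr_mult)
  also have "\<dots> \<le> 2 powr p * (a powr p + b powr p)" by (intro mult_left_mono) (auto simp: max_def)
  finally show ?thesis .
qed

text \<open>The local counterpart of \<open>interaction_near_aux\<close>: G . D consists of -
  \<phi>^n |G|^2 on {f < l} and a term with the gradient of the cutoff, which Young's inequality
  absorbs for Z = |G| \<phi>^(n/p) and Y = n l L. This time the remaining half of the coercive term
  is kept: it is the energy to be estimated.\<close>

lemma local_bound:
  fixes f :: "'a::euclidean_space \<Rightarrow> real" and G :: "'a \<Rightarrow> 'a"
  assumes p: "1 < p" "p \<le> real n" and \<phi>: "cutoff x\<^sub>0 a b L \<phi>" and l: "0 < l"
    and f0: "\<And>x. x \<in> ball x\<^sub>0 b \<Longrightarrow> 0 \<le> f x"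
    and [measurable]: "f \<in> borel_measurable borel" "G \<in> borel_measurable borel"
    and iG: "integrable lborel (\<lambda>x. indicator (ball x\<^sub>0 b) x * norm (G x) powr p)"
  defines "D \<equiv> \<lambda>x. max 0 (l - f x) *\<^sub>R grad (\<lambda>x. \<phi> x ^ n) x - (\<phi> x ^ n * indicator {x. f x < l} x) *\<^sub>R G x"
  shows "integrable lborel (\<lambda>x. norm (D x) powr p)" (is ?D)
    and "integrable lborel (\<lambda>x. \<phi> x ^ n * indicator {x. f x < l} x * norm (G x) powr p)" (is ?E)
    and "(\<integral>x. norm (G x) powr (p - 2) * (G x \<bullet> D x) \<partial>lborel)
      \<le> - (1 / 2) * (\<integral>x. \<phi> x ^ n * indicator {x. f x < l} x * norm (G x) powr p \<partial>lborel)
        + 2 powr (p - 1) * (real n * l * L) powr p * measure lborel (ball x\<^sub>0 b \<inter> {x. f x < l})" (is ?I)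
proof -
  have \<phi>1: "0 \<le> \<phi> x" "\<phi> x \<le> 1" "x \<notin> ball x\<^sub>0 b \<Longrightarrow> \<phi> x = 0" and sm: "smooth \<phi>" for x
    using \<phi> by (auto simp: cutoff_def)
  have L0: "0 \<le> L" using \<phi> norm_ge_zero[of "grad \<phi> x\<^sub>0"] unfolding cutoff_def by (meson order_trans)
  have n: "2 \<le> n" using p by linarith
  note [measurable] = smooth_measurable[OF sm] smooth_grad_measurable[OF smooth_power[OF sm, of n]]
  have [measurable]: "ball x\<^sub>0 b \<in> sets borel" "{x. f x < l} \<in> sets borel" by measurable
  have [measurable]: "D \<in> borel_measurable borel" unfolding D_def by measurable
  note tb = truncation_grad_bound[OF p \<phi> l f0]
  have tb2: "norm (grad (\<lambda>x. \<phi> x ^ n) x) \<le> real n * \<phi> x ^ (n - 1) * L" for x by (rule tb(2))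
  have Db: "norm (D x) \<le> indicator (ball x\<^sub>0 b) x * (l * (real n * L) + norm (G x))" for x
    unfolding D_def by (rule tb(3))
  have ib: "integrable lborel (indicator (ball x\<^sub>0 b) :: 'a \<Rightarrow> real)"
    using emeasure_lborel_ball_finite[of x\<^sub>0 b] by simp
  define m where "m x = 2 powr p * ((l * (real n * L)) powr p * indicator (ball x\<^sub>0 b) x + indicator (ball x\<^sub>0 b) x * norm (G x) powr p)" for x
  have im: "integrable lborel m" unfolding m_def using ib iG by simp
  have Dm: "norm (D x) powr p \<le> m x" for x
  proof (cases "x \<in> ball x\<^sub>0 b")
    case True
    have "norm (D x) powr p \<le> (l * (real n * L) + norm (G x)) powr p"
      using Db[of x] True p by (intro powr_mono2) auto
    also have "\<dots> \<le> m x" using powr_add_le[of p "l * (real n * L)" "norm (G x)"] p l L0 True by (simp add: m_def)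
    finally show ?thesis .
  next
    case False
    then show ?thesis using Db[of x] p by (simp add: m_def)
  qed
  have m0: "0 \<le> m x" for x by (simp add: m_def)
  show iD: ?D
    by (rule Bochner_Integration.integrable_bound[OF im]) (use Dm m0 in \<open>auto intro!: AE_I2\<close>)
  have Eb: "0 \<le> \<phi> x ^ n * indicator {x. f x < l} x" "\<phi> x ^ n * indicator {x. f x < l} x \<le> indicator (ball x\<^sub>0 b) x" for x
    using \<phi>1(1,2)[of x] \<phi>1(3)[of x] n by (auto simp: indicator_def power_le_one power_0_left)
  show iE: ?E
  proof (rule Bochner_Integration.integrable_bound[OF iG])
    show "AE x in lborel. norm (\<phi> x ^ n * indicator {x. f x < l} x * norm (G x) powr p) \<le> norm (indicator (ball x\<^sub>0 b) x * norm (G x) powr p)"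
    proof (rule AE_I2)
      fix x show "norm (\<phi> x ^ n * indicator {x. f x < l} x * norm (G x) powr p) \<le> norm (indicator (ball x\<^sub>0 b) x * norm (G x) powr p)"
        unfolding norm_mult using Eb[of x] by (intro mult_right_mono) auto
    qed
  qed measurable
  \<comment> \<open>Also valid for G x = 0 and p < 2, since powers of 0 are 0 by convention.\<close>
  have Gp1: "norm (G x) powr (p - 2) * norm (G x) = norm (G x) powr (p - 1)" for x
    using powr_add[of "norm (G x)" "p - 2" 1] by (cases "G x = 0") auto
  have Gp: "norm (G x) powr (p - 1) * norm (G x) = norm (G x) powr p" for x
    using powr_add[of "norm (G x)" "p - 1" 1] by (cases "G x = 0") auto
  have iI: "integrable lborel (\<lambda>x. norm (G x) powr (p - 2) * (G x \<bullet> D x))"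
  proof (rule Bochner_Integration.integrable_bound[OF Bochner_Integration.integrable_add[OF iG iD]])
    show "AE x in lborel. norm (norm (G x) powr (p - 2) * (G x \<bullet> D x)) \<le> norm (indicator (ball x\<^sub>0 b) x * norm (G x) powr p + norm (D x) powr p)"
    proof (rule AE_I2)
      fix x
      show "norm (norm (G x) powr (p - 2) * (G x \<bullet> D x)) \<le> norm (indicator (ball x\<^sub>0 b) x * norm (G x) powr p + norm (D x) powr p)"
      proof (cases "x \<in> ball x\<^sub>0 b")
        case True
        have "norm (norm (G x) powr (p - 2) * (G x \<bullet> D x)) \<le> norm (G x) powr (p - 2) * (norm (G x) * norm (D x))"
          using Cauchy_Schwarz_ineq2[of "G x" "D x"] by (simp add: abs_mult mult_left_mono)
        also have "\<dots> = norm (G x) powr (p - 1) * norm (D x)" by (simp add: Gp1[symmetric])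
        also have "\<dots> \<le> norm (G x) powr p + norm (D x) powr p"
        proof (cases "norm (D x) \<le> norm (G x)")
          case True
          have "norm (G x) powr (p - 1) * norm (D x) \<le> norm (G x) powr (p - 1) * norm (G x)"
            using True by (rule mult_left_mono) simp
          then show ?thesis by (simp add: Gp add_increasing2)
        next
          case False
          then have d: "0 < norm (D x)" using norm_ge_zero[of "G x"] by linarith
          have "norm (G x) powr (p - 1) * norm (D x) \<le> norm (D x) powr (p - 1) * norm (D x)"
            using False p by (intro mult_right_mono powr_mono2) auto
          also have "\<dots> = norm (D x) powr p" using powr_add[of "norm (D x)" "p - 1" 1] d by simp
          finally show ?thesis by (simp add: add_increasing)
        qed
        finally show ?thesis using True by simp
      next
        case False
        then have "D x = 0" using Db[of x] by simp
        then show ?thesis by simp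
      qed
    qed
  qed measurable
  let ?A = "ball x\<^sub>0 b \<inter> {x. f x < l}"
  define e where "e x = \<phi> x ^ n * indicator {x. f x < l} x * norm (G x) powr p" for x
  define K where "K = 2 powr (p - 1) * (real n * l * L) powr p"
  have iA: "integrable lborel (indicator ?A :: 'a \<Rightarrow> real)"
    using finite_ball_Int[of x\<^sub>0 b "{x. f x < l}"] by simp
  have "(\<integral>x. norm (G x) powr (p - 2) * (G x \<bullet> D x) \<partial>lborel) \<le> (\<integral>x. - (1 / 2) * e x + K * indicator ?A x \<partial>lborel)"
  proof (rule integral_mono[OF iI])
    show "integrable lborel (\<lambda>x. - (1 / 2) * e x + K * indicator ?A x)"
      using iE iA unfolding e_def by simp
    fix x
    show "norm (G x) powr (p - 2) * (G x \<bullet> D x) \<le> - (1 / 2) * e x + K * indicator ?A x"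
    proof (cases "x \<in> ?A")
      case False
      have "D x = 0"
      proof (cases "f x < l")
        case True
        then have "x \<notin> ball x\<^sub>0 b" using False by simp
        then show ?thesis using Db[of x] by simp
      qed (simp add: D_def)
      moreover have "e x = 0"
        using False \<phi>1(3)[of x] n by (cases "f x < l") (auto simp: e_def power_0_left)
      ultimately show ?thesis using False by simp
    next
      case True
      then have x: "x \<in> ball x\<^sub>0 b" "f x < l" "0 \<le> f x" using f0 by auto
      define t where "t = \<phi> x"
      have t: "0 \<le> t" "t \<le> 1" using \<phi>1 by (auto simp: t_def)
      define Z where "Z = norm (G x) * (t ^ n) powr (1 / p)"
      define Y where "Y = real n * l * L"
      have Z0: "0 \<le> Z" and Y0: "0 \<le> Y" using l L0 by (auto simp: Z_def Y_def)
      have Zp: "Z powr p = norm (G x) powr p * t ^ n"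
        unfolding Z_def using p t by (simp add: powr_mult powr_powr)
      have Zp1: "Z powr (p - 1) = norm (G x) powr (p - 1) * (t ^ n) powr ((p - 1) / p)"
        unfolding Z_def using p t by (simp add: powr_mult powr_powr)
      have ex: "e x = Z powr p" using x by (simp add: e_def Zp t_def)
      have "G x \<bullet> D x = (l - f x) * (G x \<bullet> grad (\<lambda>x. \<phi> x ^ n) x) - t ^ n * (norm (G x))\<^sup>2"
        unfolding D_def using x by (simp add: inner_diff_right t_def power2_norm_eq_inner)
      also have "\<dots> \<le> l * (norm (G x) * (real n * t ^ (n - 1) * L)) - t ^ n * (norm (G x))\<^sup>2"
      proof (rule diff_right_mono)
        have "G x \<bullet> grad (\<lambda>x. \<phi> x ^ n) x \<le> norm (G x) * (real n * t ^ (n - 1) * L)"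
          using norm_cauchy_schwarz[of "G x" "grad (\<lambda>x. \<phi> x ^ n) x"] mult_left_mono[OF tb2[of x] norm_ge_zero[of "G x"]]
          unfolding t_def by simp
        then have "(l - f x) * (G x \<bullet> grad (\<lambda>x. \<phi> x ^ n) x) \<le> (l - f x) * (norm (G x) * (real n * t ^ (n - 1) * L))"
          using x by (intro mult_left_mono) auto
        also have "\<dots> \<le> l * (norm (G x) * (real n * t ^ (n - 1) * L))"
          using x t L0 by (intro mult_right_mono) auto
        finally show "(l - f x) * (G x \<bullet> grad (\<lambda>x. \<phi> x ^ n) x) \<le> l * (norm (G x) * (real n * t ^ (n - 1) * L))" .
      qed
      finally have "norm (G x) powr (p - 2) * (G x \<bullet> D x)
        \<le> norm (G x) powr (p - 2) * (l * (norm (G x) * (real n * t ^ (n - 1) * L)) - t ^ n * (norm (G x))\<^sup>2)"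
        by (rule mult_left_mono) simp
      also have "\<dots> = (norm (G x) powr (p - 2) * norm (G x)) * t ^ (n - 1) * Y - t ^ n * ((norm (G x) powr (p - 2) * norm (G x)) * norm (G x))"
        by (simp add: Y_def power2_eq_square algebra_simps)
      also have "\<dots> = norm (G x) powr (p - 1) * t ^ (n - 1) * Y - Z powr p"
        unfolding Gp1 Gp Zp by (simp add: mult.commute)
      also have "\<dots> \<le> Z powr (p - 1) * Y - Z powr p"
        unfolding Zp1 using power_le_powr[OF t p] Y0
        by (intro diff_right_mono mult_right_mono mult_left_mono) auto
      also have "\<dots> \<le> - (1 / 2) * e x + K"
        unfolding ex K_def using young_absorb[OF p(1) Z0 Y0] by (simp add: Y_def)
      finally show ?thesis using True by simp
    qed
  qed
  also have "\<dots> = - (1 / 2) * (\<integral>x. e x \<partial>lborel) + K * measure lborel ?A"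
    using iE iA unfolding e_def by simp
  finally show ?I unfolding e_def K_def .
qed

section \<open>Admissible test functions, representatives and the tail\<close>

lemma weak_pair_W1p_zero:
  fixes v :: "'a::euclidean_space \<Rightarrow> real"
  assumes w: "weak_pair v D" and v: "integrable lborel (\<lambda>x. norm (v x) powr p)" and D: "integrable lborel (\<lambda>x. norm (D x) powr p)"
    and z: "\<And>x. x \<notin> S \<Longrightarrow> v x = 0"
  shows "W1p_zero p S v"
proof -
  note [measurable] = weak_pairD(3,4)[OF w]
  have Lp: "Lp_on p UNIV F" if [measurable]: "F \<in> borel_measurable borel" and "integrable lborel (\<lambda>x. norm (F x) powr p)"
    for F :: "'a \<Rightarrow> 'c::euclidean_space"
    unfolding Lp_on_def lebesgue_on_UNIV_eq using that by (auto simp: integrable_completion intro: measurable_completion)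
  have "Lp_on p UNIV v" by (rule Lp[OF _ v]) measurable
  moreover have "Lp_on p UNIV D" by (rule Lp[OF _ D]) measurable
  ultimately show ?thesis unfolding W1p_zero_def W1p_def using weak_pair_is_weak_grad[OF w] z by auto
qed

text \<open>U represents u on the whole space, as the nonlocal form requires; f is U times a cutoff
  that equals 1 on B_9r and vanishes outside B_10r, and it carries an integrable gradient. They
  agree on B_9r.\<close>

lemma supersolution_representative:
  fixes u :: "'a::euclidean_space \<Rightarrow> real"
  assumes super: "weak_supersolution \<mu> p \<Omega> u" and sub: "ball x\<^sub>0 R \<subseteq> \<Omega>"
    and nn: "AE x in lebesgue. x \<in> ball x\<^sub>0 R \<longrightarrow> 0 \<le> u x" and r: "0 < r" "16 * r < R"
  obtains U f G where "U \<in> borel_measurable borel" "AE x in lborel. u x = U x" "\<And>x. x \<in> ball x\<^sub>0 R \<Longrightarrow> 0 \<le> U x"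
    "weak_pair f G" "\<And>x. x \<in> ball x\<^sub>0 (9 * r) \<Longrightarrow> f x = U x"
    "integrable lborel (\<lambda>x. indicator (ball x\<^sub>0 (9 * r)) x * norm (G x) powr p)"
    "AE x in lborel. x \<in> ball x\<^sub>0 (9 * r) \<longrightarrow> weak_grad \<Omega> u x = G x"
proof -
  \<comment> \<open>The tail space makes u measurable on every ball; the truncations to growing
    balls converge pointwise.\<close>
  have um: "u \<in> borel_measurable lebesgue"
  proof (rule borel_measurable_LIMSEQ_real)
    fix i :: nat
    have "Lp_on (p - 1) (cball 0 (real i)) u"
      using super by (auto simp: weak_supersolution_def tail_space_def Lp_loc_def)
    then have "u \<in> borel_measurable (lebesgue_on (cball 0 (real i)))" by (simp add: Lp_on_def)
    then show "(\<lambda>x. indicator (cball 0 (real i)) x *\<^sub>R u x) \<in> borel_measurable lebesgue"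
      by (subst (asm) borel_measurable_restrict_space_iff) auto
  next
    fix x :: 'a
    obtain n :: nat where n: "norm x \<le> real n" using real_arch_simple by blast
    have "\<forall>\<^sub>F i in sequentially. u x = indicator (cball 0 (real i)) x *\<^sub>R u x"
      using eventually_ge_at_top[of n] by eventually_elim (use n in auto)
    then show "(\<lambda>i. indicator (cball 0 (real i)) x *\<^sub>R u x) \<longlonglongrightarrow> u x"
      by (rule Lim_transform_eventually[OF tendsto_const])
  qed
  obtain U0 where U0 [measurable]: "U0 \<in> borel_measurable borel" and ae0: "AE x in lborel. u x = U0 x"
    using lebesgue_measurable_borel_version[OF um] by auto
  \<comment> \<open>Clamping alters U0 on a null set only and makes nonnegativity hold at every
    point of B_R, as the pointwise estimates demand.\<close>
  define U where "U x = (if x \<in> ball x\<^sub>0 R then max 0 (U0 x) else U0 x)" for x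
  have [measurable]: "ball x\<^sub>0 t \<in> sets borel" for t by simp
  have Um [measurable]: "U \<in> borel_measurable borel" unfolding U_def by measurable
  have nn': "AE x in lborel. x \<in> ball x\<^sub>0 R \<longrightarrow> 0 \<le> u x" using nn by (simp add: AE_completion_iff)
  have ae: "AE x in lborel. u x = U x" using ae0 nn' by eventually_elim (auto simp: U_def)
  have U0: "0 \<le> U x" if "x \<in> ball x\<^sub>0 R" for x using that by (simp add: U_def)
  obtain g0 where g0: "is_weak_grad \<Omega> u g0" "Lp_loc p \<Omega> g0"
    using super by (auto simp: weak_supersolution_def W1p_loc_def)
  \<comment> \<open>Integrability to the power p is known for the witness g0, while the equation
    speaks of the chosen \<open>weak_grad\<close>; uniqueness will identify the two.\<close>
  have wg: "is_weak_grad \<Omega> u (weak_grad \<Omega> u)" unfolding weak_grad_def using g0(1) by (rule someI[of "is_weak_grad \<Omega> u"])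
  have "0 < 9 * r" "9 * r < 10 * r" using r by auto
  then obtain L \<xi> where \<xi>: "cutoff x\<^sub>0 (9 * r) (10 * r) L \<xi>" using cutoff_exists[where 'a='a] by blast
  have incl: "cball x\<^sub>0 (10 * r) \<subseteq> \<Omega>"
    using sub r by (auto intro!: subsetD[OF sub])
  then have t: "test_function \<Omega> \<xi>" by (rule cutoff_test_function[OF \<xi>])
  have \<xi>1: "\<xi> x = 1" "grad \<xi> x = 0" if "x \<in> ball x\<^sub>0 (9 * r)" for x
  proof -
    have 1: "\<xi> y = 1" if "y \<in> ball x\<^sub>0 (9 * r)" for y using \<xi> that by (auto simp: cutoff_def)
    show "\<xi> x = 1" by (rule 1[OF that])
    show "grad \<xi> x = 0" by (rule grad_const_open[OF open_ball 1 that])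
  qed
  note [measurable] = smooth_measurable[OF test_function_smooth[OF t]]
  obtain f1 G where f1: "weak_pair f1 G" "AE x in lborel. f1 x = \<xi> x * u x"
    "AE x in lborel. G x = \<xi> x *\<^sub>R g0 x + u x *\<^sub>R grad \<xi> x"
    using weak_grad_localize[OF g0(1) t] .
  note [measurable] = weak_pairD(4)[OF f1(1)]
  have wp: "weak_pair (\<lambda>x. \<xi> x * U x) G"
  proof (rule weak_pair_cong_AE[OF f1(1)])
    show "AE x in lborel. f1 x = \<xi> x * U x" using f1(2) ae by eventually_elim simp
  qed measurable
  have Gg: "AE x in lborel. x \<in> ball x\<^sub>0 (9 * r) \<longrightarrow> G x = g0 x"
    using f1(3) by eventually_elim (auto simp: \<xi>1)
  have wgG: "AE x in lborel. x \<in> ball x\<^sub>0 (9 * r) \<longrightarrow> weak_grad \<Omega> u x = G x"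
    using Gg weak_grad_unique[OF wg g0(1) t] by eventually_elim (auto simp: \<xi>1)
  have "Lp_on p (cball x\<^sub>0 (9 * r)) g0"
  proof -
    have "cball x\<^sub>0 (9 * r) \<subseteq> cball x\<^sub>0 (10 * r)" using r by auto
    then have "cball x\<^sub>0 (9 * r) \<subseteq> \<Omega>" using incl by blast
    then show ?thesis using g0(2) by (simp add: Lp_loc_def)
  qed
  then obtain k where k: "k \<in> borel_measurable borel" "AE x in lborel. indicator (cball x\<^sub>0 (9 * r)) x *\<^sub>R g0 x = k x"
    "integrable lborel (\<lambda>x. norm (k x) powr p)"
    using Lp_on_compact_borel_version[of p "cball x\<^sub>0 (9 * r)" g0] by (metis compact_cball)
  have "integrable lborel (\<lambda>x. indicator (ball x\<^sub>0 (9 * r)) x * norm (G x) powr p)"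
  proof (rule integrable_cong_AE_imp)
    show "integrable lborel (\<lambda>x. indicator (ball x\<^sub>0 (9 * r)) x * norm (k x) powr p)"
      using integrable_mult_indicator[OF _ k(3), of "ball x\<^sub>0 (9 * r)"] by simp
    show "AE x in lborel. indicator (ball x\<^sub>0 (9 * r)) x * norm (k x) powr p = indicator (ball x\<^sub>0 (9 * r)) x * norm (G x) powr p"
      using k(2) Gg
    proof eventually_elim
      fix x assume a: "indicator (cball x\<^sub>0 (9 * r)) x *\<^sub>R g0 x = k x" "x \<in> ball x\<^sub>0 (9 * r) \<longrightarrow> G x = g0 x"
      show "indicator (ball x\<^sub>0 (9 * r)) x * norm (k x) powr p = indicator (ball x\<^sub>0 (9 * r)) x * norm (G x) powr p"
      proof (cases "x \<in> ball x\<^sub>0 (9 * r)")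
        case True
        then have "x \<in> cball x\<^sub>0 (9 * r)" using ball_subset_cball by blast
        then show ?thesis using a True by simp
      qed simp
    qed
  qed measurable
  note int = this
  show thesis
    by (rule that[OF Um ae U0 wp _ int wgG]) (simp_all add: \<xi>1)
qed

text \<open>R^p times this is the power p - 1 of \<open>Tail\<close> of u_- at radius R, infinite
  values included.\<close>

definition tail_integral ::
    "real measure \<Rightarrow> real \<Rightarrow> ('a::euclidean_space \<Rightarrow> real) \<Rightarrow> 'a \<Rightarrow> real \<Rightarrow> ennreal" where
  "tail_integral \<mu> p u x\<^sub>0 R =
     (\<integral>\<^sup>+s\<in>{0<..<1}. ennreal (C_norm (real DIM('a)) p s) *
        (\<integral>\<^sup>+y\<in>- ball x\<^sub>0 R. ennreal (\<bar>max (- u y) 0\<bar> powr (p - 1) / norm (y - x\<^sub>0) powr (real DIM('a) + s * p)) \<partial>lebesgue) \<partial>\<mu>)"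

lemma tail_inner_eq:
  fixes u U :: "'a::euclidean_space \<Rightarrow> real"
  assumes ae: "AE x in lborel. u x = U x"
  shows "(\<integral>\<^sup>+y\<in>- ball x\<^sub>0 R. ennreal (\<bar>max (- u y) 0\<bar> powr (p - 1) / norm (y - x\<^sub>0) powr (real DIM('a) + s * p)) \<partial>lebesgue)
    = (\<integral>\<^sup>+y. indicator (- ball x\<^sub>0 R) y * ennreal ((max 0 (- U y)) powr (p - 1) / norm (y - x\<^sub>0) powr (real DIM('a) + s * p)) \<partial>lborel)"
  unfolding nn_integral_completion
  by (rule nn_integral_cong_AE, use ae in eventually_elim) (auto simp: max.commute mult.commute)

text \<open>For a Borel representative the kernel is jointly measurable in s and y, so the inner
  integral is measurable in s; \<open>C_norm\<close> is continuous on [0,1], whose Borel sets are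
  those of \<mu>.\<close>

lemma tail_integrand_measurable:
  fixes u U :: "'a::euclidean_space \<Rightarrow> real"
  assumes adm: "admissible_measure \<mu>" and p: "1 < p" and [measurable]: "U \<in> borel_measurable borel" and ae: "AE x in lborel. u x = U x"
  shows "(\<lambda>s. ennreal (C_norm (real DIM('a)) p s) *
        (\<integral>\<^sup>+y\<in>- ball x\<^sub>0 R. ennreal (\<bar>max (- u y) 0\<bar> powr (p - 1) / norm (y - x\<^sub>0) powr (real DIM('a) + s * p)) \<partial>lebesgue)
        * indicator {0<..<1} s) \<in> borel_measurable \<mu>"
proof -
  have [measurable]: "ball x\<^sub>0 R \<in> sets borel" by simp
  have sets: "sets \<mu> = sets (restrict_space borel {0..1})" using adm by (simp add: admissible_measure_def)
  have C: "C_norm (real DIM('a)) p \<in> borel_measurable (restrict_space borel {0..1})"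
    using C_norm_bound[of "real DIM('a)" p] p by (intro borel_measurable_continuous_on_restrict) auto
  have T: "(\<lambda>s. \<integral>\<^sup>+y. indicator (- ball x\<^sub>0 R) y * ennreal ((max 0 (- U y)) powr (p - 1) / norm (y - x\<^sub>0) powr (real DIM('a) + s * p)) \<partial>lborel)
    \<in> borel_measurable borel"
    by measurable
  have "(\<lambda>s. ennreal (C_norm (real DIM('a)) p s) *
      (\<integral>\<^sup>+y. indicator (- ball x\<^sub>0 R) y * ennreal ((max 0 (- U y)) powr (p - 1) / norm (y - x\<^sub>0) powr (real DIM('a) + s * p)) \<partial>lborel)
        * indicator {0<..<1} s) \<in> borel_measurable (restrict_space borel {0..1})"
    by (intro borel_measurable_times_ennreal measurable_compose[OF C] measurable_restrict_space1[OF T]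
        measurable_restrict_space1[OF borel_measurable_indicator]) auto
  then show ?thesis unfolding tail_inner_eq[OF ae] measurable_cong_sets[OF sets refl] .
qed

text \<open>The factor s (1 - s) of the normalization constant cancels the singularity of the kernel
  integral, so the near part is bounded uniformly in s and the finiteness of \<mu> suffices. The far
  part integrates to the tail, which l >= \<tau> bounds by l^(p-1) r^(-p).\<close>

lemma nonlocal_term_bound:
  fixes u U v :: "'a::euclidean_space \<Rightarrow> real"
  assumes adm: "admissible_measure \<mu>" and p: "1 < p" "p \<le> real n"
    and M: "\<And>s. s \<in> {0<..<1} \<Longrightarrow> 0 \<le> C_norm (real DIM('a)) p s \<and> C_norm (real DIM('a)) p s \<le> M * (s * (1 - s))" "0 < M"
    and Um: "U \<in> borel_measurable borel" and ae: "AE x in lborel. u x = U x"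
    and U: "\<And>x. x \<in> ball x\<^sub>0 R \<Longrightarrow> 0 \<le> U x"
    and l: "0 < \<tau>" "\<tau> \<le> l" and b: "b \<le> 8 * r" "16 * r < R" "0 < r"
    and \<phi>: "cutoff x\<^sub>0 a b L \<phi>" and L: "1 \<le> L" "1 \<le> L * (8 * r)"
    and v: "\<And>x. v x = \<phi> x ^ n * max 0 (l - U x)"
    and tail: "tail_integral \<mu> p u x\<^sub>0 R \<le> ennreal (\<tau> powr (p - 1) * r powr (- p))"
  defines "Kk \<equiv> unit_ball_vol (real DIM('a)) * 2 powr (real DIM('a) + p) * ((1 + p * ln 2) / (p * ln 2))"
  shows "(LINT s:{0<..<1}|\<mu>. C_norm (real DIM('a)) p s * nonlocal_form p s u v)
    \<le> 2 * measure lborel (ball x\<^sub>0 b \<inter> {x. U x < l}) * l powr p *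
      (2 powr p * real n powr p * M * Kk * L powr p * measure \<mu> {0<..<1} + 2 powr p * 2 powr (real DIM('a) + p) * r powr (- p))"
proof -
  let ?N = "real DIM('a)"
  have l0: "0 < l" using l by simp
  have fin: "finite_measure \<mu>" and sets: "sets \<mu> = sets (restrict_space borel {0..1})" using adm by (auto simp: admissible_measure_def)
  interpret finite_measure \<mu> by (rule fin)
  have I01: "{0<..<1::real} \<in> sets \<mu>" unfolding sets sets_restrict_space by (rule image_eqI[of _ _ "{0<..<1}"]) auto
  define mA where "mA = measure lborel (ball x\<^sub>0 b \<inter> {x. U x < l})"
  have emA: "emeasure lborel (ball x\<^sub>0 b \<inter> {x. U x < l}) = ennreal mA" unfolding mA_def by (rule emeasure_ball_Int)
  have mA0: "0 \<le> mA" by (simp add: mA_def)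
  have Kk0: "0 \<le> Kk" unfolding Kk_def using p by simp
  define c1 where "c1 = 2 powr p * real n powr p * l powr p"
  define c2 where "c2 = 2 powr p * 2 powr (?N + p) * l"
  have c: "0 \<le> c1" "0 \<le> c2" using l0 by (auto simp: c1_def c2_def)
  define T where "T s = (\<integral>\<^sup>+y\<in>- ball x\<^sub>0 R. ennreal (\<bar>max (- u y) 0\<bar> powr (p - 1) / norm (y - x\<^sub>0) powr (?N + s * p)) \<partial>lebesgue)" for s
  define B1 where "B1 = 2 * ennreal mA * ennreal (c1 * (M * Kk * L powr p))"
  define B2 where "B2 = 2 * ennreal mA * ennreal c2"
  have pt: "ennreal (C_norm ?N p s * nonlocal_form p s u v) \<le> B1 + B2 * (ennreal (C_norm ?N p s) * T s)" if s: "s \<in> {0<..<1}" for s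
  proof -
    define k where "k = (\<integral>\<^sup>+z. ennreal ((min 1 (L * norm (z::'a))) powr p / norm z powr (?N + s * p)) \<partial>lborel)"
    have s': "0 < s" "s < 1" using s by auto
    have "ennreal (nonlocal_form p s u v) \<le> (\<integral>\<^sup>+z. ennreal (case z of (x, y) \<Rightarrow>
        \<bar>u x - u y\<bar> powr (p - 2) * (u x - u y) * (v x - v y) / norm (x - y) powr (?N + s * p)) \<partial>(lebesgue :: ('a \<times> 'a) measure))"
      unfolding nonlocal_form_def by (rule ennreal_integral_le_nn_integral)
    also have "\<dots> \<le> 2 * ennreal mA * (ennreal c1 * k + ennreal c2 * T s)"
      using nonlocal_bound[OF p s' Um ae U l0 b \<phi> L(2) v]
      unfolding emA T_def tail_inner_eq[OF ae] c1_def c2_def k_def .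
    finally have nl: "ennreal (nonlocal_form p s u v) \<le> 2 * ennreal mA * (ennreal c1 * k + ennreal c2 * T s)" .
    have "ennreal (C_norm ?N p s) * k \<le> ennreal (M * (s * (1 - s))) * ennreal (Kk * L powr p * (1 / (s * (1 - s))))"
      using M(1)[OF s] kernel_integral_bound[OF p(1) s' L(1), where 'a='a] unfolding k_def Kk_def
      by (intro mult_mono ennreal_leI) auto
    also have "\<dots> = ennreal (M * Kk * L powr p)"
      using s' M(2) Kk0 by (subst ennreal_mult[symmetric]) auto
    finally have Ck: "ennreal (C_norm ?N p s) * k \<le> ennreal (M * Kk * L powr p)" .
    have "ennreal (C_norm ?N p s * nonlocal_form p s u v) = ennreal (C_norm ?N p s) * ennreal (nonlocal_form p s u v)"
      using M(1)[OF s] by (intro ennreal_mult') auto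
    also have "\<dots> \<le> ennreal (C_norm ?N p s) * (2 * ennreal mA * (ennreal c1 * k + ennreal c2 * T s))"
      by (rule mult_left_mono[OF nl]) simp
    also have "\<dots> = 2 * ennreal mA * (ennreal c1 * (ennreal (C_norm ?N p s) * k)) + B2 * (ennreal (C_norm ?N p s) * T s)"
      by (simp add: B2_def distrib_left mult_ac)
    also have "\<dots> \<le> 2 * ennreal mA * (ennreal c1 * ennreal (M * Kk * L powr p)) + B2 * (ennreal (C_norm ?N p s) * T s)"
      by (intro add_right_mono mult_left_mono Ck) auto
    also have "2 * ennreal mA * (ennreal c1 * ennreal (M * Kk * L powr p)) = B1"
      unfolding B1_def using c M(2) Kk0 by (simp add: ennreal_mult[symmetric])
    finally show ?thesis .
  qed
  have meas: "(\<lambda>s. ennreal (C_norm ?N p s) * T s * indicator {0<..<1} s) \<in> borel_measurable \<mu>"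
    unfolding T_def by (rule tail_integrand_measurable[OF adm p(1) Um ae])
  have "ennreal (LINT s:{0<..<1}|\<mu>. C_norm ?N p s * nonlocal_form p s u v)
    \<le> (\<integral>\<^sup>+s. ennreal (indicator {0<..<1} s *\<^sub>R (C_norm ?N p s * nonlocal_form p s u v)) \<partial>\<mu>)"
    unfolding set_lebesgue_integral_def by (rule ennreal_integral_le_nn_integral)
  also have "\<dots> \<le> (\<integral>\<^sup>+s. B1 * indicator {0<..<1} s + B2 * (ennreal (C_norm ?N p s) * T s * indicator {0<..<1} s) \<partial>\<mu>)"
    using pt by (intro nn_integral_mono) (auto simp: indicator_def)
  also have "\<dots> = (\<integral>\<^sup>+s. B1 * indicator {0<..<1} s \<partial>\<mu>) + (\<integral>\<^sup>+s. B2 * (ennreal (C_norm ?N p s) * T s * indicator {0<..<1} s) \<partial>\<mu>)"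
    using I01 by (intro nn_integral_add borel_measurable_times_ennreal meas) auto
  also have "(\<integral>\<^sup>+s. B1 * indicator {0<..<1} s \<partial>\<mu>) = B1 * ennreal (measure \<mu> {0<..<1})"
    using I01 by (simp add: nn_integral_cmult_indicator emeasure_eq_measure)
  also have "(\<integral>\<^sup>+s. B2 * (ennreal (C_norm ?N p s) * T s * indicator {0<..<1} s) \<partial>\<mu>) = B2 * tail_integral \<mu> p u x\<^sub>0 R"
    using meas by (simp add: nn_integral_cmult tail_integral_def T_def)
  also have "B1 * ennreal (measure \<mu> {0<..<1}) + B2 * tail_integral \<mu> p u x\<^sub>0 R
    \<le> B1 * ennreal (measure \<mu> {0<..<1}) + B2 * ennreal (l powr (p - 1) * r powr (- p))"
  proof (intro add_left_mono mult_left_mono)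
    have "\<tau> powr (p - 1) \<le> l powr (p - 1)" using l p by (intro powr_mono2) auto
    then show "tail_integral \<mu> p u x\<^sub>0 R \<le> ennreal (l powr (p - 1) * r powr (- p))"
      by (intro order_trans[OF tail] ennreal_leI mult_right_mono) auto
  qed auto
  also have "\<dots> = ennreal (2 * mA * (c1 * (M * Kk * L powr p)) * measure \<mu> {0<..<1} + 2 * mA * c2 * (l powr (p - 1) * r powr (- p)))"
  proof -
    have 2: "2 * ennreal mA = ennreal (2 * mA)" using mA0 by (simp add: ennreal_mult)
    show ?thesis unfolding B1_def B2_def 2 using mA0 c M(2) Kk0
      by (simp add: ennreal_mult[symmetric] ennreal_plus[symmetric] del: ennreal_plus)
  qed
  also have "2 * mA * (c1 * (M * Kk * L powr p)) * measure \<mu> {0<..<1} + 2 * mA * c2 * (l powr (p - 1) * r powr (- p))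
    = 2 * mA * l powr p *
      (2 powr p * real n powr p * M * Kk * L powr p * measure \<mu> {0<..<1} + 2 powr p * 2 powr (?N + p) * r powr (- p))"
  proof -
    \<comment> \<open>The far interaction has one factor l from the test function and l^(p-1) from
      the tail, so both parts scale like l^p.\<close>
    have "l powr p = l * l powr (p - 1)" using l0 powr_add[of l 1 "p - 1"] by simp
    then show ?thesis unfolding c1_def c2_def by (simp add: algebra_simps)
  qed
  finally show ?thesis
    using mA0 M(2) Kk0 by (subst (asm) ennreal_le_iff) (auto simp: mA_def intro!: mult_nonneg_nonneg add_nonneg_nonneg)
qed

text \<open>The equation compares the local energy, which has the coefficient \<alpha> > 0, with the
  upper bound for the nonlocal term. The assumption on the tail is needed at the lowest level \<tau>
  only, since its bound increases with the level.\<close>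

lemma supersolution_caccioppoli:
  fixes p :: real and \<mu> :: "real measure"
  assumes p: "1 < p" and adm: "admissible_measure \<mu>"
  shows "\<exists>C\<ge>0. \<forall>(\<Omega> :: 'a::euclidean_space set) u x\<^sub>0 R r \<tau>.
    bounded \<Omega> \<longrightarrow> weak_supersolution \<mu> p \<Omega> u \<longrightarrow> ball x\<^sub>0 R \<subseteq> \<Omega> \<longrightarrow>
    (AE x in lebesgue. x \<in> ball x\<^sub>0 R \<longrightarrow> 0 \<le> u x) \<longrightarrow> 0 < r \<longrightarrow> r \<le> 1 \<longrightarrow> 16 * r < R \<longrightarrow> 0 < \<tau> \<longrightarrow>
    tail_integral \<mu> p u x\<^sub>0 R \<le> ennreal (\<tau> powr (p - 1) * r powr (- p)) \<longrightarrow>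
    (\<exists>f G. weak_pair f G \<and> (AE x in lborel. x \<in> ball x\<^sub>0 (8 * r) \<longrightarrow> f x = u x) \<and>
       (\<forall>x\<in>ball x\<^sub>0 (8 * r). 0 \<le> f x) \<and> caccioppoli p C f G x\<^sub>0 r \<tau>)"
proof -
  let ?N = "real DIM('a)"
  obtain \<Lambda>0 where \<Lambda>0: "1 \<le> \<Lambda>0" "\<And>(x\<^sub>0::'a) a b. 0 < a \<Longrightarrow> a < b \<Longrightarrow> \<exists>\<phi>. cutoff x\<^sub>0 a b (\<Lambda>0 / (b - a)) \<phi>"
    using cutoff_exists[where 'a='a] by blast
  \<comment> \<open>With k = b - a <= 8r <= 8, the factor 8 gives the slope L = \<Lambda> / k both L
    >= 1 and 8 r L >= 1, as the nonlocal estimates require.\<close>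
  define \<Lambda> where "\<Lambda> = 8 * \<Lambda>0"
  obtain M where M: "0 < M" "\<And>s. s \<in> {0<..<1} \<Longrightarrow> 0 \<le> C_norm ?N p s \<and> C_norm ?N p s \<le> M * (s * (1 - s))"
    using C_norm_bound[of ?N p] p by auto
  define n where "n = nat \<lceil>p\<rceil>"
  have n: "p \<le> real n" unfolding n_def by (rule real_nat_ceiling_ge)
  define Kk where "Kk = unit_ball_vol ?N * 2 powr (?N + p) * ((1 + p * ln 2) / (p * ln 2))"
  have Kk0: "0 \<le> Kk" unfolding Kk_def using p by simp
  define \<alpha> where "\<alpha> = measure \<mu> {1}"
  have \<alpha>: "0 < \<alpha>" using adm by (simp add: \<alpha>_def admissible_measure_def)
  \<comment> \<open>The nonlocal contribution after extracting (l / k)^p: \<Lambda>^p stems from L =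
    \<Lambda> / k and 8^p from 1 / r <= 8 / k.\<close>
  define Cn where "Cn = 2 * (2 powr p * real n powr p * M * Kk * \<Lambda> powr p * measure \<mu> {0<..<1} + 2 powr p * 2 powr (?N + p) * 8 powr p)"
  define Cl where "Cl = 2 powr (p - 1) * (real n * \<Lambda>) powr p"
  \<comment> \<open>The factor 2 / \<alpha> inverts the coefficient \<alpha> / 2 with which the
    energy survives.\<close>
  define C where "C = 2 / \<alpha> * (Cn + \<alpha> * Cl)"
  have Cn0: "0 \<le> Cn" unfolding Cn_def using M Kk0 by (intro mult_nonneg_nonneg add_nonneg_nonneg) auto
  have C0: "0 \<le> C" unfolding C_def using \<alpha> Cn0 by (simp add: Cl_def)
  have "\<exists>f G. weak_pair f G \<and> (AE x in lborel. x \<in> ball x\<^sub>0 (8 * r) \<longrightarrow> f x = u x) \<and>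
       (\<forall>x\<in>ball x\<^sub>0 (8 * r). 0 \<le> f x) \<and> caccioppoli p C f G x\<^sub>0 r \<tau>"
    if bd: "bounded \<Omega>" and super: "weak_supersolution \<mu> p \<Omega> u" and sub: "ball x\<^sub>0 R \<subseteq> \<Omega>"
      and nn: "AE x in lebesgue. x \<in> ball x\<^sub>0 R \<longrightarrow> 0 \<le> u x" and r: "0 < r" "r \<le> 1" "16 * r < R" and \<tau>: "0 < \<tau>"
      and tail: "tail_integral \<mu> p u x\<^sub>0 R \<le> ennreal (\<tau> powr (p - 1) * r powr (- p))"
    for \<Omega> :: "'a set" and u x\<^sub>0 R r \<tau>
  proof -
    obtain U f G where Um [measurable]: "U \<in> borel_measurable borel" and ae: "AE x in lborel. u x = U x"
      and U0: "\<And>x. x \<in> ball x\<^sub>0 R \<Longrightarrow> 0 \<le> U x"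
      and wp: "weak_pair f G" and fU: "\<And>x. x \<in> ball x\<^sub>0 (9 * r) \<Longrightarrow> f x = U x"
      and iG: "integrable lborel (\<lambda>x. indicator (ball x\<^sub>0 (9 * r)) x * norm (G x) powr p)"
      and wgG: "AE x in lborel. x \<in> ball x\<^sub>0 (9 * r) \<longrightarrow> weak_grad \<Omega> u x = G x"
      using supersolution_representative[OF super sub nn r(1,3)] by blast
    note [measurable] = weak_pairD(3,4)[OF wp]
    have in9: "x \<in> ball x\<^sub>0 (9 * r)" "x \<in> ball x\<^sub>0 R" if "x \<in> ball x\<^sub>0 b" "b \<le> 8 * r" for x b
      using that r by auto
    have f0: "0 \<le> f x" if "x \<in> ball x\<^sub>0 b" "b \<le> 8 * r" for x b
      using in9[OF that] U0 fU by simp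
    have cacc: "caccioppoli p C f G x\<^sub>0 r \<tau>"
      unfolding caccioppoli_def
    proof (intro allI impI)
      fix l a b assume l: "\<tau> \<le> l" and a: "0 < a" "a < b" and b: "b \<le> 8 * r"
      define k where "k = b - a"
      have k: "0 < k" "k \<le> 8 * r" "k \<le> 8" using a b r by (auto simp: k_def)
      have l0: "0 < l" using \<tau> l by simp
      define L where "L = \<Lambda> / k"
      have "8 / k \<le> L" unfolding L_def \<Lambda>_def using \<Lambda>0(1) k by (intro divide_right_mono) auto
      moreover have "1 \<le> 8 / k" using k by simp
      ultimately have L1: "1 \<le> L" by simp
      have "1 \<le> 8 / k * (8 * r)" using k by (simp add: field_simps)
      also have "\<dots> \<le> L * (8 * r)" using \<open>8 / k \<le> L\<close> r by (intro mult_right_mono) auto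
      finally have L2: "1 \<le> L * (8 * r)" .
      obtain \<phi> where \<phi>0: "cutoff x\<^sub>0 a b (\<Lambda>0 / k) \<phi>" using \<Lambda>0(2)[OF a, of x\<^sub>0] unfolding k_def by blast
      have "\<Lambda>0 / k \<le> L" unfolding L_def \<Lambda>_def using \<Lambda>0(1) k by (intro divide_right_mono) auto
      then have \<phi>: "cutoff x\<^sub>0 a b L \<phi>" using \<phi>0 unfolding cutoff_def by (meson order_trans)
      have \<phi>1: "0 \<le> \<phi> x" "\<phi> x \<le> 1" "x \<in> cball x\<^sub>0 a \<Longrightarrow> \<phi> x = 1" "x \<notin> ball x\<^sub>0 b \<Longrightarrow> \<phi> x = 0" for x
        using \<phi> by (auto simp: cutoff_def)
      have n0: "0 < n" using n p by (cases n) auto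
      have t: "test_function UNIV (\<lambda>x. \<phi> x ^ n)"
        by (rule test_function_power[OF cutoff_test_function[OF \<phi>] n0]) simp
      define v where "v x = \<phi> x ^ n * max 0 (l - f x)" for x
      define D where "D = (\<lambda>x. max 0 (l - f x) *\<^sub>R grad (\<lambda>x. \<phi> x ^ n) x - (\<phi> x ^ n * indicator {x. f x < l} x) *\<^sub>R G x)"
      have wv: "weak_pair v D" unfolding v_def D_def by (rule weak_pair_truncate[OF wp t])
      note [measurable] = weak_pairD(3,4)[OF wv]
      have [measurable]: "ball x\<^sub>0 b \<in> sets borel" by simp
      have iGb: "integrable lborel (\<lambda>x. indicator (ball x\<^sub>0 b) x * norm (G x) powr p)"
        by (rule Bochner_Integration.integrable_bound[OF iG]) (use in9[OF _ b] in \<open>auto simp: indicator_def intro!: AE_I2\<close>)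
      have f0b: "\<And>x. x \<in> ball x\<^sub>0 b \<Longrightarrow> 0 \<le> f x" using f0 b by blast
      have iD: "integrable lborel (\<lambda>x. norm (D x) powr p)"
        unfolding D_def by (rule local_bound(1)[OF p n \<phi> l0 _ weak_pairD(3,4)[OF wp] iGb]) (rule f0b)
      have iE: "integrable lborel (\<lambda>x. \<phi> x ^ n * indicator {x. f x < l} x * norm (G x) powr p)"
        by (rule local_bound(2)[OF p n \<phi> l0 _ weak_pairD(3,4)[OF wp] iGb]) (rule f0b)
      have loc_le: "(\<integral>x. norm (G x) powr (p - 2) * (G x \<bullet> D x) \<partial>lborel)
        \<le> - (1 / 2) * (\<integral>x. \<phi> x ^ n * indicator {x. f x < l} x * norm (G x) powr p \<partial>lborel)
          + 2 powr (p - 1) * (real n * l * L) powr p * measure lborel (ball x\<^sub>0 b \<inter> {x. f x < l})"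
        unfolding D_def by (rule local_bound(3)[OF p n \<phi> l0 _ weak_pairD(3,4)[OF wp] iGb]) (rule f0b)
      \<comment> \<open>Outside B_b the cutoff vanishes, so f and U give the same test function: f
        serves the local form, U the nonlocal one.\<close>
      have vU: "v x = \<phi> x ^ n * max 0 (l - U x)" for x
        using fU[OF in9(1)[OF _ b], of x] \<phi>1(4)[of x] n0 by (cases "x \<in> ball x\<^sub>0 b") (auto simp: v_def power_0_left)
      have v_out: "v x = 0" if "x \<notin> ball x\<^sub>0 b" for x
        using \<phi>1(4)[OF that] n0 by (simp add: v_def power_0_left)
      have D_out: "D x = 0" if "x \<notin> ball x\<^sub>0 b" for x
      proof -
        have "grad (\<lambda>x. \<phi> x ^ n) x = 0"
          by (rule truncation_grad_bound(1)[OF p n \<phi> l0 _ that]) (rule f0b)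
        then show ?thesis using \<phi>1(4)[OF that] n0 by (simp add: D_def power_0_left)
      qed
      have v_le: "\<bar>v x\<bar> powr p \<le> l powr p * indicator (ball x\<^sub>0 b) x" for x
      proof (cases "x \<in> ball x\<^sub>0 b")
        case True
        have "v x \<le> 1 * l" unfolding v_def using \<phi>1 f0b[OF True] l0 by (intro mult_mono power_le_one) auto
        then have "\<bar>v x\<bar> powr p \<le> l powr p" using \<phi>1(1)[of x] p by (intro powr_mono2) (auto simp: v_def)
        then show ?thesis using True by simp
      next
        case False
        then show ?thesis using v_out[OF False] by simp
      qed
      have ib: "integrable lborel (indicator (ball x\<^sub>0 b) :: 'a \<Rightarrow> real)"
        using emeasure_lborel_ball_finite[of x\<^sub>0 b] by simp
      have iv: "integrable lborel (\<lambda>x. norm (v x) powr p)"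
        by (rule Bochner_Integration.integrable_bound[where f="\<lambda>x. l powr p * indicator (ball x\<^sub>0 b) x"])
          (use ib v_le in \<open>auto intro!: AE_I2\<close>)
      \<comment> \<open>B_9r is the subdomain of the definition: it contains B_b, outside of which v
        vanishes, and its closure lies in B_R.\<close>
      have W: "W1p_zero p (ball x\<^sub>0 (9 * r)) v"
        by (rule weak_pair_W1p_zero[OF wv iv iD]) (use v_out in9(1)[OF _ b] in blast)
      have dom: "domain (ball x\<^sub>0 (9 * r))" using r by (auto simp: domain_def)
      have comp: "compactly_inside (ball x\<^sub>0 (9 * r)) \<Omega>"
        unfolding compactly_inside_def
      proof
        show "compact (closure (ball x\<^sub>0 (9 * r)))" by (simp add: compact_closure)
        have "closure (ball x\<^sub>0 (9 * r)) \<subseteq> cball x\<^sub>0 (9 * r)" by (intro closure_minimal) auto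
        also have "\<dots> \<subseteq> ball x\<^sub>0 R" using r by auto
        finally show "closure (ball x\<^sub>0 (9 * r)) \<subseteq> \<Omega>" using sub by blast
      qed
      have v0: "AE x in lebesgue. 0 \<le> v x" using \<phi>1(1) by (auto simp: v_def)
      have ineq: "0 \<le> (LINT s:{0<..<1}|\<mu>. C_norm ?N p s * nonlocal_form p s u v) + \<alpha> * local_form p \<Omega> u v"
        using super dom comp W v0 unfolding weak_supersolution_def \<alpha>_def by blast
      have loc: "local_form p \<Omega> u v = (\<integral>x. norm (G x) powr (p - 2) * (G x \<bullet> D x) \<partial>lborel)"
        unfolding local_form_def set_lebesgue_integral_def
      proof (rule integral_lebesgue_AE_eq)
        \<comment> \<open>Boundedness of \<Omega> enters here: a cutoff equal to 1 on all of
          \<Omega> identifies the chosen gradient of v with D throughout \<Omega>.\<close>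
        obtain \<rho> where \<rho>: "0 < \<rho>" "\<Omega> \<subseteq> cball x\<^sub>0 \<rho>"
        proof -
          obtain e where "\<forall>y\<in>\<Omega>. dist x\<^sub>0 y \<le> e" using bd bounded_any_center[of \<Omega> x\<^sub>0] by blast
          then have "\<Omega> \<subseteq> cball x\<^sub>0 (max 1 e)" by (auto simp: le_max_iff_disj)
          then show ?thesis using that[of "max 1 e"] by simp
        qed
        then have "0 < \<rho>" "\<rho> < 2 * \<rho>" by auto
        then obtain \<xi> where \<xi>: "cutoff x\<^sub>0 \<rho> (2 * \<rho>) (\<Lambda>0 / (2 * \<rho> - \<rho>)) \<xi>" using \<Lambda>0(2) by blast
        have \<xi>1: "\<xi> x = 1" if "x \<in> \<Omega>" for x using \<xi> \<rho>(2) that by (auto simp: cutoff_def)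
        have tx: "test_function UNIV \<xi>" by (rule cutoff_test_function[OF \<xi>]) simp
        have w1: "is_weak_grad UNIV v D" by (rule weak_pair_is_weak_grad[OF wv])
        then have w2: "is_weak_grad UNIV v (weak_grad UNIV v)"
          unfolding weak_grad_def by (rule someI[of "is_weak_grad UNIV v"])
        have "AE x in lborel. \<xi> x *\<^sub>R weak_grad UNIV v x = \<xi> x *\<^sub>R D x"
          by (rule weak_grad_unique[OF w2 w1 tx])
        with wgG show "AE x in lborel. indicator \<Omega> x *\<^sub>R (norm (weak_grad \<Omega> u x) powr (p - 2) * (weak_grad \<Omega> u x \<bullet> weak_grad UNIV v x))
          = norm (G x) powr (p - 2) * (G x \<bullet> D x)"
        proof eventually_elim
          fix x assume h: "x \<in> ball x\<^sub>0 (9 * r) \<longrightarrow> weak_grad \<Omega> u x = G x" "\<xi> x *\<^sub>R weak_grad UNIV v x = \<xi> x *\<^sub>R D x"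
          show "indicator \<Omega> x *\<^sub>R (norm (weak_grad \<Omega> u x) powr (p - 2) * (weak_grad \<Omega> u x \<bullet> weak_grad UNIV v x))
            = norm (G x) powr (p - 2) * (G x \<bullet> D x)"
          proof (cases "x \<in> ball x\<^sub>0 b")
            case True
            then have "x \<in> \<Omega>" using in9(2)[OF _ b] sub by blast
            then show ?thesis using h \<xi>1 in9(1)[OF True b] by simp
          next
            case False
            then show ?thesis using D_out[OF False] h(2) \<xi>1[of x] by (cases "x \<in> \<Omega>") auto
          qed
        qed
      qed measurable
      define mA where "mA = sublevel f x\<^sub>0 l b"
      have mA0: "0 \<le> mA" by (simp add: mA_def sublevel_nonneg)
      have sets_eq: "ball x\<^sub>0 b \<inter> {x. U x < l} = ball x\<^sub>0 b \<inter> {x. f x < l}"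
        using fU in9(1)[OF _ b] by force
      have rk: "r powr (- p) \<le> (8 / k) powr p"
      proof -
        have "(1 / r) powr p \<le> (8 / k) powr p" using k r p by (intro powr_mono2) (auto simp: field_simps)
        then show ?thesis using r by (simp add: powr_minus powr_divide inverse_eq_divide)
      qed
      have "(LINT s:{0<..<1}|\<mu>. C_norm ?N p s * nonlocal_form p s u v)
        \<le> 2 * mA * l powr p *
          (2 powr p * real n powr p * M * Kk * L powr p * measure \<mu> {0<..<1} + 2 powr p * 2 powr (?N + p) * r powr (- p))"
        using nonlocal_term_bound[OF adm p n M(2) M(1) Um ae U0 \<tau> l b r(3,1) \<phi> L1 L2 vU tail]
        unfolding sets_eq Kk_def mA_def sublevel_def .
      also have "\<dots> \<le> 2 * mA * l powr p *
          (2 powr p * real n powr p * M * Kk * L powr p * measure \<mu> {0<..<1} + 2 powr p * 2 powr (?N + p) * (8 / k) powr p)"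
        using mA0 by (intro mult_left_mono add_left_mono rk) auto
      also have "\<dots> = Cn * (l / k) powr p * mA"
        using k l0 \<Lambda>0(1) unfolding Cn_def L_def by (simp add: powr_divide \<Lambda>_def field_simps)
      finally have NL: "(LINT s:{0<..<1}|\<mu>. C_norm ?N p s * nonlocal_form p s u v) \<le> Cn * (l / k) powr p * mA" .
      define E where "E = (\<integral>x. \<phi> x ^ n * indicator {x. f x < l} x * norm (G x) powr p \<partial>lborel)"
      have "local_form p \<Omega> u v \<le> - (1 / 2) * E + 2 powr (p - 1) * (real n * l * L) powr p * mA"
        using loc_le unfolding loc E_def mA_def sublevel_def .
      also have "2 powr (p - 1) * (real n * l * L) powr p = Cl * (l / k) powr p"
        using k l0 \<Lambda>0(1) unfolding Cl_def L_def by (simp add: powr_divide powr_mult \<Lambda>_def)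
      finally have "\<alpha> * local_form p \<Omega> u v \<le> \<alpha> * (- (1 / 2) * E + Cl * (l / k) powr p * mA)"
        using \<alpha> by (intro mult_left_mono) auto
      \<comment> \<open>The supersolution inequality says that the local term is at least minus the
        nonlocal one; the energy - E / 2 moves to the other side.\<close>
      with NL ineq have "\<alpha> / 2 * E \<le> (Cn + \<alpha> * Cl) * (l / k) powr p * mA" by (simp add: algebra_simps)
      then have E: "E \<le> C * (l / k) powr p * mA" unfolding C_def using \<alpha> by (simp add: field_simps)
      have "(\<integral>\<^sup>+x. indicator (ball x\<^sub>0 a \<inter> {x. f x < l}) x * ennreal (norm (G x) powr p) \<partial>lborel)
        \<le> (\<integral>\<^sup>+x. ennreal (\<phi> x ^ n * indicator {x. f x < l} x * norm (G x) powr p) \<partial>lborel)"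
        using \<phi>1(3) by (intro nn_integral_mono) (auto simp: indicator_def)
      also have "\<dots> = ennreal E"
        unfolding E_def using iE \<phi>1(1) by (intro nn_integral_eq_integral) auto
      also have "\<dots> \<le> ennreal (C * (l / k) powr p * mA)" by (rule ennreal_leI[OF E])
      finally show "(\<integral>\<^sup>+x. indicator (ball x\<^sub>0 a \<inter> {x. f x < l}) x * ennreal (norm (G x) powr p) \<partial>lborel)
        \<le> ennreal (C * (l / (b - a)) powr p * sublevel f x\<^sub>0 l b)"
        unfolding k_def mA_def .
    qed
    have "AE x in lborel. x \<in> ball x\<^sub>0 (8 * r) \<longrightarrow> f x = u x"
      using ae by eventually_elim (use fU in9(1)[of _ "8 * r"] in auto)
    then show ?thesis using wp cacc f0[of _ "8 * r"] by blast
  qed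
  then show ?thesis using C0 by blast
qed

section \<open>Expansion of positivity\<close>

lemma ess_inf_ge:
  fixes u :: "'a::euclidean_space \<Rightarrow> real"
  assumes u: "u \<in> borel_measurable lebesgue" and S: "S \<in> sets lebesgue" and ae: "AE x in lborel. x \<in> S \<longrightarrow> c \<le> u x"
  shows "ereal c \<le> ess_inf S u"
proof -
  have "esssup (lebesgue_on S) (\<lambda>x. - ereal (u x)) \<le> - ereal c"
  proof (rule esssup_I)
    show "(\<lambda>x. - ereal (u x)) \<in> borel_measurable (lebesgue_on S)"
      using measurable_restrict_space1[OF u, of S] by measurable
    have "AE x in lebesgue. x \<in> S \<longrightarrow> - ereal (u x) \<le> - ereal c"
      by (rule AE_completion) (use ae in \<open>auto elim: eventually_mono\<close>)
    then show "AE x in lebesgue_on S. - ereal (u x) \<le> - ereal c"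
      using S by (simp add: AE_restrict_space_iff)
  qed
  then have "- (- ereal c) \<le> - esssup (lebesgue_on S) (\<lambda>x. - ereal (u x))" by (simp only: ereal_minus_le_minus)
  then show ?thesis unfolding ess_inf_def by simp
qed

text \<open>Raising the hypothesis to the power p - 1 turns (r / R)^(p/(p-1)) into (r / R)^p, and
  the R^p inside \<open>Tail\<close> cancels. This explains the exponent in the theorem.\<close>

lemma tail_integral_le_Tail:
  fixes u U :: "'a::euclidean_space \<Rightarrow> real"
  assumes adm: "admissible_measure \<mu>" and p: "1 < p" and Um: "U \<in> borel_measurable borel" and ae: "AE x in lborel. u x = U x"
    and r: "0 < r" "r < R" and \<tau>: "0 < \<tau>"
    and T: "ereal ((r / R) powr (p / (p - 1))) * enn2ereal (Tail \<mu> p (\<lambda>x. max (- u x) 0) x\<^sub>0 R) < ereal \<tau>"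
  shows "tail_integral \<mu> p u x\<^sub>0 R \<le> ennreal (\<tau> powr (p - 1) * r powr (- p))"
proof -
  define I where "I = (\<integral>\<^sup>+s\<in>{0<..<1}. ennreal (C_norm (real DIM('a)) p s * R powr p) *
                (\<integral>\<^sup>+y\<in>- ball x\<^sub>0 R.
                   ennreal (\<bar>max (- u y) 0\<bar> powr (p - 1) / norm (y - x\<^sub>0) powr (real DIM('a) + s * p))
                 \<partial>lebesgue) \<partial>\<mu>)"
  have Tail: "Tail \<mu> p (\<lambda>x. max (- u x) 0) x\<^sub>0 R = (if I = \<infinity> then \<infinity> else ennreal (enn2real I powr (1 / (p - 1))))"
    unfolding Tail_def I_def Let_def ..
  have R: "0 < R" using r by simp
  have "ennreal (R powr p) * tail_integral \<mu> p u x\<^sub>0 R = I"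
    unfolding I_def tail_integral_def
    by (subst nn_integral_cmult[OF tail_integrand_measurable[OF adm p Um ae], symmetric])
      (auto intro!: nn_integral_cong simp: ennreal_mult' mult_ac)
  note IR = this
  have c: "0 < (r / R) powr (p / (p - 1))" using r by simp
  \<comment> \<open>The factor in front of \<open>Tail\<close> is positive, so an infinite tail
    would contradict the finite bound \<tau>.\<close>
  have "I \<noteq> \<infinity>"
  proof
    assume "I = \<infinity>"
    then have "ereal ((r / R) powr (p / (p - 1))) * enn2ereal (Tail \<mu> p (\<lambda>x. max (- u x) 0) x\<^sub>0 R) = \<infinity>"
      using c by (simp add: Tail)
    then show False using T by simp
  qed
  then obtain i where i: "I = ennreal i" "0 \<le> i" by (cases I) auto
  have "(r / R) powr (p / (p - 1)) * i powr (1 / (p - 1)) < \<tau>"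
    using T i by (simp add: Tail enn2ereal_ennreal)
  then have "((r / R) powr (p / (p - 1)) * i powr (1 / (p - 1))) powr (p - 1) \<le> \<tau> powr (p - 1)"
    using p by (intro powr_mono2) auto
  also have "((r / R) powr (p / (p - 1)) * i powr (1 / (p - 1))) powr (p - 1) = (r / R) powr p * i"
    using p i r by (simp add: powr_mult powr_powr)
  finally have "i \<le> R powr p * (\<tau> powr (p - 1) * r powr (- p))"
    using r R by (simp add: powr_divide powr_minus field_simps)
  then have "I \<le> ennreal (R powr p) * ennreal (\<tau> powr (p - 1) * r powr (- p))"
    unfolding i(1) by (subst ennreal_mult[symmetric]) (auto intro: ennreal_leI)
  then show ?thesis
    unfolding IR[symmetric] using R by (subst (asm) ennreal_mult_le_mult_iff) auto
qed

theorem lemma5p2: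
  fixes p \<sigma> :: real and \<mu> :: "real measure"
  assumes "1 < p" and "admissible_measure \<mu>" and "0 < \<sigma>" and "\<sigma> \<le> 1"
  shows "\<exists>\<delta>::real. 0 < \<delta> \<and> \<delta> < 1 / 4 \<and>
    (\<forall>(\<Omega> :: 'a::euclidean_space set) (u :: 'a \<Rightarrow> real) x\<^sub>0 R r \<zeta>.
       domain \<Omega> \<longrightarrow> bounded \<Omega> \<longrightarrow>
       weak_supersolution \<mu> p \<Omega> u \<longrightarrow>
       ball x\<^sub>0 R \<subseteq> \<Omega> \<longrightarrow>
       (AE x in lebesgue. x \<in> ball x\<^sub>0 R \<longrightarrow> 0 \<le> u x) \<longrightarrow>
       0 \<le> \<zeta> \<longrightarrow>
       0 < r \<longrightarrow> r \<le> 1 \<longrightarrow> 16 * r < R \<longrightarrow>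
       measure lebesgue ({x. \<zeta> \<le> u x} \<inter> ball x\<^sub>0 r) \<ge> \<sigma> * measure lebesgue (ball x\<^sub>0 r) \<longrightarrow>
       ess_inf (ball x\<^sub>0 (4 * r)) u
         \<ge> ereal (\<delta> * \<zeta>)
           - ereal ((r / R) powr (p / (p - 1))) * enn2ereal (Tail \<mu> p (\<lambda>x. max (- u x) 0) x\<^sub>0 R))"
proof -
  obtain C where C: "0 \<le> C" "\<And>(\<Omega> :: 'a set) u x\<^sub>0 R r \<tau>. bounded \<Omega> \<Longrightarrow> weak_supersolution \<mu> p \<Omega> u \<Longrightarrow> ball x\<^sub>0 R \<subseteq> \<Omega> \<Longrightarrow>
    (AE x in lebesgue. x \<in> ball x\<^sub>0 R \<longrightarrow> 0 \<le> u x) \<Longrightarrow> 0 < r \<Longrightarrow> r \<le> 1 \<Longrightarrow> 16 * r < R \<Longrightarrow> 0 < \<tau> \<Longrightarrow>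
    tail_integral \<mu> p u x\<^sub>0 R \<le> ennreal (\<tau> powr (p - 1) * r powr (- p)) \<Longrightarrow>
    \<exists>f G. weak_pair f G \<and> (AE x in lborel. x \<in> ball x\<^sub>0 (8 * r) \<longrightarrow> f x = u x) \<and>
       (\<forall>x\<in>ball x\<^sub>0 (8 * r). 0 \<le> f x) \<and> caccioppoli p C f G x\<^sub>0 r \<tau>"
    using supersolution_caccioppoli[OF assms(1,2), where 'a='a] by blast
  obtain \<delta> where \<delta>: "0 < \<delta>" "\<delta> < 1 / 4" "\<And>(f :: 'a \<Rightarrow> real) G x\<^sub>0 r \<zeta>.
    weak_pair f G \<Longrightarrow> 0 < r \<Longrightarrow> 0 < \<zeta> \<Longrightarrow> (\<forall>x\<in>ball x\<^sub>0 (8 * r). 0 \<le> f x) \<Longrightarrow>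
    caccioppoli p C f G x\<^sub>0 r (\<delta> * \<zeta>) \<Longrightarrow>
    \<sigma> * measure lborel (ball x\<^sub>0 r) \<le> measure lborel ({x. \<zeta> \<le> f x} \<inter> ball x\<^sub>0 r) \<Longrightarrow>
    sublevel f x\<^sub>0 (\<delta> * \<zeta>) (4 * r) = 0"
    using degiorgi_positivity[OF assms(1) C(1) assms(3), where 'a='a] by blast
  have "ereal (\<delta> * \<zeta>) - ereal ((r / R) powr (p / (p - 1))) * enn2ereal (Tail \<mu> p (\<lambda>x. max (- u x) 0) x\<^sub>0 R)
      \<le> ess_inf (ball x\<^sub>0 (4 * r)) u"
    if bd: "bounded \<Omega>" and super: "weak_supersolution \<mu> p \<Omega> u" and sub: "ball x\<^sub>0 R \<subseteq> \<Omega>"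
      and nn: "AE x in lebesgue. x \<in> ball x\<^sub>0 R \<longrightarrow> 0 \<le> u x" and \<zeta>: "0 \<le> \<zeta>" and r: "0 < r" "r \<le> 1" "16 * r < R"
      and dens: "measure lebesgue ({x. \<zeta> \<le> u x} \<inter> ball x\<^sub>0 r) \<ge> \<sigma> * measure lebesgue (ball x\<^sub>0 r)"
    for \<Omega> :: "'a set" and u x\<^sub>0 R r \<zeta>
  proof -
    define t where "t = ereal ((r / R) powr (p / (p - 1))) * enn2ereal (Tail \<mu> p (\<lambda>x. max (- u x) 0) x\<^sub>0 R)"
    have t0: "0 \<le> t" unfolding t_def by (intro ereal_0_le_mult) auto
    obtain U where Um [measurable]: "U \<in> borel_measurable borel" and ae: "AE x in lborel. u x = U x"
      using supersolution_representative[OF super sub nn r(1,3)] by metis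
    have um: "u \<in> borel_measurable lebesgue" by (rule lebesgue_measurable_AE_eq[OF Um ae])
    have b4: "ball x\<^sub>0 (4 * r) \<in> sets lebesgue" "ball x\<^sub>0 r \<in> sets lebesgue" by auto
    have nn': "AE x in lborel. x \<in> ball x\<^sub>0 R \<longrightarrow> 0 \<le> u x" using nn by (simp add: AE_completion_iff)
    have sub4: "ball x\<^sub>0 (4 * r) \<subseteq> ball x\<^sub>0 R" using r by auto
    have inf0: "ereal 0 \<le> ess_inf (ball x\<^sub>0 (4 * r)) u"
      by (rule ess_inf_ge[OF um b4(1)], use nn' in eventually_elim) (use sub4 in blast)
    show ?thesis
    \<comment> \<open>The dichotomy of the overview; an infinite tail falls under the trivial case,
      where u >= 0 is enough.\<close>
    proof (cases "t < ereal (\<delta> * \<zeta>)")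
      case False
      then have "ereal (\<delta> * \<zeta>) - t \<le> 0" by (simp add: ereal_diff_le_self ereal_minus_le_iff not_less t0)
      also have "0 \<le> ess_inf (ball x\<^sub>0 (4 * r)) u" using inf0 by (simp add: zero_ereal_def)
      finally show ?thesis unfolding t_def .
    next
      case True
      \<comment> \<open>Since t >= 0, this case excludes \<zeta> = 0.\<close>
      then have \<tau>: "0 < \<delta> * \<zeta>" using t0 by (metis ereal_less(2) order_le_less_trans)
      then have \<zeta>0: "0 < \<zeta>" using \<delta>(1) by (simp add: zero_less_mult_iff)
      have "r < R" using r by simp
      have "tail_integral \<mu> p u x\<^sub>0 R \<le> ennreal ((\<delta> * \<zeta>) powr (p - 1) * r powr (- p))"
        by (rule tail_integral_le_Tail[OF assms(2,1) Um ae r(1) \<open>r < R\<close> \<tau> True[unfolded t_def]])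
      from C(2)[OF bd super sub nn r \<tau> this] obtain f G
        where f: "weak_pair f G" "AE x in lborel. x \<in> ball x\<^sub>0 (8 * r) \<longrightarrow> f x = u x"
          "\<forall>x\<in>ball x\<^sub>0 (8 * r). 0 \<le> f x" "caccioppoli p C f G x\<^sub>0 r (\<delta> * \<zeta>)" by blast
      note [measurable] = weak_pairD(3)[OF f(1)]
      have [measurable]: "ball x\<^sub>0 s \<in> sets borel" for s by simp
      have mB: "{x. \<zeta> \<le> f x} \<inter> ball x\<^sub>0 r \<in> sets borel" "ball x\<^sub>0 (4 * r) \<inter> {x. f x < \<delta> * \<zeta>} \<in> sets borel" by measurable
      \<comment> \<open>The density hypothesis passes from u to its Borel representative f, with
        which it agrees almost everywhere in B_8r.\<close>
      have "measure lebesgue ({x. \<zeta> \<le> u x} \<inter> ball x\<^sub>0 r) = measure lebesgue ({x. \<zeta> \<le> f x} \<inter> ball x\<^sub>0 r)"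
      proof (rule measure_eq_AE)
        have "AE x in lborel. x \<in> {x. \<zeta> \<le> u x} \<inter> ball x\<^sub>0 r \<longleftrightarrow> x \<in> {x. \<zeta> \<le> f x} \<inter> ball x\<^sub>0 r"
          using f(2) by eventually_elim (use r in auto)
        then show "AE x in lebesgue. x \<in> {x. \<zeta> \<le> u x} \<inter> ball x\<^sub>0 r \<longleftrightarrow> x \<in> {x. \<zeta> \<le> f x} \<inter> ball x\<^sub>0 r"
          by (rule AE_completion)
        have "{x \<in> space lebesgue. \<zeta> \<le> u x} \<in> sets lebesgue" using um by measurable
        then show "{x. \<zeta> \<le> u x} \<inter> ball x\<^sub>0 r \<in> sets lebesgue" using b4(2) by auto
        show "{x. \<zeta> \<le> f x} \<inter> ball x\<^sub>0 r \<in> sets lebesgue" using mB(1) by simp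
      qed
      then have "\<sigma> * measure lborel (ball x\<^sub>0 r) \<le> measure lborel ({x. \<zeta> \<le> f x} \<inter> ball x\<^sub>0 r)"
        using dens mB(1) by (simp add: measure_completion)
      from \<delta>(3)[OF f(1) r(1) \<zeta>0 f(3,4) this] have "sublevel f x\<^sub>0 (\<delta> * \<zeta>) (4 * r) = 0" .
      then have "emeasure lborel (ball x\<^sub>0 (4 * r) \<inter> {x. f x < \<delta> * \<zeta>}) = 0"
        unfolding emeasure_ball_Int sublevel_def by simp
      then have "ball x\<^sub>0 (4 * r) \<inter> {x. f x < \<delta> * \<zeta>} \<in> null_sets lborel" using mB(2) by (simp add: null_sets_def)
      from AE_not_in[OF this] f(2) have "AE x in lborel. x \<in> ball x\<^sub>0 (4 * r) \<longrightarrow> \<delta> * \<zeta> \<le> u x"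
        by eventually_elim (use r in auto)
      then have "ereal (\<delta> * \<zeta>) \<le> ess_inf (ball x\<^sub>0 (4 * r)) u" by (rule ess_inf_ge[OF um b4(1)])
      moreover have "ereal (\<delta> * \<zeta>) - t \<le> ereal (\<delta> * \<zeta>)" using t0 by (simp add: ereal_diff_le_self)
      ultimately show ?thesis unfolding t_def[symmetric] by (rule order_trans[rotated])
    qed
  qed
  then show ?thesis using \<delta>(1,2) by (intro exI[of _ \<delta>]) blast
qed

end
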